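(* Let $\mathcal{C}$ be a symmetric monoidal category such that: (0) $\mathcal{C}$ has all equalizers and coequalizers (of parallel pairs); (1) the monoidal structure of $\mathcal{C}$ is bistable; (2) the category $\mathsf{Hopf}^{\mathsf{bc}}(\mathcal{C})$ of bicommutative Hopf monoids in $\mathcal{C}$ is abelian. Let $A,B$ be bicommutative Hopf monoids in $\mathcal{C}$ and let $\xi : A \to B$ be a Hopf monoid homomorphism. Then there exists a normalized generator integral $\mu_\xi$ along $\xi$ if and only if the following two conditions hold: (i) the kernel Hopf monoid $Ker(\xi)$ has a normalized integral; (ii) the cokernel Hopf monoid $Cok(\xi)$ has a normalized cointegral. Moreover, if a normalized integral along $\xi$ exists, then it is unique.
   Context: Coherence isomorphisms of $\mathcal{C}$ are suppressed; $\mathds{1}$ is the unit object. A bimonoid $A$ has structure maps $\nabla_A,\eta_A,\Delta_A,\epsilon_A$ (multiplication, unit, comultiplication, counit); a Hopf monoid is a bimonoid with antipode; bicommutative means commutative and cocommutative. Morphisms of $\mathsf{Hopf}^{\mathsf{bc}}(\mathcal{C})$ are bimonoid homomorphisms. $Ker(\xi)$ and $Cok(\xi)$ are the kernel and cokernel of $\xi$ in $\mathsf{Hopf}^{\mathsf{bc}}(\mathcal{C})$ (i.e. equalizer and coequalizer of $\xi$ and the trivial homomorphism $\eta_B\circ\epsilon_A$). Integrals of a bimonoid. A morphism $\varphi:\mathds{1}\to A$ is an integral of $A$ if $\nabla_A\circ(\varphi\otimes id_A)=\varphi\otimes\epsilon_A$ and $\nabla_A\circ(id_A\otimes\varphi)=\epsilon_A\otimes\varphi$;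 it is normalized if $\epsilon_A\circ\varphi=id_{\mathds{1}}$. A morphism $\varphi:A\to\mathds{1}$ is a cointegral of $A$ if $(\varphi\otimes id_A)\circ\Delta_A=\eta_A\circ\varphi=(id_A\otimes\varphi)\circ\Delta_A$; it is normalized if $\varphi\circ\eta_A=id_{\mathds{1}}$. Integrals along a homomorphism. Let $\xi:A\to B$ be a bimonoid homomorphism. A morphism $\mu:B\to A$ in $\mathcal{C}$ is a right integral along $\xi$ if $\nabla_A\circ(\mu\otimes id_A)=\mu\circ\nabla_B\circ(id_B\otimes\xi)$ and $(\mu\otimes id_B)\circ\Delta_B=(id_A\otimes\xi)\circ\Delta_A\circ\mu$; a left integral along $\xi$ if $\nabla_A\circ(id_A\otimes\mu)=\mu\circ\nabla_B\circ(\xi\otimes id_B)$ and $(id_B\otimes\mu)\circ\Delta_B=(\xi\otimes id_A)\circ\Delta_A\circ\mu$; an integral along $\xi$ if it is both. It is normalized if $\xi\circ\mu\circ\xi=\xi$. An integral $\mu$ along $\xi$ is a generator if $\mu\circ\xi\circ\mu'=\mu'=\mu'\circ\xi\circ\mu$ for every $\mu'$ that is a right integral or a left integral along $\xi$. Bistability. A left action $(A,\alpha,X)$ is a bimonoid $A$, an object $X$ and a morphism $\alpha:A\otimes X\to X$ which is associative and unital with respect to the monoid structure of $A$; the trivial action is $\epsilon_A\otimes id_X$. The stabilized object $\alpha\backslash X$ is the coequalizer of $\alpha$ and $\epsilon_A\otimes id_X$. The tensor product of $(A,\alpha,X)$ and $(A',\alpha',X')$ is $(A\otimes A',\alpha\tilde\otimes\alpha',X\otimes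 X')$, where $\alpha\tilde\otimes\alpha'=(\alpha\otimes\alpha')\circ(id_A\otimes \mathbf{s}_{A',X}\otimes id_{X'})$ and $\mathbf{s}$ is the symmetry. The projections induce a canonical morphism $(\alpha\tilde\otimes\alpha')\backslash(X\otimes X')\to(\alpha\backslash X)\otimes(\alpha'\backslash X')$, making $(A,\alpha,X)\mapsto\alpha\backslash X$ a symmetric comonoidal functor. The same is done for right actions. The monoidal structure of $\mathcal{C}$ is stable if these functors, for left and for right actions, are strong symmetric monoidal, i.e. these canonical morphisms are all isomorphisms. Dually, for a left coaction $(B,\beta,Y)$, $\beta:Y\to B\otimes Y$ (coassociative, counital, $B$ a bimonoid), the stabilized object is the equalizer of $\beta$ and the trivial coaction $\eta_B\otimes id_Y$, similarly for right coactions, and the monoidal structure is costable if the resulting symmetric monoidal functors from left and from right coactions to $\mathcal{C}$ are strong. Bistable means stable and costable. *)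

theory Defs
  imports "HOL-Algebra.Group"
begin

section \<open>Categories\<close>

record ('o, 'm) category =
  Obj :: "'o set"
  Arr :: "'m set"
  Dom :: "'m \<Rightarrow> 'o"
  Cod :: "'m \<Rightarrow> 'o"
  Idn :: "'o \<Rightarrow> 'm" ("\<iota>\<index>")
  Comp :: "'m \<Rightarrow> 'm \<Rightarrow> 'm" (infixr "\<cdot>\<index>" 55)

definition Hom :: "('o, 'm, 'z) category_scheme \<Rightarrow> 'o \<Rightarrow> 'o \<Rightarrow> 'm set" where
  "Hom C X Y = {f \<in> Arr C. Dom C f = X \<and> Cod C f = Y}"

locale category =
  fixes C :: "('o, 'm, 'z) category_scheme" (structure)
  assumes Dom_Obj: "f \<in> Arr C \<Longrightarrow> Dom C f \<in> Obj C"
    and Cod_Obj: "f \<in> Arr C \<Longrightarrow> Cod C f \<in> Obj C"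
    and Idn_Hom: "X \<in> Obj C \<Longrightarrow> \<iota> X \<in> Hom C X X"
    and Comp_Hom: "\<lbrakk>f \<in> Hom C X Y; g \<in> Hom C Y Z\<rbrakk> \<Longrightarrow> g \<cdot> f \<in> Hom C X Z"
    and Idn_left: "f \<in> Hom C X Y \<Longrightarrow> \<iota> Y \<cdot> f = f"
    and Idn_right: "f \<in> Hom C X Y \<Longrightarrow> f \<cdot> \<iota> X = f"
    and Comp_assoc: "\<lbrakk>f \<in> Hom C W X; g \<in> Hom C X Y; h \<in> Hom C Y Z\<rbrakk>
      \<Longrightarrow> (h \<cdot> g) \<cdot> f = h \<cdot> (g \<cdot> f)"

context
  fixes C :: "('o, 'm, 'z) category_scheme" (structure)
begin

definition inverse_arrows :: "'m \<Rightarrow> 'm \<Rightarrow> bool" where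
  "inverse_arrows f g \<longleftrightarrow> f \<in> Arr C \<and> g \<in> Hom C (Cod C f) (Dom C f)
     \<and> g \<cdot> f = \<iota> (Dom C f) \<and> f \<cdot> g = \<iota> (Cod C f)"

definition iso_arrow :: "'m \<Rightarrow> bool" where
  "iso_arrow f \<longleftrightarrow> (\<exists>g. inverse_arrows f g)"

definition inv_arrow :: "'m \<Rightarrow> 'm" where
  "inv_arrow f = (THE g. inverse_arrows f g)"

definition parallel :: "'m \<Rightarrow> 'm \<Rightarrow> bool" where
  "parallel f g \<longleftrightarrow> f \<in> Arr C \<and> g \<in> Arr C \<and> Dom C f = Dom C g \<and> Cod C f = Cod C g"

definition is_equalizer :: "'m \<Rightarrow> 'm \<Rightarrow> 'o \<Rightarrow> 'm \<Rightarrow> bool" where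
  "is_equalizer f g E e \<longleftrightarrow> parallel f g \<and> e \<in> Hom C E (Dom C f) \<and> f \<cdot> e = g \<cdot> e
     \<and> (\<forall>W h. h \<in> Hom C W (Dom C f) \<and> f \<cdot> h = g \<cdot> h
          \<longrightarrow> (\<exists>!u. u \<in> Hom C W E \<and> e \<cdot> u = h))"

definition is_coequalizer :: "'m \<Rightarrow> 'm \<Rightarrow> 'o \<Rightarrow> 'm \<Rightarrow> bool" where
  "is_coequalizer f g Q q \<longleftrightarrow> parallel f g \<and> q \<in> Hom C (Cod C f) Q \<and> q \<cdot> f = q \<cdot> g
     \<and> (\<forall>W h. h \<in> Hom C (Cod C f) W \<and> h \<cdot> f = h \<cdot> g
          \<longrightarrow> (\<exists>!u. u \<in> Hom C Q W \<and> u \<cdot> q = h))"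

definition has_equalizers :: bool where
  "has_equalizers \<longleftrightarrow> (\<forall>f g. parallel f g \<longrightarrow> (\<exists>E e. is_equalizer f g E e))"

definition has_coequalizers :: bool where
  "has_coequalizers \<longleftrightarrow> (\<forall>f g. parallel f g \<longrightarrow> (\<exists>Q q. is_coequalizer f g Q q))"

definition mono_arrow :: "'m \<Rightarrow> bool" where
  "mono_arrow f \<longleftrightarrow> f \<in> Arr C
     \<and> (\<forall>W g h. g \<in> Hom C W (Dom C f) \<and> h \<in> Hom C W (Dom C f) \<and> f \<cdot> g = f \<cdot> h \<longrightarrow> g = h)"

definition epi_arrow :: "'m \<Rightarrow> bool" where
  "epi_arrow f \<longleftrightarrow> f \<in> Arr C
     \<and> (\<forall>W g h. g \<in> Hom C (Cod C f) W \<and> h \<in> Hom C (Cod C f) W \<and> g \<cdot> f = h \<cdot> f \<longrightarrow> g = h)"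

definition zero_object :: "'o \<Rightarrow> bool" where
  "zero_object Z \<longleftrightarrow> Z \<in> Obj C
     \<and> (\<forall>X\<in>Obj C. (\<exists>!f. f \<in> Hom C X Z) \<and> (\<exists>!f. f \<in> Hom C Z X))"

definition preadditive :: "('m \<Rightarrow> 'm \<Rightarrow> 'm) \<Rightarrow> ('o \<Rightarrow> 'o \<Rightarrow> 'm) \<Rightarrow> bool" where
  "preadditive add zero \<longleftrightarrow>
     (\<forall>X\<in>Obj C. \<forall>Y\<in>Obj C.
        comm_group \<lparr>carrier = Hom C X Y, monoid.mult = add, one = zero X Y\<rparr>)
     \<and> (\<forall>X Y Z f g h. f \<in> Hom C X Y \<and> g \<in> Hom C X Y \<and> h \<in> Hom C Y Z
          \<longrightarrow> h \<cdot> add f g = add (h \<cdot> f) (h \<cdot> g))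
     \<and> (\<forall>X Y Z f g h. h \<in> Hom C X Y \<and> f \<in> Hom C Y Z \<and> g \<in> Hom C Y Z
          \<longrightarrow> add f g \<cdot> h = add (f \<cdot> h) (g \<cdot> h))"

definition biproduct ::
  "('m \<Rightarrow> 'm \<Rightarrow> 'm) \<Rightarrow> ('o \<Rightarrow> 'o \<Rightarrow> 'm) \<Rightarrow> 'o \<Rightarrow> 'o \<Rightarrow> 'o \<Rightarrow> 'm \<Rightarrow> 'm \<Rightarrow> 'm \<Rightarrow> 'm \<Rightarrow> bool" where
  "biproduct add zero X Y P i j p q \<longleftrightarrow>
     i \<in> Hom C X P \<and> j \<in> Hom C Y P \<and> p \<in> Hom C P X \<and> q \<in> Hom C P Y
     \<and> p \<cdot> i = \<iota> X \<and> q \<cdot> j = \<iota> Y \<and> p \<cdot> j = zero Y X \<and> q \<cdot> i = zero X Y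
     \<and> add (i \<cdot> p) (j \<cdot> q) = \<iota> P"

definition abelian_category :: bool where
  "abelian_category \<longleftrightarrow> category C \<and> (\<exists>add zero.
       preadditive add zero
     \<and> (\<exists>Z. zero_object Z)
     \<and> (\<forall>X\<in>Obj C. \<forall>Y\<in>Obj C. \<exists>P i j p q. biproduct add zero X Y P i j p q)
     \<and> (\<forall>X Y. \<forall>f\<in>Hom C X Y. (\<exists>K k. is_equalizer f (zero X Y) K k)
                            \<and> (\<exists>Q q. is_coequalizer f (zero X Y) Q q))
     \<and> (\<forall>m. mono_arrow m \<longrightarrow> (\<exists>X Y. \<exists>f\<in>Hom C X Y. is_equalizer f (zero X Y) (Dom C m) m))
     \<and> (\<forall>e. epi_arrow e \<longrightarrow> (\<exists>X Y. \<exists>f\<in>Hom C X Y. is_coequalizer f (zero X Y) (Cod C e) e)))"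

end

section \<open>Symmetric monoidal categories\<close>

record ('o, 'm) smc = "('o, 'm) category" +
  TenO :: "'o \<Rightarrow> 'o \<Rightarrow> 'o" (infixr "\<otimes>\<^sub>o\<index>" 70)
  TenA :: "'m \<Rightarrow> 'm \<Rightarrow> 'm" (infixr "\<otimes>\<^sub>a\<index>" 70)
  UnitO :: "'o" ("\<I>\<index>")
  Assoc :: "'o \<Rightarrow> 'o \<Rightarrow> 'o \<Rightarrow> 'm" ("\<a>\<index>")
  LUnit :: "'o \<Rightarrow> 'm" ("\<l>\<index>")
  RUnit :: "'o \<Rightarrow> 'm" ("\<r>\<index>")
  Braid :: "'o \<Rightarrow> 'o \<Rightarrow> 'm" ("\<s>\<index>")

locale symmetric_monoidal_category = category C
  for C :: "('o, 'm, 'z) smc_scheme" (structure) +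
  assumes UnitO_Obj: "\<I> \<in> Obj C"
    and TenO_Obj: "\<lbrakk>X \<in> Obj C; Y \<in> Obj C\<rbrakk> \<Longrightarrow> X \<otimes>\<^sub>o Y \<in> Obj C"
    and TenA_Hom: "\<lbrakk>f \<in> Hom C X Y; f' \<in> Hom C X' Y'\<rbrakk>
      \<Longrightarrow> f \<otimes>\<^sub>a f' \<in> Hom C (X \<otimes>\<^sub>o X') (Y \<otimes>\<^sub>o Y')"
    and TenA_Idn: "\<lbrakk>X \<in> Obj C; Y \<in> Obj C\<rbrakk> \<Longrightarrow> \<iota> X \<otimes>\<^sub>a \<iota> Y = \<iota> (X \<otimes>\<^sub>o Y)"
    and TenA_Comp:
      "\<lbrakk>f \<in> Hom C X Y; g \<in> Hom C Y Z; f' \<in> Hom C X' Y'; g' \<in> Hom C Y' Z'\<rbrakk>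
      \<Longrightarrow> (g \<cdot> f) \<otimes>\<^sub>a (g' \<cdot> f') = (g \<otimes>\<^sub>a g') \<cdot> (f \<otimes>\<^sub>a f')"
    and Assoc_Hom: "\<lbrakk>X \<in> Obj C; Y \<in> Obj C; Z \<in> Obj C\<rbrakk>
      \<Longrightarrow> \<a> X Y Z \<in> Hom C ((X \<otimes>\<^sub>o Y) \<otimes>\<^sub>o Z) (X \<otimes>\<^sub>o (Y \<otimes>\<^sub>o Z))"
    and Assoc_iso: "\<lbrakk>X \<in> Obj C; Y \<in> Obj C; Z \<in> Obj C\<rbrakk> \<Longrightarrow> iso_arrow C (\<a> X Y Z)"
    and Assoc_natural: "\<lbrakk>f \<in> Hom C X X'; g \<in> Hom C Y Y'; h \<in> Hom C Z Z'\<rbrakk>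
      \<Longrightarrow> \<a> X' Y' Z' \<cdot> ((f \<otimes>\<^sub>a g) \<otimes>\<^sub>a h) = (f \<otimes>\<^sub>a (g \<otimes>\<^sub>a h)) \<cdot> \<a> X Y Z"
    and LUnit_Hom: "X \<in> Obj C \<Longrightarrow> \<l> X \<in> Hom C (\<I> \<otimes>\<^sub>o X) X"
    and LUnit_iso: "X \<in> Obj C \<Longrightarrow> iso_arrow C (\<l> X)"
    and LUnit_natural: "f \<in> Hom C X Y \<Longrightarrow> \<l> Y \<cdot> (\<iota> \<I> \<otimes>\<^sub>a f) = f \<cdot> \<l> X"
    and RUnit_Hom: "X \<in> Obj C \<Longrightarrow> \<r> X \<in> Hom C (X \<otimes>\<^sub>o \<I>) X"
    and RUnit_iso: "X \<in> Obj C \<Longrightarrow> iso_arrow C (\<r> X)"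
    and RUnit_natural: "f \<in> Hom C X Y \<Longrightarrow> \<r> Y \<cdot> (f \<otimes>\<^sub>a \<iota> \<I>) = f \<cdot> \<r> X"
    and pentagon: "\<lbrakk>W \<in> Obj C; X \<in> Obj C; Y \<in> Obj C; Z \<in> Obj C\<rbrakk>
      \<Longrightarrow> \<a> W X (Y \<otimes>\<^sub>o Z) \<cdot> \<a> (W \<otimes>\<^sub>o X) Y Z
        = (\<iota> W \<otimes>\<^sub>a \<a> X Y Z) \<cdot> \<a> W (X \<otimes>\<^sub>o Y) Z \<cdot> (\<a> W X Y \<otimes>\<^sub>a \<iota> Z)"
    and triangle: "\<lbrakk>X \<in> Obj C; Y \<in> Obj C\<rbrakk>
      \<Longrightarrow> (\<iota> X \<otimes>\<^sub>a \<l> Y) \<cdot> \<a> X \<I> Y = \<r> X \<otimes>\<^sub>a \<iota> Y"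
    and Braid_Hom: "\<lbrakk>X \<in> Obj C; Y \<in> Obj C\<rbrakk> \<Longrightarrow> \<s> X Y \<in> Hom C (X \<otimes>\<^sub>o Y) (Y \<otimes>\<^sub>o X)"
    and Braid_natural: "\<lbrakk>f \<in> Hom C X X'; g \<in> Hom C Y Y'\<rbrakk>
      \<Longrightarrow> \<s> X' Y' \<cdot> (f \<otimes>\<^sub>a g) = (g \<otimes>\<^sub>a f) \<cdot> \<s> X Y"
    and Braid_Braid: "\<lbrakk>X \<in> Obj C; Y \<in> Obj C\<rbrakk> \<Longrightarrow> \<s> Y X \<cdot> \<s> X Y = \<iota> (X \<otimes>\<^sub>o Y)"
    and hexagon: "\<lbrakk>X \<in> Obj C; Y \<in> Obj C; Z \<in> Obj C\<rbrakk>
      \<Longrightarrow> \<a> Y Z X \<cdot> \<s> X (Y \<otimes>\<^sub>o Z) \<cdot> \<a> X Y Z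
        = (\<iota> Y \<otimes>\<^sub>a \<s> X Z) \<cdot> \<a> Y X Z \<cdot> (\<s> X Y \<otimes>\<^sub>a \<iota> Z)"

section \<open>Bimonoids and Hopf monoids\<close>

record ('o, 'm) bimonoid =
  Carrier :: "'o"
  Mult :: "'m" ("\<nabla>")
  Unit :: "'m" ("\<eta>")
  Comult :: "'m" ("\<Delta>")
  Counit :: "'m" ("\<epsilon>")

context
  fixes C :: "('o, 'm, 'z) smc_scheme" (structure)
begin

text \<open>The coherent isomorphism
  \<open>(W \<otimes> X) \<otimes> (Y \<otimes> Z) \<rightarrow> (W \<otimes> Y) \<otimes> (X \<otimes> Z)\<close>, which is
  \<open>id \<otimes> s \<otimes> id\<close> up to associators.\<close>

definition middle_four :: "'o \<Rightarrow> 'o \<Rightarrow> 'o \<Rightarrow> 'o \<Rightarrow> 'm" where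
  "middle_four W X Y Z =
     inv_arrow C (\<a> W Y (X \<otimes>\<^sub>o Z))
     \<cdot> (\<iota> W \<otimes>\<^sub>a (\<a> Y X Z \<cdot> (\<s> X Y \<otimes>\<^sub>a \<iota> Z) \<cdot> inv_arrow C (\<a> X Y Z)))
     \<cdot> \<a> W X (Y \<otimes>\<^sub>o Z)"

definition is_monoid :: "'o \<Rightarrow> 'm \<Rightarrow> 'm \<Rightarrow> bool" where
  "is_monoid M m u \<longleftrightarrow> M \<in> Obj C \<and> m \<in> Hom C (M \<otimes>\<^sub>o M) M \<and> u \<in> Hom C \<I> M
     \<and> m \<cdot> (m \<otimes>\<^sub>a \<iota> M) = m \<cdot> (\<iota> M \<otimes>\<^sub>a m) \<cdot> \<a> M M M
     \<and> m \<cdot> (u \<otimes>\<^sub>a \<iota> M) = \<l> M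
     \<and> m \<cdot> (\<iota> M \<otimes>\<^sub>a u) = \<r> M"

definition is_comonoid :: "'o \<Rightarrow> 'm \<Rightarrow> 'm \<Rightarrow> bool" where
  "is_comonoid M d e \<longleftrightarrow> M \<in> Obj C \<and> d \<in> Hom C M (M \<otimes>\<^sub>o M) \<and> e \<in> Hom C M \<I>
     \<and> \<a> M M M \<cdot> (d \<otimes>\<^sub>a \<iota> M) \<cdot> d = (\<iota> M \<otimes>\<^sub>a d) \<cdot> d
     \<and> \<l> M \<cdot> (e \<otimes>\<^sub>a \<iota> M) \<cdot> d = \<iota> M
     \<and> \<r> M \<cdot> (\<iota> M \<otimes>\<^sub>a e) \<cdot> d = \<iota> M"

definition is_bimonoid :: "('o, 'm) bimonoid \<Rightarrow> bool" where
  "is_bimonoid A \<longleftrightarrow> (let X = Carrier A in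
       is_monoid X (\<nabla> A) (\<eta> A) \<and> is_comonoid X (\<Delta> A) (\<epsilon> A)
     \<and> \<Delta> A \<cdot> \<nabla> A = (\<nabla> A \<otimes>\<^sub>a \<nabla> A) \<cdot> middle_four X X X X \<cdot> (\<Delta> A \<otimes>\<^sub>a \<Delta> A)
     \<and> \<epsilon> A \<cdot> \<nabla> A = \<l> \<I> \<cdot> (\<epsilon> A \<otimes>\<^sub>a \<epsilon> A)
     \<and> \<Delta> A \<cdot> \<eta> A = (\<eta> A \<otimes>\<^sub>a \<eta> A) \<cdot> inv_arrow C (\<l> \<I>)
     \<and> \<epsilon> A \<cdot> \<eta> A = \<iota> \<I>)"

definition is_antipode :: "('o, 'm) bimonoid \<Rightarrow> 'm \<Rightarrow> bool" where
  "is_antipode A S \<longleftrightarrow> S \<in> Hom C (Carrier A) (Carrier A)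
     \<and> \<nabla> A \<cdot> (S \<otimes>\<^sub>a \<iota> (Carrier A)) \<cdot> \<Delta> A = \<eta> A \<cdot> \<epsilon> A
     \<and> \<nabla> A \<cdot> (\<iota> (Carrier A) \<otimes>\<^sub>a S) \<cdot> \<Delta> A = \<eta> A \<cdot> \<epsilon> A"

definition is_hopf_monoid :: "('o, 'm) bimonoid \<Rightarrow> bool" where
  "is_hopf_monoid A \<longleftrightarrow> is_bimonoid A \<and> (\<exists>S. is_antipode A S)"

definition is_bicommutative :: "('o, 'm) bimonoid \<Rightarrow> bool" where
  "is_bicommutative A \<longleftrightarrow> \<nabla> A \<cdot> \<s> (Carrier A) (Carrier A) = \<nabla> A
     \<and> \<s> (Carrier A) (Carrier A) \<cdot> \<Delta> A = \<Delta> A"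

definition bimonoid_hom :: "('o, 'm) bimonoid \<Rightarrow> ('o, 'm) bimonoid \<Rightarrow> 'm \<Rightarrow> bool" where
  "bimonoid_hom A B f \<longleftrightarrow> f \<in> Hom C (Carrier A) (Carrier B)
     \<and> f \<cdot> \<nabla> A = \<nabla> B \<cdot> (f \<otimes>\<^sub>a f) \<and> f \<cdot> \<eta> A = \<eta> B
     \<and> \<Delta> B \<cdot> f = (f \<otimes>\<^sub>a f) \<cdot> \<Delta> A \<and> \<epsilon> B \<cdot> f = \<epsilon> A"

definition trivial_hom :: "('o, 'm) bimonoid \<Rightarrow> ('o, 'm) bimonoid \<Rightarrow> 'm" where
  "trivial_hom A B = \<eta> B \<cdot> \<epsilon> A"

text \<open>The category of bicommutative Hopf monoids. Arrows are tagged with their source and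
  target, since one arrow of \<open>C\<close> may be a homomorphism for several bimonoid structures.\<close>

definition Hopf_bc ::
  "(('o, 'm) bimonoid, ('o, 'm) bimonoid \<times> 'm \<times> ('o, 'm) bimonoid) category" where
  "Hopf_bc = \<lparr>
     Obj = {A. is_hopf_monoid A \<and> is_bicommutative A},
     Arr = {(A, f, B). is_hopf_monoid A \<and> is_bicommutative A
                     \<and> is_hopf_monoid B \<and> is_bicommutative B \<and> bimonoid_hom A B f},
     Dom = (\<lambda>(A, f, B). A),
     Cod = (\<lambda>(A, f, B). B),
     Idn = (\<lambda>A. (A, \<iota> (Carrier A), A)),
     Comp = (\<lambda>(B', g, D) (A, f, B). (A, g \<cdot> f, D))\<rparr>"

definition is_Ker ::
  "('o, 'm) bimonoid \<Rightarrow> ('o, 'm) bimonoid \<Rightarrow> 'm \<Rightarrow> ('o, 'm) bimonoid \<Rightarrow> 'm \<Rightarrow> bool" where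
  "is_Ker A B \<xi> K k \<longleftrightarrow>
     is_equalizer Hopf_bc (A, \<xi>, B) (A, trivial_hom A B, B) K (K, k, A)"

definition is_Cok ::
  "('o, 'm) bimonoid \<Rightarrow> ('o, 'm) bimonoid \<Rightarrow> 'm \<Rightarrow> ('o, 'm) bimonoid \<Rightarrow> 'm \<Rightarrow> bool" where
  "is_Cok A B \<xi> Q q \<longleftrightarrow>
     is_coequalizer Hopf_bc (A, \<xi>, B) (A, trivial_hom A B, B) Q (B, q, Q)"

section \<open>Integrals\<close>

definition integral :: "('o, 'm) bimonoid \<Rightarrow> 'm \<Rightarrow> bool" where
  "integral A \<phi> \<longleftrightarrow> \<phi> \<in> Hom C \<I> (Carrier A)
     \<and> \<nabla> A \<cdot> (\<phi> \<otimes>\<^sub>a \<iota> (Carrier A)) = \<r> (Carrier A) \<cdot> (\<phi> \<otimes>\<^sub>a \<epsilon> A)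
     \<and> \<nabla> A \<cdot> (\<iota> (Carrier A) \<otimes>\<^sub>a \<phi>) = \<l> (Carrier A) \<cdot> (\<epsilon> A \<otimes>\<^sub>a \<phi>)"

definition normalized_integral :: "('o, 'm) bimonoid \<Rightarrow> 'm \<Rightarrow> bool" where
  "normalized_integral A \<phi> \<longleftrightarrow> integral A \<phi> \<and> \<epsilon> A \<cdot> \<phi> = \<iota> \<I>"

definition cointegral :: "('o, 'm) bimonoid \<Rightarrow> 'm \<Rightarrow> bool" where
  "cointegral A \<phi> \<longleftrightarrow> \<phi> \<in> Hom C (Carrier A) \<I>
     \<and> \<l> (Carrier A) \<cdot> (\<phi> \<otimes>\<^sub>a \<iota> (Carrier A)) \<cdot> \<Delta> A = \<eta> A \<cdot> \<phi>
     \<and> \<r> (Carrier A) \<cdot> (\<iota> (Carrier A) \<otimes>\<^sub>a \<phi>) \<cdot> \<Delta> A = \<eta> A \<cdot> \<phi>"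

definition normalized_cointegral :: "('o, 'm) bimonoid \<Rightarrow> 'm \<Rightarrow> bool" where
  "normalized_cointegral A \<phi> \<longleftrightarrow> cointegral A \<phi> \<and> \<phi> \<cdot> \<eta> A = \<iota> \<I>"

definition right_integral_along ::
  "('o, 'm) bimonoid \<Rightarrow> ('o, 'm) bimonoid \<Rightarrow> 'm \<Rightarrow> 'm \<Rightarrow> bool" where
  "right_integral_along A B \<xi> \<mu> \<longleftrightarrow> \<mu> \<in> Hom C (Carrier B) (Carrier A)
     \<and> \<nabla> A \<cdot> (\<mu> \<otimes>\<^sub>a \<iota> (Carrier A)) = \<mu> \<cdot> \<nabla> B \<cdot> (\<iota> (Carrier B) \<otimes>\<^sub>a \<xi>)
     \<and> (\<mu> \<otimes>\<^sub>a \<iota> (Carrier B)) \<cdot> \<Delta> B = (\<iota> (Carrier A) \<otimes>\<^sub>a \<xi>) \<cdot> \<Delta> A \<cdot> \<mu>"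

definition left_integral_along ::
  "('o, 'm) bimonoid \<Rightarrow> ('o, 'm) bimonoid \<Rightarrow> 'm \<Rightarrow> 'm \<Rightarrow> bool" where
  "left_integral_along A B \<xi> \<mu> \<longleftrightarrow> \<mu> \<in> Hom C (Carrier B) (Carrier A)
     \<and> \<nabla> A \<cdot> (\<iota> (Carrier A) \<otimes>\<^sub>a \<mu>) = \<mu> \<cdot> \<nabla> B \<cdot> (\<xi> \<otimes>\<^sub>a \<iota> (Carrier B))
     \<and> (\<iota> (Carrier B) \<otimes>\<^sub>a \<mu>) \<cdot> \<Delta> B = (\<xi> \<otimes>\<^sub>a \<iota> (Carrier A)) \<cdot> \<Delta> A \<cdot> \<mu>"

definition integral_along ::
  "('o, 'm) bimonoid \<Rightarrow> ('o, 'm) bimonoid \<Rightarrow> 'm \<Rightarrow> 'm \<Rightarrow> bool" where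
  "integral_along A B \<xi> \<mu> \<longleftrightarrow> right_integral_along A B \<xi> \<mu> \<and> left_integral_along A B \<xi> \<mu>"

definition normalized_along :: "'m \<Rightarrow> 'm \<Rightarrow> bool" where
  "normalized_along \<xi> \<mu> \<longleftrightarrow> \<xi> \<cdot> \<mu> \<cdot> \<xi> = \<xi>"

definition generator_along ::
  "('o, 'm) bimonoid \<Rightarrow> ('o, 'm) bimonoid \<Rightarrow> 'm \<Rightarrow> 'm \<Rightarrow> bool" where
  "generator_along A B \<xi> \<mu> \<longleftrightarrow> integral_along A B \<xi> \<mu>
     \<and> (\<forall>\<mu>'. right_integral_along A B \<xi> \<mu>' \<or> left_integral_along A B \<xi> \<mu>'
          \<longrightarrow> \<mu> \<cdot> \<xi> \<cdot> \<mu>' = \<mu>' \<and> \<mu>' \<cdot> \<xi> \<cdot> \<mu> = \<mu>')"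

section \<open>Bistability\<close>

definition bimonoid_tensor ::
  "('o, 'm) bimonoid \<Rightarrow> ('o, 'm) bimonoid \<Rightarrow> ('o, 'm) bimonoid" where
  "bimonoid_tensor A A' = (let X = Carrier A; X' = Carrier A' in \<lparr>
     Carrier = X \<otimes>\<^sub>o X',
     Mult = (\<nabla> A \<otimes>\<^sub>a \<nabla> A') \<cdot> middle_four X X' X X',
     Unit = (\<eta> A \<otimes>\<^sub>a \<eta> A') \<cdot> inv_arrow C (\<l> \<I>),
     Comult = middle_four X X X' X' \<cdot> (\<Delta> A \<otimes>\<^sub>a \<Delta> A'),
     Counit = \<l> \<I> \<cdot> (\<epsilon> A \<otimes>\<^sub>a \<epsilon> A')\<rparr>)"

definition left_action :: "('o, 'm) bimonoid \<Rightarrow> 'm \<Rightarrow> 'o \<Rightarrow> bool" where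
  "left_action A \<alpha> X \<longleftrightarrow> is_bimonoid A \<and> X \<in> Obj C \<and> \<alpha> \<in> Hom C (Carrier A \<otimes>\<^sub>o X) X
     \<and> \<alpha> \<cdot> (\<nabla> A \<otimes>\<^sub>a \<iota> X) = \<alpha> \<cdot> (\<iota> (Carrier A) \<otimes>\<^sub>a \<alpha>) \<cdot> \<a> (Carrier A) (Carrier A) X
     \<and> \<alpha> \<cdot> (\<eta> A \<otimes>\<^sub>a \<iota> X) = \<l> X"

definition right_action :: "('o, 'm) bimonoid \<Rightarrow> 'm \<Rightarrow> 'o \<Rightarrow> bool" where
  "right_action A \<alpha> X \<longleftrightarrow> is_bimonoid A \<and> X \<in> Obj C \<and> \<alpha> \<in> Hom C (X \<otimes>\<^sub>o Carrier A) X
     \<and> \<alpha> \<cdot> (\<alpha> \<otimes>\<^sub>a \<iota> (Carrier A)) = \<alpha> \<cdot> (\<iota> X \<otimes>\<^sub>a \<nabla> A) \<cdot> \<a> X (Carrier A) (Carrier A)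
     \<and> \<alpha> \<cdot> (\<iota> X \<otimes>\<^sub>a \<eta> A) = \<r> X"

definition left_coaction :: "('o, 'm) bimonoid \<Rightarrow> 'm \<Rightarrow> 'o \<Rightarrow> bool" where
  "left_coaction B \<beta> Y \<longleftrightarrow> is_bimonoid B \<and> Y \<in> Obj C \<and> \<beta> \<in> Hom C Y (Carrier B \<otimes>\<^sub>o Y)
     \<and> \<a> (Carrier B) (Carrier B) Y \<cdot> (\<Delta> B \<otimes>\<^sub>a \<iota> Y) \<cdot> \<beta> = (\<iota> (Carrier B) \<otimes>\<^sub>a \<beta>) \<cdot> \<beta>
     \<and> \<l> Y \<cdot> (\<epsilon> B \<otimes>\<^sub>a \<iota> Y) \<cdot> \<beta> = \<iota> Y"

definition right_coaction :: "('o, 'm) bimonoid \<Rightarrow> 'm \<Rightarrow> 'o \<Rightarrow> bool" where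
  "right_coaction B \<beta> Y \<longleftrightarrow> is_bimonoid B \<and> Y \<in> Obj C \<and> \<beta> \<in> Hom C Y (Y \<otimes>\<^sub>o Carrier B)
     \<and> \<a> Y (Carrier B) (Carrier B) \<cdot> (\<beta> \<otimes>\<^sub>a \<iota> (Carrier B)) \<cdot> \<beta> = (\<iota> Y \<otimes>\<^sub>a \<Delta> B) \<cdot> \<beta>
     \<and> \<r> Y \<cdot> (\<iota> Y \<otimes>\<^sub>a \<epsilon> B) \<cdot> \<beta> = \<iota> Y"

definition left_action_stabilized ::
  "('o, 'm) bimonoid \<Rightarrow> 'm \<Rightarrow> 'o \<Rightarrow> 'o \<Rightarrow> 'm \<Rightarrow> bool" where
  "left_action_stabilized A \<alpha> X Q p \<longleftrightarrow>
     is_coequalizer C \<alpha> (\<l> X \<cdot> (\<epsilon> A \<otimes>\<^sub>a \<iota> X)) Q p"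

definition right_action_stabilized ::
  "('o, 'm) bimonoid \<Rightarrow> 'm \<Rightarrow> 'o \<Rightarrow> 'o \<Rightarrow> 'm \<Rightarrow> bool" where
  "right_action_stabilized A \<alpha> X Q p \<longleftrightarrow>
     is_coequalizer C \<alpha> (\<r> X \<cdot> (\<iota> X \<otimes>\<^sub>a \<epsilon> A)) Q p"

definition left_coaction_stabilized ::
  "('o, 'm) bimonoid \<Rightarrow> 'm \<Rightarrow> 'o \<Rightarrow> 'o \<Rightarrow> 'm \<Rightarrow> bool" where
  "left_coaction_stabilized B \<beta> Y E e \<longleftrightarrow>
     is_equalizer C \<beta> ((\<eta> B \<otimes>\<^sub>a \<iota> Y) \<cdot> inv_arrow C (\<l> Y)) E e"

definition right_coaction_stabilized ::
  "('o, 'm) bimonoid \<Rightarrow> 'm \<Rightarrow> 'o \<Rightarrow> 'o \<Rightarrow> 'm \<Rightarrow> bool" where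
  "right_coaction_stabilized B \<beta> Y E e \<longleftrightarrow>
     is_equalizer C \<beta> ((\<iota> Y \<otimes>\<^sub>a \<eta> B) \<cdot> inv_arrow C (\<r> Y)) E e"

definition left_action_tensor ::
  "('o, 'm) bimonoid \<Rightarrow> 'm \<Rightarrow> 'o \<Rightarrow> ('o, 'm) bimonoid \<Rightarrow> 'm \<Rightarrow> 'o \<Rightarrow> 'm" where
  "left_action_tensor A \<alpha> X A' \<alpha>' X' =
     (\<alpha> \<otimes>\<^sub>a \<alpha>') \<cdot> middle_four (Carrier A) (Carrier A') X X'"

definition right_action_tensor ::
  "('o, 'm) bimonoid \<Rightarrow> 'm \<Rightarrow> 'o \<Rightarrow> ('o, 'm) bimonoid \<Rightarrow> 'm \<Rightarrow> 'o \<Rightarrow> 'm" where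
  "right_action_tensor A \<alpha> X A' \<alpha>' X' =
     (\<alpha> \<otimes>\<^sub>a \<alpha>') \<cdot> middle_four X X' (Carrier A) (Carrier A')"

definition left_coaction_tensor ::
  "('o, 'm) bimonoid \<Rightarrow> 'm \<Rightarrow> 'o \<Rightarrow> ('o, 'm) bimonoid \<Rightarrow> 'm \<Rightarrow> 'o \<Rightarrow> 'm" where
  "left_coaction_tensor B \<beta> Y B' \<beta>' Y' =
     middle_four (Carrier B) Y (Carrier B') Y' \<cdot> (\<beta> \<otimes>\<^sub>a \<beta>')"

definition right_coaction_tensor ::
  "('o, 'm) bimonoid \<Rightarrow> 'm \<Rightarrow> 'o \<Rightarrow> ('o, 'm) bimonoid \<Rightarrow> 'm \<Rightarrow> 'o \<Rightarrow> 'm" where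
  "right_coaction_tensor B \<beta> Y B' \<beta>' Y' =
     middle_four Y (Carrier B) Y' (Carrier B') \<cdot> (\<beta> \<otimes>\<^sub>a \<beta>')"

text \<open>In the four definitions below the canonical comparison morphism \<open>g\<close> is the unique one
  compatible with the (co)equalizing morphisms. The remaining structure map of these
  (co)monoidal functors compares \<open>\<I>\<close> with the stabilized object of the unit (co)action of
  \<open>\<I>\<close> on \<open>\<I>\<close>; it is always invertible, because this (co)action is trivial.\<close>

definition left_stable :: bool where
  "left_stable \<longleftrightarrow> (\<forall>A \<alpha> X Q p A' \<alpha>' X' Q' p' R r.
     left_action A \<alpha> X \<and> left_action A' \<alpha>' X'
     \<and> left_action_stabilized A \<alpha> X Q p \<and> left_action_stabilized A' \<alpha>' X' Q' p'
     \<and> left_action_stabilized (bimonoid_tensor A A') (left_action_tensor A \<alpha> X A' \<alpha>' X')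
         (X \<otimes>\<^sub>o X') R r
     \<longrightarrow> (\<exists>g\<in>Hom C R (Q \<otimes>\<^sub>o Q'). g \<cdot> r = p \<otimes>\<^sub>a p' \<and> iso_arrow C g))"

definition right_stable :: bool where
  "right_stable \<longleftrightarrow> (\<forall>A \<alpha> X Q p A' \<alpha>' X' Q' p' R r.
     right_action A \<alpha> X \<and> right_action A' \<alpha>' X'
     \<and> right_action_stabilized A \<alpha> X Q p \<and> right_action_stabilized A' \<alpha>' X' Q' p'
     \<and> right_action_stabilized (bimonoid_tensor A A') (right_action_tensor A \<alpha> X A' \<alpha>' X')
         (X \<otimes>\<^sub>o X') R r
     \<longrightarrow> (\<exists>g\<in>Hom C R (Q \<otimes>\<^sub>o Q'). g \<cdot> r = p \<otimes>\<^sub>a p' \<and> iso_arrow C g))"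

definition left_costable :: bool where
  "left_costable \<longleftrightarrow> (\<forall>B \<beta> Y E e B' \<beta>' Y' E' e' R r.
     left_coaction B \<beta> Y \<and> left_coaction B' \<beta>' Y'
     \<and> left_coaction_stabilized B \<beta> Y E e \<and> left_coaction_stabilized B' \<beta>' Y' E' e'
     \<and> left_coaction_stabilized (bimonoid_tensor B B') (left_coaction_tensor B \<beta> Y B' \<beta>' Y')
         (Y \<otimes>\<^sub>o Y') R r
     \<longrightarrow> (\<exists>g\<in>Hom C (E \<otimes>\<^sub>o E') R. r \<cdot> g = e \<otimes>\<^sub>a e' \<and> iso_arrow C g))"

definition right_costable :: bool where
  "right_costable \<longleftrightarrow> (\<forall>B \<beta> Y E e B' \<beta>' Y' E' e' R r.
     right_coaction B \<beta> Y \<and> right_coaction B' \<beta>' Y'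
     \<and> right_coaction_stabilized B \<beta> Y E e \<and> right_coaction_stabilized B' \<beta>' Y' E' e'
     \<and> right_coaction_stabilized (bimonoid_tensor B B') (right_coaction_tensor B \<beta> Y B' \<beta>' Y')
         (Y \<otimes>\<^sub>o Y') R r
     \<longrightarrow> (\<exists>g\<in>Hom C (E \<otimes>\<^sub>o E') R. r \<cdot> g = e \<otimes>\<^sub>a e' \<and> iso_arrow C g))"

definition stable :: bool where
  "stable \<longleftrightarrow> left_stable \<and> right_stable"

definition costable :: bool where
  "costable \<longleftrightarrow> left_costable \<and> right_costable"

definition bistable :: bool where
  "bistable \<longleftrightarrow> stable \<and> costable"

end

end

theory Submission
  imports Defs
begin

text \<open>In a strict notation with elements, put \<open>p = \<mu>(1)\<close> for an integral \<open>\<mu>\<close> along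
  \<open>\<xi> : A \<rightarrow> B\<close>.  Linearity of \<open>\<mu>\<close> says that \<open>\<mu> \<xi>\<close> is multiplication by \<open>p\<close>, and normalization
  says that \<open>\<xi>(p) = 1\<close>.  Hence \<open>\<mu>(\<xi>(\<mu>'(b))) = p \<mu>'(b) = \<mu>'(\<xi>(p) b) = \<mu>'(b)\<close> for every
  integral \<open>\<mu>'\<close> along \<open>\<xi>\<close>, and dually \<open>\<mu>' \<xi> \<mu> = \<mu>'\<close>.  So a normalized integral is
  automatically a generator, and two normalized integrals \<open>\<mu>\<close> and \<open>\<mu>'\<close> coincide, both being equal
  to \<open>\<mu> \<xi> \<mu>'\<close> (\<open>normalized_integral_generates\<close>, \<open>normalized_integral_unique\<close>).

  For the existence criterion one has to know kernels concretely.  The homomorphism \<open>\<xi>\<close> makes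
  \<open>A\<close> a right \<open>B\<close>-comodule, by \<open>x \<mapsto> x\<^sub>1 \<otimes> \<xi>(x\<^sub>2)\<close>.  Its stabilized object is an equalizer in the
  category \<open>C\<close>, whose tensor square is, by costability, the stabilized object of the tensor square
  of the coaction.  Therefore all structure maps of \<open>A\<close> restrict to it, it becomes a
  bicommutative Hopf monoid, and it is the kernel of \<open>\<xi>\<close> (\<open>kernel_equalizer\<close>).

  Given a normalized integral \<open>\<mu>\<close> along \<open>\<xi>\<close>, colinearity of \<open>\<mu>\<close> shows that \<open>p\<close> belongs to this
  equalizer, and linearity makes it a normalized integral of the kernel
  (\<open>kernel_normalized_integral\<close>).  Conversely, let \<open>p\<close> be the image in \<open>A\<close> of a normalized integral
  of the kernel.  Multiplication by \<open>p\<close> factors through the cokernel \<open>\<pi> : A \<rightarrow> I\<close> of the kernel,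
  and the factor \<open>I \<rightarrow> A\<close> is an integral along \<open>\<pi>\<close> and a section of \<open>\<pi>\<close>
  (\<open>integral_along_quotient\<close>).  Dually, a normalized cointegral of the cokernel of \<open>\<xi>\<close> gives an
  integral \<open>B \<rightarrow> I\<close> along the kernel \<open>i\<close> of that cokernel, and it is a retraction of \<open>i\<close>.
  In an abelian category \<open>\<xi> = i \<pi>\<close> (\<open>hopf_image_factorization\<close>), and the composite of the two
  integrals is the desired normalized integral along \<open>\<xi>\<close>.

  The dual half of every argument comes from applying the first half to the opposite symmetric
  monoidal category, in which actions and coactions, kernels and cokernels, and integrals and
  cointegrals are exchanged, while integrals along a homomorphism are self-dual.\<close>

section \<open>Arrows, equalizers and monomorphisms\<close>

lemma Hom_iff: "f \<in> Hom C X Y \<longleftrightarrow> f \<in> Arr C \<and> Dom C f = X \<and> Cod C f = Y"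
  by (simp add: Hom_def)

context category
begin

lemma idn_simps [simp]:
  assumes "X \<in> Obj C"
  shows "\<iota> X \<in> Arr C" "Dom C (\<iota> X) = X" "Cod C (\<iota> X) = X"
  using Idn_Hom[OF assms] by (simp_all add: Hom_iff)

lemma comp_simps [simp]:
  assumes "f \<in> Arr C" "g \<in> Arr C" "Cod C f = Dom C g"
  shows "g \<cdot> f \<in> Arr C" "Dom C (g \<cdot> f) = Dom C f" "Cod C (g \<cdot> f) = Cod C g"
  using Comp_Hom[of f "Dom C f" "Cod C f" g "Cod C g"] assms by (simp_all add: Hom_iff)

lemma Dom_Obj' [simp]: "f \<in> Arr C \<Longrightarrow> Dom C f \<in> Obj C"
  and Cod_Obj' [simp]: "f \<in> Arr C \<Longrightarrow> Cod C f \<in> Obj C"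
  by (fact Dom_Obj, fact Cod_Obj)

lemma comp_idn [simp]:
  assumes "f \<in> Arr C"
  shows "Cod C f = Y \<Longrightarrow> \<iota> Y \<cdot> f = f" "Dom C f = X \<Longrightarrow> f \<cdot> \<iota> X = f"
  using Idn_left[of f "Dom C f" "Cod C f"] Idn_right[of f "Dom C f" "Cod C f"] assms
  by (auto simp: Hom_iff)

lemma comp_assoc [simp]:
  assumes "f \<in> Arr C" "g \<in> Arr C" "h \<in> Arr C" "Cod C f = Dom C g" "Cod C g = Dom C h"
  shows "(h \<cdot> g) \<cdot> f = h \<cdot> g \<cdot> f"
  using Comp_assoc[of f "Dom C f" "Cod C f" g "Cod C g" h "Cod C h"] assms
  by (simp add: Hom_iff)

lemma Hom_Obj: "f \<in> Hom C X Y \<Longrightarrow> X \<in> Obj C \<and> Y \<in> Obj C"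
  by (auto simp: Hom_iff)

text \<open>Rewriting inside a right-nested composite needs each equation \<open>g \<cdot> f = h\<close> also in the
  form that it takes when something is precomposed.\<close>

lemma comp_extend:
  assumes "g \<cdot> f = h"
    and "f \<in> Arr C" "g \<in> Arr C" "Cod C f = Dom C g" "k \<in> Arr C" "Cod C k = Dom C f"
  shows "g \<cdot> f \<cdot> k = h \<cdot> k"
  using assms comp_assoc[of k f g] by simp

lemma inverse_arrows_unique:
  assumes "inverse_arrows C f g" "inverse_arrows C f h"
  shows "g = h"
proof -
  have arr: "f \<in> Arr C" "g \<in> Arr C" "h \<in> Arr C" "Cod C f = Dom C h" "Cod C g = Dom C f"
    and inv: "h \<cdot> f = \<iota> (Dom C f)" "f \<cdot> g = \<iota> (Dom C h)"
    using assms by (simp_all add: inverse_arrows_def Hom_iff)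
  have "g = h \<cdot> f \<cdot> g"
    using arr comp_extend[OF inv(1), of g] by simp
  also have "\<dots> = h"
    using arr inv by simp
  finally show ?thesis .
qed

lemma inv_arrow_eq: "inverse_arrows C f g \<Longrightarrow> inv_arrow C f = g"
  unfolding inv_arrow_def by (rule the_equality) (auto intro: inverse_arrows_unique)

lemma iso_inverse: "iso_arrow C f \<Longrightarrow> inverse_arrows C f (inv_arrow C f)"
  unfolding iso_arrow_def using inv_arrow_eq by auto

lemma iso_simps [simp]:
  assumes "iso_arrow C f"
  shows "f \<in> Arr C" "inv_arrow C f \<in> Arr C"
    "Dom C (inv_arrow C f) = Cod C f" "Cod C (inv_arrow C f) = Dom C f"
    "inv_arrow C f \<cdot> f = \<iota> (Dom C f)" "f \<cdot> inv_arrow C f = \<iota> (Cod C f)"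
  using iso_inverse[OF assms] by (simp_all add: inverse_arrows_def Hom_iff)

lemma iso_cancel [simp]:
  assumes "iso_arrow C f" "k \<in> Arr C"
  shows "Cod C k = Dom C f \<Longrightarrow> inv_arrow C f \<cdot> f \<cdot> k = k"
    and "Cod C k = Cod C f \<Longrightarrow> f \<cdot> inv_arrow C f \<cdot> k = k"
  using assms comp_extend[of "inv_arrow C f" f _ k] comp_extend[of f "inv_arrow C f" _ k]
  by auto

lemma iso_inv_arrow:
  assumes "iso_arrow C f"
  shows "iso_arrow C (inv_arrow C f)" "inv_arrow C (inv_arrow C f) = f"
proof -
  have *: "inverse_arrows C (inv_arrow C f) f"
    using assms by (simp add: inverse_arrows_def Hom_iff)
  then show "iso_arrow C (inv_arrow C f)" by (auto simp: iso_arrow_def)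
  show "inv_arrow C (inv_arrow C f) = f" by (rule inv_arrow_eq[OF *])
qed

lemma mono_arrowD:
  assumes "mono_arrow C f" "g \<in> Arr C" "h \<in> Arr C" "Cod C g = Dom C f" "Cod C h = Dom C f"
    "Dom C g = Dom C h" "f \<cdot> g = f \<cdot> h"
  shows "g = h"
  using assms unfolding mono_arrow_def Hom_iff by blast

lemma epi_arrowD:
  assumes "epi_arrow C f" "g \<in> Arr C" "h \<in> Arr C" "Dom C g = Cod C f" "Dom C h = Cod C f"
    "Cod C g = Cod C h" "g \<cdot> f = h \<cdot> f"
  shows "g = h"
  using assms unfolding epi_arrow_def Hom_iff by blast

lemma mono_arrowI:
  assumes "f \<in> Arr C"
    "\<And>g h. \<lbrakk>g \<in> Arr C; h \<in> Arr C; Cod C g = Dom C f; Cod C h = Dom C f;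
      Dom C g = Dom C h; f \<cdot> g = f \<cdot> h\<rbrakk> \<Longrightarrow> g = h"
  shows "mono_arrow C f"
  using assms unfolding mono_arrow_def Hom_iff by metis

lemma split_mono:
  assumes "f \<in> Arr C" "g \<in> Arr C" "Dom C g = Cod C f" "g \<cdot> f = \<iota> (Dom C f)"
  shows "mono_arrow C f"
proof (rule mono_arrowI[OF assms(1)])
  fix x y
  assume xy: "x \<in> Arr C" "y \<in> Arr C" "Cod C x = Dom C f" "Cod C y = Dom C f"
    "Dom C x = Dom C y" and eq: "f \<cdot> x = f \<cdot> y"
  have "x = g \<cdot> f \<cdot> x" "y = g \<cdot> f \<cdot> y"
    using xy assms comp_extend[OF assms(4)] by simp_all
  with eq show "x = y" by simp
qed

lemma split_epi:
  assumes "f \<in> Arr C" "g \<in> Arr C" "Cod C g = Dom C f" "Cod C f = Dom C g" "f \<cdot> g = \<iota> (Cod C f)"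
  shows "epi_arrow C f"
  unfolding epi_arrow_def
proof (intro conjI allI impI assms(1))
  fix W x y
  assume "x \<in> Hom C (Cod C f) W \<and> y \<in> Hom C (Cod C f) W \<and> x \<cdot> f = y \<cdot> f"
  then have xy: "x \<in> Arr C" "y \<in> Arr C" "Dom C x = Cod C f" "Dom C y = Cod C f"
    and eq: "x \<cdot> f = y \<cdot> f"
    by (auto simp: Hom_iff)
  have "x = (x \<cdot> f) \<cdot> g" "y = (y \<cdot> f) \<cdot> g"
    using xy assms by simp_all
  with eq show "x = y" by simp
qed

lemma iso_mono: "iso_arrow C f \<Longrightarrow> mono_arrow C f"
  by (rule split_mono[of f "inv_arrow C f"]) simp_all

lemma mono_comp:
  assumes "mono_arrow C f" "mono_arrow C g" "Cod C f = Dom C g"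
  shows "mono_arrow C (g \<cdot> f)"
proof (rule mono_arrowI)
  have arr: "f \<in> Arr C" "g \<in> Arr C" using assms by (auto simp: mono_arrow_def)
  then show "g \<cdot> f \<in> Arr C" using assms by simp
  fix x y
  assume xy: "x \<in> Arr C" "y \<in> Arr C" "Cod C x = Dom C (g \<cdot> f)" "Cod C y = Dom C (g \<cdot> f)"
    "Dom C x = Dom C y" "(g \<cdot> f) \<cdot> x = (g \<cdot> f) \<cdot> y"
  then have "f \<cdot> x = f \<cdot> y"
    using arr assms by - (rule mono_arrowD[OF assms(2)], simp_all)
  then show "x = y"
    using xy arr assms by - (rule mono_arrowD[OF assms(1)], simp_all)
qed

lemma equalizer_arrow:
  assumes "is_equalizer C f g E e"
  shows "f \<in> Arr C" "g \<in> Arr C" "Dom C g = Dom C f" "Cod C g = Cod C f"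
    "e \<in> Arr C" "Dom C e = E" "Cod C e = Dom C f" "f \<cdot> e = g \<cdot> e"
  using assms by (auto simp: is_equalizer_def parallel_def Hom_iff)

lemma equalizer_factor:
  assumes "is_equalizer C f g E e" "h \<in> Arr C" "Cod C h = Dom C f" "f \<cdot> h = g \<cdot> h"
  obtains u where "u \<in> Arr C" "Dom C u = Dom C h" "Cod C u = E" "e \<cdot> u = h"
proof -
  have "h \<in> Hom C (Dom C h) (Dom C f) \<and> f \<cdot> h = g \<cdot> h"
    using assms by (simp add: Hom_iff)
  then obtain u where "u \<in> Hom C (Dom C h) E" "e \<cdot> u = h"
    using assms(1) unfolding is_equalizer_def by blast
  then show thesis using that[of u] unfolding Hom_iff by blast
qed

lemma equalizer_mono:
  assumes "is_equalizer C f g E e"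
  shows "mono_arrow C e"
proof (rule mono_arrowI)
  note e = equalizer_arrow[OF assms]
  show "e \<in> Arr C" by (fact e)
  fix x y
  assume xy: "x \<in> Arr C" "y \<in> Arr C" "Cod C x = Dom C e" "Cod C y = Dom C e"
    "Dom C x = Dom C y" "e \<cdot> x = e \<cdot> y"
  have "e \<cdot> x \<in> Hom C (Dom C x) (Dom C f) \<and> f \<cdot> e \<cdot> x = g \<cdot> e \<cdot> x"
    using e xy by (simp add: Hom_iff comp_extend[OF e(8)])
  then have "\<exists>!u. u \<in> Hom C (Dom C x) E \<and> e \<cdot> u = e \<cdot> x"
    using assms unfolding is_equalizer_def by blast
  then show "x = y"
    using xy e by (auto simp: Hom_iff)
qed

lemma equalizerI:
  assumes "f \<in> Arr C" "g \<in> Arr C" "Dom C g = Dom C f" "Cod C g = Cod C f"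
    "mono_arrow C e" "Dom C e = E" "Cod C e = Dom C f" "f \<cdot> e = g \<cdot> e"
    "\<And>h. \<lbrakk>h \<in> Arr C; Cod C h = Dom C f; f \<cdot> h = g \<cdot> h\<rbrakk>
      \<Longrightarrow> \<exists>u. u \<in> Arr C \<and> Dom C u = Dom C h \<and> Cod C u = E \<and> e \<cdot> u = h"
  shows "is_equalizer C f g E e"
  unfolding is_equalizer_def
proof (intro conjI allI impI)
  show "parallel C f g" "e \<in> Hom C E (Dom C f)" "f \<cdot> e = g \<cdot> e"
    using assms(1-8) by (simp_all add: parallel_def Hom_iff mono_arrow_def)
  fix W h
  assume "h \<in> Hom C W (Dom C f) \<and> f \<cdot> h = g \<cdot> h"
  then obtain u where "u \<in> Hom C W E" "e \<cdot> u = h"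
    using assms(9)[of h] by (auto simp: Hom_iff)
  then show "\<exists>!u. u \<in> Hom C W E \<and> e \<cdot> u = h"
    using mono_arrowD[OF assms(5), of u] assms(6) by (metis Hom_iff mono_arrowD[OF assms(5)])
qed

lemma coequalizer_arrow:
  assumes "is_coequalizer C f g Q q"
  shows "f \<in> Arr C" "g \<in> Arr C" "Dom C g = Dom C f" "Cod C g = Cod C f"
    "q \<in> Arr C" "Dom C q = Cod C f" "Cod C q = Q" "q \<cdot> f = q \<cdot> g"
  using assms by (auto simp: is_coequalizer_def parallel_def Hom_iff)

lemma coequalizer_factor:
  assumes "is_coequalizer C f g Q q" "h \<in> Arr C" "Dom C h = Cod C f" "h \<cdot> f = h \<cdot> g"
  obtains u where "u \<in> Arr C" "Dom C u = Q" "Cod C u = Cod C h" "u \<cdot> q = h"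
proof -
  have "h \<in> Hom C (Cod C f) (Cod C h) \<and> h \<cdot> f = h \<cdot> g"
    using assms by (simp add: Hom_iff)
  then obtain u where "u \<in> Hom C Q (Cod C h)" "u \<cdot> q = h"
    using assms(1) unfolding is_coequalizer_def by blast
  then show thesis using that[of u] unfolding Hom_iff by blast
qed

lemma coequalizer_epi:
  assumes "is_coequalizer C f g Q q"
  shows "epi_arrow C q"
  unfolding epi_arrow_def
proof (intro conjI allI impI)
  note q = coequalizer_arrow[OF assms]
  show "q \<in> Arr C" by (fact q)
  fix W x y
  assume xy: "x \<in> Hom C (Cod C q) W \<and> y \<in> Hom C (Cod C q) W \<and> x \<cdot> q = y \<cdot> q"
  then have "(x \<cdot> q) \<in> Hom C (Cod C f) W \<and> (x \<cdot> q) \<cdot> f = (x \<cdot> q) \<cdot> g"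
    using q by (simp add: Hom_iff)
  then have "\<exists>!u. u \<in> Hom C Q W \<and> u \<cdot> q = x \<cdot> q"
    using assms unfolding is_coequalizer_def by blast
  then show "x = y"
    using xy q by (auto simp: Hom_iff)
qed

end

section \<open>Factorization through image and coimage\<close>

locale preadditive_category = category C
  for C :: "('o, 'm, 'z) category_scheme" (structure) +
  fixes add :: "'m \<Rightarrow> 'm \<Rightarrow> 'm" and zero :: "'o \<Rightarrow> 'o \<Rightarrow> 'm"
  assumes preadditive: "preadditive C add zero"
begin

lemma Hom_group:
  "X \<in> Obj C \<Longrightarrow> Y \<in> Obj C
    \<Longrightarrow> comm_group \<lparr>carrier = Hom C X Y, monoid.mult = add, one = zero X Y\<rparr>"
  using preadditive by (auto simp: preadditive_def)

lemma zero_simps [simp]: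
  assumes "X \<in> Obj C" "Y \<in> Obj C"
  shows "zero X Y \<in> Arr C" "Dom C (zero X Y) = X" "Cod C (zero X Y) = Y"
proof -
  interpret G: comm_group "\<lparr>carrier = Hom C X Y, monoid.mult = add, one = zero X Y\<rparr>"
    using Hom_group assms by blast
  show "zero X Y \<in> Arr C" "Dom C (zero X Y) = X" "Cod C (zero X Y) = Y"
    using G.one_closed by (simp_all add: Hom_iff)
qed

lemma add_eq_right_iff:
  assumes "f \<in> Hom C X Y" "g \<in> Hom C X Y" "add f g = g"
  shows "f = zero X Y"
proof -
  interpret G: comm_group "\<lparr>carrier = Hom C X Y, monoid.mult = add, one = zero X Y\<rparr>"
    using Hom_group Hom_Obj[OF assms(1)] by blast
  show ?thesis using assms G.r_cancel_one[of g f] by simp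
qed

lemma add_zero: "X \<in> Obj C \<Longrightarrow> Y \<in> Obj C \<Longrightarrow> add (zero X Y) (zero X Y) = zero X Y"
proof -
  assume "X \<in> Obj C" "Y \<in> Obj C"
  then interpret G: comm_group "\<lparr>carrier = Hom C X Y, monoid.mult = add, one = zero X Y\<rparr>"
    using Hom_group by blast
  show ?thesis using G.l_one[of "zero X Y"] G.one_closed by simp
qed

lemma comp_zero [simp]:
  assumes "h \<in> Arr C" "Dom C h = Y" "X \<in> Obj C"
  shows "h \<cdot> zero X Y = zero X (Cod C h)"
proof -
  have Y: "Y \<in> Obj C" using assms by auto
  have "add (h \<cdot> zero X Y) (h \<cdot> zero X Y) = h \<cdot> add (zero X Y) (zero X Y)"
    using preadditive assms Y unfolding preadditive_def Hom_iff
    by (metis zero_simps)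
  then show ?thesis
    using assms Y add_zero[of X Y]
    by - (rule add_eq_right_iff, simp_all add: Hom_iff)
qed

lemma zero_comp [simp]:
  assumes "h \<in> Arr C" "Cod C h = X" "Y \<in> Obj C"
  shows "zero X Y \<cdot> h = zero (Dom C h) Y"
proof -
  have X: "X \<in> Obj C" using assms by auto
  have "add (zero X Y \<cdot> h) (zero X Y \<cdot> h) = add (zero X Y) (zero X Y) \<cdot> h"
    using preadditive assms X unfolding preadditive_def Hom_iff
    by (metis zero_simps)
  then show ?thesis
    using assms X add_zero[of X Y]
    by - (rule add_eq_right_iff, simp_all add: Hom_iff)
qed

lemma mono_if_zero_kernel:
  assumes i: "i \<in> Arr C"
    and ker: "\<And>x. \<lbrakk>x \<in> Arr C; Cod C x = Dom C i; i \<cdot> x = zero (Dom C x) (Cod C i)\<rbrakk>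
      \<Longrightarrow> x = zero (Dom C x) (Dom C i)"
  shows "mono_arrow C i"
proof (rule mono_arrowI[OF i])
  fix g h
  assume gh: "g \<in> Arr C" "h \<in> Arr C" "Cod C g = Dom C i" "Cod C h = Dom C i"
    "Dom C g = Dom C h" "i \<cdot> g = i \<cdot> h"
  let ?W = "Dom C h" and ?X = "Dom C i"
  have obj: "?W \<in> Obj C" "?X \<in> Obj C" using gh i by auto
  let ?G = "\<lparr>carrier = Hom C ?W ?X, monoid.mult = add, one = zero ?W ?X\<rparr>"
  interpret G: comm_group ?G using Hom_group[OF obj] .
  define x where "x = g \<otimes>\<^bsub>?G\<^esub> inv\<^bsub>?G\<^esub> h"
  have car: "g \<in> carrier ?G" "h \<in> carrier ?G" using gh by (auto simp: Hom_iff)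
  then have x: "x \<in> carrier ?G" unfolding x_def by blast
  have xh: "add x h = g"
    using G.m_assoc[of g "inv\<^bsub>?G\<^esub> h" h] G.l_inv[of h] G.r_one[of g] G.inv_closed[of h] car
    unfolding x_def by simp
  have "add (i \<cdot> x) (i \<cdot> h) = i \<cdot> add x h"
    using preadditive x i gh unfolding preadditive_def
    by (simp add: Hom_iff)
  then have "i \<cdot> x = zero ?W (Cod C i)"
    using xh gh x i by - (rule add_eq_right_iff[of _ _ _ "i \<cdot> h"], auto simp: Hom_iff)
  then have "x = zero ?W ?X" using ker[of x] x by (simp add: Hom_iff)
  then show "g = h" using xh G.l_one[of h] car by simp
qed

end

text \<open>The factorization \<open>f = i \<cdot> p\<close> of an arrow of an abelian category through its coimage.
  The arrow \<open>i\<close> is monic: if \<open>i \<cdot> x = 0\<close> and \<open>c\<close> is the cokernel of \<open>x\<close>, then \<open>c \<cdot> p\<close> is a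
  cokernel of some \<open>h\<close>; since \<open>f \<cdot> h = 0\<close>, the arrow \<open>h\<close> factors through the kernel of \<open>f\<close>, so
  \<open>p \<cdot> h = 0\<close> and \<open>c\<close> is split monic, whence \<open>x = 0\<close>.  A monic arrow is a kernel, and therefore
  the kernel of its own cokernel, which is that of \<open>f\<close>.\<close>

lemma (in preadditive_category) coimage_factorization:
  assumes cokernels: "\<And>X Y f. f \<in> Hom C X Y \<Longrightarrow> \<exists>Q q. is_coequalizer C f (zero X Y) Q q"
    and normal_mono: "\<And>m. mono_arrow C m
      \<Longrightarrow> \<exists>X Y. \<exists>f\<in>Hom C X Y. is_equalizer C f (zero X Y) (Dom C m) m"
    and normal_epi: "\<And>e. epi_arrow C e
      \<Longrightarrow> \<exists>X Y. \<exists>f\<in>Hom C X Y. is_coequalizer C f (zero X Y) (Cod C e) e"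
    and K: "is_equalizer C f (zero X Y) K k" and Q: "is_coequalizer C f (zero X Y) Q q"
    and f: "f \<in> Hom C X Y"
  obtains I p i where "p \<in> Hom C X I" "i \<in> Hom C I Y" "i \<cdot> p = f"
    "is_coequalizer C k (zero K X) I p" "is_equalizer C q (zero Y Q) I i"
proof -
  note f' = f[unfolded Hom_iff]
  have XY: "X \<in> Obj C" "Y \<in> Obj C" using f' by auto
  note k = equalizer_arrow[OF K] and q = coequalizer_arrow[OF Q]
  have KO: "K \<in> Obj C" using k by auto
  have fk: "f \<cdot> k = zero K Y" using k f' XY by simp
  have QO: "Q \<in> Obj C" using q by auto
  have qf: "q \<cdot> f = zero X Q" using q f' XY by simp
  obtain I p where P: "is_coequalizer C k (zero K X) I p"
    using cokernels[of k K X] k f' by (auto simp: Hom_iff)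
  note p = coequalizer_arrow[OF P]
  have pX: "Dom C p = X" using p k f' by simp
  have IO: "I \<in> Obj C" using p by auto
  have pk: "p \<cdot> k = zero K I" using p KO pX by simp
  have p_epi: "epi_arrow C p" by (rule coequalizer_epi[OF P])
  obtain i where i: "i \<in> Arr C" "Dom C i = I" "Cod C i = Y" "i \<cdot> p = f"
    using coequalizer_factor[OF P, of f] f' fk k KO by auto
  have i_mono: "mono_arrow C i"
  proof (rule mono_if_zero_kernel[OF i(1)])
    fix x
    assume x: "x \<in> Arr C" "Cod C x = Dom C i" "i \<cdot> x = zero (Dom C x) (Cod C i)"
    define W where "W = Dom C x"
    have W: "W \<in> Obj C" unfolding W_def using x by auto
    obtain J c where J: "is_coequalizer C x (zero W I) J c"
      using cokernels[of x W I] x i W_def by (auto simp: Hom_iff)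
    note c = coequalizer_arrow[OF J]
    have cI: "Dom C c = I" using c x i by simp
    obtain i' where i': "i' \<in> Arr C" "Dom C i' = J" "Cod C i' = Y" "i' \<cdot> c = i"
      using coequalizer_factor[OF J, of i] i x W W_def by auto
    have "epi_arrow C (c \<cdot> p)"
      unfolding epi_arrow_def
    proof (intro conjI allI impI)
      show "c \<cdot> p \<in> Arr C" using c p cI by simp
      fix V g h
      assume gh: "g \<in> Hom C (Cod C (c \<cdot> p)) V \<and> h \<in> Hom C (Cod C (c \<cdot> p)) V
        \<and> g \<cdot> c \<cdot> p = h \<cdot> c \<cdot> p"
      then have "g \<cdot> c = h \<cdot> c"
        using c p cI by - (rule epi_arrowD[OF p_epi], simp_all add: Hom_iff)
      then show "g = h"
        using gh c p cI by - (rule epi_arrowD[OF coequalizer_epi[OF J]], simp_all add: Hom_iff)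
    qed
    from normal_epi[OF this] obtain X' Y' h
      where h: "h \<in> Hom C X' Y'" and H: "is_coequalizer C h (zero X' Y') (Cod C (c \<cdot> p)) (c \<cdot> p)"
      by blast
    note cp = coequalizer_arrow[OF H]
    have h': "h \<in> Arr C" "Dom C h = X'" "Cod C h = X"
      using cp h c p cI pX by (auto simp: Hom_iff)
    have X': "X' \<in> Obj C" using h' by auto
    have cph: "c \<cdot> p \<cdot> h = zero X' J"
      using cp h h' c p cI pX X' XY by (simp add: Hom_iff)
    have "f \<cdot> h = i' \<cdot> c \<cdot> p \<cdot> h"
      using i i' h' c p cI pX comp_extend[OF i(4), of h] comp_extend[OF i'(4), of "p \<cdot> h"] by simp
    also have "\<dots> = zero X' Y" using cph i' X' by simp
    finally obtain h2 where h2: "h2 \<in> Arr C" "Dom C h2 = X'" "Cod C h2 = K" "k \<cdot> h2 = h"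
      using equalizer_factor[OF K, of h] h' f' XY by auto
    have "p \<cdot> h = p \<cdot> k \<cdot> h2" using h2 by simp
    also have "\<dots> = zero X' I"
      using comp_extend[OF pk, of h2] h2 p k pX f' IO KO by simp
    finally have ph: "p \<cdot> h = zero X' I" .
    then obtain t where t: "t \<in> Arr C" "Dom C t = J" "Cod C t = I" "t \<cdot> c \<cdot> p = p"
      using coequalizer_factor[OF H, of p] p c cI pX h h' X' by (auto simp: Hom_iff)
    have "t \<cdot> c = \<iota> I"
      using t p c cI IO by - (rule epi_arrowD[OF p_epi], simp_all)
    then have "x = t \<cdot> c \<cdot> x"
      using comp_extend[of t c "\<iota> I" x] t c cI x i by simp
    also have "\<dots> = t \<cdot> c \<cdot> zero W I" using c by simp
    also have "\<dots> = zero W I" using c cI W t by simp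
    finally show "x = zero (Dom C x) (Dom C i)" using W_def i by simp
  qed
  obtain Y' Z g where g: "g \<in> Hom C Y' Z" and G: "is_equalizer C g (zero Y' Z) (Dom C i) i"
    using normal_mono[OF i_mono] by blast
  note gi = equalizer_arrow[OF G]
  have g': "g \<in> Arr C" "Dom C g = Y" "Cod C g = Z" "Y' = Y"
    using gi g i by (auto simp: Hom_iff)
  have ZO: "Z \<in> Obj C" using g' by auto
  have gi0: "g \<cdot> i = zero I Z" using gi g' i ZO XY by simp
  have "g \<cdot> f = zero X Z"
    using comp_extend[OF gi0, of p] gi0 i p pX g' ZO by simp
  then obtain g2 where g2: "g2 \<in> Arr C" "Dom C g2 = Q" "Cod C g2 = Z" "g2 \<cdot> q = g"
    using coequalizer_factor[OF Q, of g] g' f' XY by auto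
  have "is_equalizer C q (zero Y Q) I i"
  proof (rule equalizerI[OF _ _ _ _ i_mono])
    show "q \<in> Arr C" "zero Y Q \<in> Arr C" "Dom C (zero Y Q) = Dom C q" "Cod C (zero Y Q) = Cod C q"
      "Dom C i = I" "Cod C i = Dom C q"
      using q f' XY QO i by simp_all
    have "q \<cdot> i = zero I Q"
      using i q f' p pX IO QO qf by - (rule epi_arrowD[OF p_epi], simp_all)
    then show "q \<cdot> i = zero Y Q \<cdot> i"
      using i QO by simp
    fix w
    assume w: "w \<in> Arr C" "Cod C w = Dom C q" "q \<cdot> w = zero Y Q \<cdot> w"
    then have "g \<cdot> w = zero (Dom C w) Z"
      using comp_extend[OF g2(4), of w] g2 q f' QO by simp
    then show "\<exists>u. u \<in> Arr C \<and> Dom C u = Dom C w \<and> Cod C u = I \<and> i \<cdot> u = w"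
      using equalizer_factor[OF G, of w] w q f' g' ZO i by auto
  qed
  with that[OF _ _ i(4) P] show thesis using p pX i by (simp add: Hom_iff)
qed

section \<open>Coherence in symmetric monoidal categories\<close>

context symmetric_monoidal_category
begin

abbreviation ainv :: "'o \<Rightarrow> 'o \<Rightarrow> 'o \<Rightarrow> 'm" where "ainv X Y Z \<equiv> inv_arrow C (\<a> X Y Z)"
abbreviation linv :: "'o \<Rightarrow> 'm" where "linv X \<equiv> inv_arrow C (\<l> X)"
abbreviation rinv :: "'o \<Rightarrow> 'm" where "rinv X \<equiv> inv_arrow C (\<r> X)"
abbreviation mid :: "'o \<Rightarrow> 'o \<Rightarrow> 'o \<Rightarrow> 'o \<Rightarrow> 'm" where "mid \<equiv> middle_four C"

declare UnitO_Obj [simp] TenO_Obj [simp] TenA_Idn [simp]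
  Assoc_iso [simp] LUnit_iso [simp] RUnit_iso [simp] Braid_Braid [simp]

lemma ten_simps [simp]:
  assumes "f \<in> Arr C" "g \<in> Arr C"
  shows "f \<otimes>\<^sub>a g \<in> Arr C" "Dom C (f \<otimes>\<^sub>a g) = Dom C f \<otimes>\<^sub>o Dom C g"
    "Cod C (f \<otimes>\<^sub>a g) = Cod C f \<otimes>\<^sub>o Cod C g"
  using TenA_Hom[of f "Dom C f" "Cod C f" g "Dom C g" "Cod C g"] assms by (simp_all add: Hom_iff)

lemma assoc_simps [simp]:
  assumes "X \<in> Obj C" "Y \<in> Obj C" "Z \<in> Obj C"
  shows "Dom C (\<a> X Y Z) = (X \<otimes>\<^sub>o Y) \<otimes>\<^sub>o Z" "Cod C (\<a> X Y Z) = X \<otimes>\<^sub>o (Y \<otimes>\<^sub>o Z)"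
  using Assoc_Hom[OF assms] by (simp_all add: Hom_iff)

lemma unitor_simps [simp]:
  assumes "X \<in> Obj C"
  shows "Dom C (\<l> X) = \<I> \<otimes>\<^sub>o X" "Cod C (\<l> X) = X"
    "Dom C (\<r> X) = X \<otimes>\<^sub>o \<I>" "Cod C (\<r> X) = X"
  using LUnit_Hom[OF assms] RUnit_Hom[OF assms] by (simp_all add: Hom_iff)

lemma braid_simps [simp]:
  assumes "X \<in> Obj C" "Y \<in> Obj C"
  shows "\<s> X Y \<in> Arr C" "Dom C (\<s> X Y) = X \<otimes>\<^sub>o Y" "Cod C (\<s> X Y) = Y \<otimes>\<^sub>o X"
  using Braid_Hom[OF assms] by (simp_all add: Hom_iff)

lemma interchange:
  assumes "f \<in> Arr C" "g \<in> Arr C" "f' \<in> Arr C" "g' \<in> Arr C"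
    "Cod C f = Dom C g" "Cod C f' = Dom C g'"
  shows "(g \<otimes>\<^sub>a g') \<cdot> (f \<otimes>\<^sub>a f') = (g \<cdot> f) \<otimes>\<^sub>a (g' \<cdot> f')"
  using TenA_Comp[of f "Dom C f" "Cod C f" g "Cod C g" f' "Dom C f'" "Cod C f'" g' "Cod C g'"]
    assms by (simp add: Hom_iff)

lemmas merge = interchange comp_extend[OF interchange]

lemma assoc_nat:
  assumes "f \<in> Arr C" "g \<in> Arr C" "h \<in> Arr C" "Cod C f = X" "Cod C g = Y" "Cod C h = Z"
  shows "\<a> X Y Z \<cdot> ((f \<otimes>\<^sub>a g) \<otimes>\<^sub>a h) = (f \<otimes>\<^sub>a (g \<otimes>\<^sub>a h)) \<cdot> \<a> (Dom C f) (Dom C g) (Dom C h)"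
  using Assoc_natural[of f "Dom C f" X g "Dom C g" Y h "Dom C h" Z] assms by (simp add: Hom_iff)

lemma assoc_nat_idn:
  assumes "X \<in> Obj C" "Y \<in> Obj C" "h \<in> Arr C" "Cod C h = Z"
  shows "\<a> X Y Z \<cdot> (\<iota> (X \<otimes>\<^sub>o Y) \<otimes>\<^sub>a h) = (\<iota> X \<otimes>\<^sub>a (\<iota> Y \<otimes>\<^sub>a h)) \<cdot> \<a> X Y (Dom C h)"
  using assms assoc_nat[of "\<iota> X" "\<iota> Y" h X Y Z] by simp

lemma ainv_nat:
  assumes "f \<in> Arr C" "g \<in> Arr C" "h \<in> Arr C" "Cod C f = X" "Cod C g = Y" "Cod C h = Z"
  shows "ainv X Y Z \<cdot> (f \<otimes>\<^sub>a (g \<otimes>\<^sub>a h)) = ((f \<otimes>\<^sub>a g) \<otimes>\<^sub>a h) \<cdot> ainv (Dom C f) (Dom C g) (Dom C h)"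
proof -
  let ?a = "\<a> (Dom C f) (Dom C g) (Dom C h)" and ?b = "ainv (Dom C f) (Dom C g) (Dom C h)"
  have obj: "X \<in> Obj C" "Y \<in> Obj C" "Z \<in> Obj C" using assms by auto
  have "ainv X Y Z \<cdot> (f \<otimes>\<^sub>a (g \<otimes>\<^sub>a h)) = ainv X Y Z \<cdot> (f \<otimes>\<^sub>a (g \<otimes>\<^sub>a h)) \<cdot> ?a \<cdot> ?b"
    using assms obj by simp
  also have "\<dots> = ainv X Y Z \<cdot> \<a> X Y Z \<cdot> ((f \<otimes>\<^sub>a g) \<otimes>\<^sub>a h) \<cdot> ?b"
    using assms obj by (simp add: comp_extend[OF assoc_nat] del: iso_cancel iso_simps(5,6))
  also have "\<dots> = ((f \<otimes>\<^sub>a g) \<otimes>\<^sub>a h) \<cdot> ?b"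
    using assms obj by simp
  finally show ?thesis .
qed

lemma ainv_nat_idn:
  assumes "f \<in> Arr C" "Cod C f = X" "Y \<in> Obj C" "Z \<in> Obj C"
  shows "ainv X Y Z \<cdot> (f \<otimes>\<^sub>a \<iota> (Y \<otimes>\<^sub>o Z)) = ((f \<otimes>\<^sub>a \<iota> Y) \<otimes>\<^sub>a \<iota> Z) \<cdot> ainv (Dom C f) Y Z"
  using assms ainv_nat[of f "\<iota> Y" "\<iota> Z" X Y Z] by simp

lemma l_nat:
  assumes "f \<in> Arr C" "Cod C f = Y"
  shows "\<l> Y \<cdot> (\<iota> \<I> \<otimes>\<^sub>a f) = f \<cdot> \<l> (Dom C f)"
  using LUnit_natural[of f "Dom C f" Y] assms by (simp add: Hom_iff)

lemma r_nat:
  assumes "f \<in> Arr C" "Cod C f = Y"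
  shows "\<r> Y \<cdot> (f \<otimes>\<^sub>a \<iota> \<I>) = f \<cdot> \<r> (Dom C f)"
  using RUnit_natural[of f "Dom C f" Y] assms by (simp add: Hom_iff)

lemma linv_nat:
  assumes "f \<in> Arr C" "Cod C f = Y"
  shows "linv Y \<cdot> f = (\<iota> \<I> \<otimes>\<^sub>a f) \<cdot> linv (Dom C f)"
proof -
  have Y: "Y \<in> Obj C" using assms by auto
  have "linv Y \<cdot> f = linv Y \<cdot> (\<l> Y \<cdot> (\<iota> \<I> \<otimes>\<^sub>a f)) \<cdot> linv (Dom C f)"
    using assms Y by (simp add: comp_extend[OF l_nat])
  also have "\<dots> = (\<iota> \<I> \<otimes>\<^sub>a f) \<cdot> linv (Dom C f)"
    using assms Y by simp
  finally show ?thesis .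
qed

lemma rinv_nat:
  assumes "f \<in> Arr C" "Cod C f = Y"
  shows "rinv Y \<cdot> f = (f \<otimes>\<^sub>a \<iota> \<I>) \<cdot> rinv (Dom C f)"
proof -
  have Y: "Y \<in> Obj C" using assms by auto
  have "rinv Y \<cdot> f = rinv Y \<cdot> (\<r> Y \<cdot> (f \<otimes>\<^sub>a \<iota> \<I>)) \<cdot> rinv (Dom C f)"
    using assms Y by (simp add: comp_extend[OF r_nat])
  also have "\<dots> = (f \<otimes>\<^sub>a \<iota> \<I>) \<cdot> rinv (Dom C f)"
    using assms Y by simp
  finally show ?thesis .
qed

lemma s_nat:
  assumes "f \<in> Arr C" "g \<in> Arr C" "Cod C f = X" "Cod C g = Y"
  shows "\<s> X Y \<cdot> (f \<otimes>\<^sub>a g) = (g \<otimes>\<^sub>a f) \<cdot> \<s> (Dom C f) (Dom C g)"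
  using Braid_natural[of f "Dom C f" X g "Dom C g" Y] assms by (simp add: Hom_iff)

lemma iso_ten:
  assumes "iso_arrow C f" "iso_arrow C g"
  shows "iso_arrow C (f \<otimes>\<^sub>a g)" "inv_arrow C (f \<otimes>\<^sub>a g) = inv_arrow C f \<otimes>\<^sub>a inv_arrow C g"
proof -
  have *: "inverse_arrows C (f \<otimes>\<^sub>a g) (inv_arrow C f \<otimes>\<^sub>a inv_arrow C g)"
    using assms by (simp add: inverse_arrows_def Hom_iff interchange)
  show "iso_arrow C (f \<otimes>\<^sub>a g)" using * by (auto simp: iso_arrow_def)
  show "inv_arrow C (f \<otimes>\<^sub>a g) = inv_arrow C f \<otimes>\<^sub>a inv_arrow C g"
    by (rule inv_arrow_eq[OF *])
qed

lemma iso_idn: "X \<in> Obj C \<Longrightarrow> iso_arrow C (\<iota> X)" "X \<in> Obj C \<Longrightarrow> inv_arrow C (\<iota> X) = \<iota> X"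
proof -
  assume X: "X \<in> Obj C"
  have *: "inverse_arrows C (\<iota> X) (\<iota> X)"
    using X by (simp add: inverse_arrows_def Hom_iff)
  show "iso_arrow C (\<iota> X)" "inv_arrow C (\<iota> X) = \<iota> X"
    using * inv_arrow_eq[OF *] by (auto simp: iso_arrow_def)
qed

lemma iso_epi_cancel:
  assumes "iso_arrow C t" "f \<in> Arr C" "g \<in> Arr C" "Dom C f = Cod C t" "Dom C g = Cod C t"
    "f \<cdot> t = g \<cdot> t"
  shows "f = g"
proof -
  have "f = (f \<cdot> t) \<cdot> inv_arrow C t" "g = (g \<cdot> t) \<cdot> inv_arrow C t"
    using assms(1-5) by simp_all
  with assms(6) show ?thesis by simp
qed

lemma iso_mono_cancel:
  assumes "iso_arrow C t" "f \<in> Arr C" "g \<in> Arr C" "Cod C f = Dom C t" "Cod C g = Dom C t"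
    "t \<cdot> f = t \<cdot> g"
  shows "f = g"
proof -
  have "f = inv_arrow C t \<cdot> t \<cdot> f" "g = inv_arrow C t \<cdot> t \<cdot> g"
    using assms(1-5) by simp_all
  with assms(6) show ?thesis by simp
qed

lemma left_unit_faithful:
  assumes "f \<in> Arr C" "g \<in> Arr C" "Dom C f = Dom C g" "Cod C f = Cod C g"
    "\<iota> \<I> \<otimes>\<^sub>a f = \<iota> \<I> \<otimes>\<^sub>a g"
  shows "f = g"
proof (rule iso_epi_cancel[of "\<l> (Dom C g)"])
  show "f \<cdot> \<l> (Dom C g) = g \<cdot> \<l> (Dom C g)"
    using assms l_nat[of f "Cod C g"] l_nat[of g "Cod C g"] by simp
qed (use assms in simp_all)

lemma right_unit_faithful:
  assumes "f \<in> Arr C" "g \<in> Arr C" "Dom C f = Dom C g" "Cod C f = Cod C g"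
    "f \<otimes>\<^sub>a \<iota> \<I> = g \<otimes>\<^sub>a \<iota> \<I>"
  shows "f = g"
proof (rule iso_epi_cancel[of "\<r> (Dom C g)"])
  show "f \<cdot> \<r> (Dom C g) = g \<cdot> \<r> (Dom C g)"
    using assms r_nat[of f "Cod C g"] r_nat[of g "Cod C g"] by simp
qed (use assms in simp_all)

text \<open>Kelly's consequences of the pentagon and triangle identities, all obtained by tensoring
  with the unit object, which is faithful.\<close>

lemma l_ten:
  assumes X: "X \<in> Obj C" and Y: "Y \<in> Obj C"
  shows "\<l> (X \<otimes>\<^sub>o Y) \<cdot> \<a> \<I> X Y = \<l> X \<otimes>\<^sub>a \<iota> Y"
proof (rule left_unit_faithful)
  note XY = X Y
  let ?T = "\<a> \<I> (\<I> \<otimes>\<^sub>o X) Y \<cdot> (\<a> \<I> \<I> X \<otimes>\<^sub>a \<iota> Y)"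
  have "(\<iota> \<I> \<otimes>\<^sub>a (\<l> (X \<otimes>\<^sub>o Y) \<cdot> \<a> \<I> X Y)) \<cdot> ?T
      = (\<iota> \<I> \<otimes>\<^sub>a \<l> (X \<otimes>\<^sub>o Y)) \<cdot> (\<iota> \<I> \<otimes>\<^sub>a \<a> \<I> X Y) \<cdot> ?T"
    using XY by (simp add: merge)
  also have "\<dots> = (\<iota> \<I> \<otimes>\<^sub>a \<l> (X \<otimes>\<^sub>o Y)) \<cdot> \<a> \<I> \<I> (X \<otimes>\<^sub>o Y) \<cdot> \<a> (\<I> \<otimes>\<^sub>o \<I>) X Y"
    using XY by (simp add: pentagon)
  also have "\<dots> = (\<r> \<I> \<otimes>\<^sub>a \<iota> (X \<otimes>\<^sub>o Y)) \<cdot> \<a> (\<I> \<otimes>\<^sub>o \<I>) X Y"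
    using XY comp_extend[OF triangle[of \<I> "X \<otimes>\<^sub>o Y"], of "\<a> (\<I> \<otimes>\<^sub>o \<I>) X Y"] by simp
  also have "\<dots> = \<a> \<I> X Y \<cdot> ((\<r> \<I> \<otimes>\<^sub>a \<iota> X) \<otimes>\<^sub>a \<iota> Y)"
    using XY by (simp add: assoc_nat)
  also have "\<dots> = \<a> \<I> X Y \<cdot> ((\<iota> \<I> \<otimes>\<^sub>a \<l> X) \<otimes>\<^sub>a \<iota> Y) \<cdot> (\<a> \<I> \<I> X \<otimes>\<^sub>a \<iota> Y)"
    using XY by (simp add: merge triangle)
  also have "\<dots> = (\<iota> \<I> \<otimes>\<^sub>a (\<l> X \<otimes>\<^sub>a \<iota> Y)) \<cdot> ?T"
    using XY by (simp add: comp_extend[OF assoc_nat])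
  finally have *: "(\<iota> \<I> \<otimes>\<^sub>a (\<l> (X \<otimes>\<^sub>o Y) \<cdot> \<a> \<I> X Y)) \<cdot> ?T
    = (\<iota> \<I> \<otimes>\<^sub>a (\<l> X \<otimes>\<^sub>a \<iota> Y)) \<cdot> ?T" .
  have "(\<iota> \<I> \<otimes>\<^sub>a (\<l> (X \<otimes>\<^sub>o Y) \<cdot> \<a> \<I> X Y)) \<cdot> \<a> \<I> (\<I> \<otimes>\<^sub>o X) Y
    = (\<iota> \<I> \<otimes>\<^sub>a (\<l> X \<otimes>\<^sub>a \<iota> Y)) \<cdot> \<a> \<I> (\<I> \<otimes>\<^sub>o X) Y"
    by (rule iso_epi_cancel[of "\<a> \<I> \<I> X \<otimes>\<^sub>a \<iota> Y"])
      (use XY * in \<open>simp_all add: iso_ten iso_idn\<close>)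
  then show "\<iota> \<I> \<otimes>\<^sub>a (\<l> (X \<otimes>\<^sub>o Y) \<cdot> \<a> \<I> X Y) = \<iota> \<I> \<otimes>\<^sub>a (\<l> X \<otimes>\<^sub>a \<iota> Y)"
    by - (rule iso_epi_cancel[of "\<a> \<I> (\<I> \<otimes>\<^sub>o X) Y"], use XY in simp_all)
qed (use X Y in simp_all)

lemma r_ten:
  assumes X: "X \<in> Obj C" and Y: "Y \<in> Obj C"
  shows "(\<iota> X \<otimes>\<^sub>a \<r> Y) \<cdot> \<a> X Y \<I> = \<r> (X \<otimes>\<^sub>o Y)"
proof (rule right_unit_faithful)
  note XY = X Y
  have "\<a> X Y \<I> \<cdot> (((\<iota> X \<otimes>\<^sub>a \<r> Y) \<cdot> \<a> X Y \<I>) \<otimes>\<^sub>a \<iota> \<I>)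
      = \<a> X Y \<I> \<cdot> ((\<iota> X \<otimes>\<^sub>a \<r> Y) \<otimes>\<^sub>a \<iota> \<I>) \<cdot> (\<a> X Y \<I> \<otimes>\<^sub>a \<iota> \<I>)"
    using XY by (simp add: merge)
  also have "\<dots> = (\<iota> X \<otimes>\<^sub>a (\<r> Y \<otimes>\<^sub>a \<iota> \<I>)) \<cdot> \<a> X (Y \<otimes>\<^sub>o \<I>) \<I> \<cdot> (\<a> X Y \<I> \<otimes>\<^sub>a \<iota> \<I>)"
    using XY by (simp add: comp_extend[OF assoc_nat])
  also have "\<dots> = (\<iota> X \<otimes>\<^sub>a (\<iota> Y \<otimes>\<^sub>a \<l> \<I>)) \<cdot> (\<iota> X \<otimes>\<^sub>a \<a> Y \<I> \<I>)
      \<cdot> \<a> X (Y \<otimes>\<^sub>o \<I>) \<I> \<cdot> (\<a> X Y \<I> \<otimes>\<^sub>a \<iota> \<I>)"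
    using XY by (simp add: merge triangle)
  also have "\<dots> = (\<iota> X \<otimes>\<^sub>a (\<iota> Y \<otimes>\<^sub>a \<l> \<I>)) \<cdot> \<a> X Y (\<I> \<otimes>\<^sub>o \<I>) \<cdot> \<a> (X \<otimes>\<^sub>o Y) \<I> \<I>"
    using XY by (simp add: pentagon)
  also have "\<dots> = \<a> X Y \<I> \<cdot> (\<iota> (X \<otimes>\<^sub>o Y) \<otimes>\<^sub>a \<l> \<I>) \<cdot> \<a> (X \<otimes>\<^sub>o Y) \<I> \<I>"
    using XY by (simp add: comp_extend[OF assoc_nat_idn])
  also have "\<dots> = \<a> X Y \<I> \<cdot> (\<r> (X \<otimes>\<^sub>o Y) \<otimes>\<^sub>a \<iota> \<I>)"
    using XY by (simp add: triangle)
  finally show "((\<iota> X \<otimes>\<^sub>a \<r> Y) \<cdot> \<a> X Y \<I>) \<otimes>\<^sub>a \<iota> \<I> = \<r> (X \<otimes>\<^sub>o Y) \<otimes>\<^sub>a \<iota> \<I>"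
    by - (rule iso_mono_cancel[of "\<a> X Y \<I>"], use XY in simp_all)
qed (use X Y in simp_all)

lemma l_unit: "\<l> \<I> = \<r> \<I>"
proof (rule right_unit_faithful)
  have "\<l> (\<I> \<otimes>\<^sub>o \<I>) = \<iota> \<I> \<otimes>\<^sub>a \<l> \<I>"
    by (rule iso_mono_cancel[of "\<l> \<I>"]) (simp_all add: l_nat)
  then show "\<l> \<I> \<otimes>\<^sub>a \<iota> \<I> = \<r> \<I> \<otimes>\<^sub>a \<iota> \<I>"
    using l_ten[of \<I> \<I>] triangle[of \<I> \<I>] by simp
qed simp_all

lemma l_braid:
  assumes X: "X \<in> Obj C"
  shows "\<l> X \<cdot> \<s> X \<I> = \<r> X"
proof (rule right_unit_faithful)
  have "\<s> X \<I> \<cdot> ((\<l> X \<cdot> \<s> X \<I>) \<otimes>\<^sub>a \<iota> \<I>) = \<s> X \<I> \<cdot> (\<l> X \<otimes>\<^sub>a \<iota> \<I>) \<cdot> (\<s> X \<I> \<otimes>\<^sub>a \<iota> \<I>)"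
    using X by (simp add: merge)
  also have "\<dots> = \<s> X \<I> \<cdot> \<l> (X \<otimes>\<^sub>o \<I>) \<cdot> \<a> \<I> X \<I> \<cdot> (\<s> X \<I> \<otimes>\<^sub>a \<iota> \<I>)"
    using X by (simp add: l_ten comp_extend[OF l_ten])
  also have "\<dots> = \<l> (\<I> \<otimes>\<^sub>o X) \<cdot> (\<iota> \<I> \<otimes>\<^sub>a \<s> X \<I>) \<cdot> \<a> \<I> X \<I> \<cdot> (\<s> X \<I> \<otimes>\<^sub>a \<iota> \<I>)"
    using X by (simp add: comp_extend[OF l_nat])
  also have "\<dots> = \<l> (\<I> \<otimes>\<^sub>o X) \<cdot> \<a> \<I> \<I> X \<cdot> \<s> X (\<I> \<otimes>\<^sub>o \<I>) \<cdot> \<a> X \<I> \<I>"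
    using X by (simp add: hexagon)
  also have "\<dots> = (\<l> \<I> \<otimes>\<^sub>a \<iota> X) \<cdot> \<s> X (\<I> \<otimes>\<^sub>o \<I>) \<cdot> \<a> X \<I> \<I>"
    using X by (simp add: comp_extend[OF l_ten])
  also have "\<dots> = \<s> X \<I> \<cdot> (\<iota> X \<otimes>\<^sub>a \<l> \<I>) \<cdot> \<a> X \<I> \<I>"
    using X by (simp add: comp_extend[OF s_nat])
  also have "\<dots> = \<s> X \<I> \<cdot> (\<r> X \<otimes>\<^sub>a \<iota> \<I>)"
    using X by (simp add: triangle)
  finally have "\<s> \<I> X \<cdot> \<s> X \<I> \<cdot> ((\<l> X \<cdot> \<s> X \<I>) \<otimes>\<^sub>a \<iota> \<I>) = \<s> \<I> X \<cdot> \<s> X \<I> \<cdot> (\<r> X \<otimes>\<^sub>a \<iota> \<I>)"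
    by simp
  then show "(\<l> X \<cdot> \<s> X \<I>) \<otimes>\<^sub>a \<iota> \<I> = \<r> X \<otimes>\<^sub>a \<iota> \<I>"
    using X by (simp add: comp_extend[OF Braid_Braid])
qed (use X in simp_all)

lemma braid_unit_inv:
  assumes X: "X \<in> Obj C"
  shows "\<s> \<I> X \<cdot> linv X = rinv X"
proof -
  have "rinv X = \<s> \<I> X \<cdot> linv X \<cdot> \<l> X \<cdot> \<s> X \<I> \<cdot> rinv X"
    using X by (simp add: comp_extend[OF Braid_Braid])
  also have "\<dots> = \<s> \<I> X \<cdot> linv X"
    using X by (simp add: comp_extend[OF l_braid])
  finally show ?thesis by simp
qed

text \<open>The unit laws again, solved for the inverses of the coherence isomorphisms.\<close>

lemma assoc_rinv:
  assumes "X \<in> Obj C" "Y \<in> Obj C"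
  shows "\<a> X \<I> Y \<cdot> (rinv X \<otimes>\<^sub>a \<iota> Y) = \<iota> X \<otimes>\<^sub>a linv Y"
proof -
  have "\<a> X \<I> Y \<cdot> (rinv X \<otimes>\<^sub>a \<iota> Y)
      = (\<iota> X \<otimes>\<^sub>a linv Y) \<cdot> ((\<iota> X \<otimes>\<^sub>a \<l> Y) \<cdot> \<a> X \<I> Y) \<cdot> (rinv X \<otimes>\<^sub>a \<iota> Y)"
    using assms by (simp add: merge)
  also have "\<dots> = \<iota> X \<otimes>\<^sub>a linv Y"
    using assms by (simp add: triangle merge)
  finally show ?thesis .
qed

lemma assoc_rinv_ten:
  assumes "X \<in> Obj C" "Y \<in> Obj C"
  shows "\<a> X Y \<I> \<cdot> rinv (X \<otimes>\<^sub>o Y) = \<iota> X \<otimes>\<^sub>a rinv Y"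
proof -
  have "\<a> X Y \<I> \<cdot> rinv (X \<otimes>\<^sub>o Y)
      = (\<iota> X \<otimes>\<^sub>a rinv Y) \<cdot> ((\<iota> X \<otimes>\<^sub>a \<r> Y) \<cdot> \<a> X Y \<I>) \<cdot> rinv (X \<otimes>\<^sub>o Y)"
    using assms by (simp add: merge)
  also have "\<dots> = \<iota> X \<otimes>\<^sub>a rinv Y"
    using assms by (simp add: r_ten)
  finally show ?thesis .
qed

lemma assoc_linv:
  assumes "X \<in> Obj C" "Y \<in> Obj C"
  shows "\<a> \<I> X Y \<cdot> (linv X \<otimes>\<^sub>a \<iota> Y) = linv (X \<otimes>\<^sub>o Y)"
proof -
  have "\<a> \<I> X Y \<cdot> (linv X \<otimes>\<^sub>a \<iota> Y)
      = linv (X \<otimes>\<^sub>o Y) \<cdot> (\<l> (X \<otimes>\<^sub>o Y) \<cdot> \<a> \<I> X Y) \<cdot> (linv X \<otimes>\<^sub>a \<iota> Y)"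
    using assms by simp
  also have "\<dots> = linv (X \<otimes>\<^sub>o Y)"
    using assms by (simp add: l_ten merge)
  finally show ?thesis .
qed

lemma ainv_linv:
  assumes "X \<in> Obj C" "Y \<in> Obj C"
  shows "ainv X \<I> Y \<cdot> (\<iota> X \<otimes>\<^sub>a linv Y) = rinv X \<otimes>\<^sub>a \<iota> Y"
    and "ainv \<I> X Y \<cdot> linv (X \<otimes>\<^sub>o Y) = linv X \<otimes>\<^sub>a \<iota> Y"
  using assms by (simp_all flip: assoc_rinv assoc_linv)

lemma mid_simps [simp]:
  assumes "W \<in> Obj C" "X \<in> Obj C" "Y \<in> Obj C" "Z \<in> Obj C"
  shows "mid W X Y Z \<in> Arr C" "Dom C (mid W X Y Z) = (W \<otimes>\<^sub>o X) \<otimes>\<^sub>o (Y \<otimes>\<^sub>o Z)"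
    "Cod C (mid W X Y Z) = (W \<otimes>\<^sub>o Y) \<otimes>\<^sub>o (X \<otimes>\<^sub>o Z)"
  using assms by (simp_all add: middle_four_def)

lemma mid_nat:
  assumes f: "f \<in> Arr C" "g \<in> Arr C" "h \<in> Arr C" "k \<in> Arr C"
    and X: "Cod C f = W" "Cod C g = X" "Cod C h = Y" "Cod C k = Z"
  shows "mid W X Y Z \<cdot> ((f \<otimes>\<^sub>a g) \<otimes>\<^sub>a (h \<otimes>\<^sub>a k))
    = ((f \<otimes>\<^sub>a h) \<otimes>\<^sub>a (g \<otimes>\<^sub>a k)) \<cdot> mid (Dom C f) (Dom C g) (Dom C h) (Dom C k)"
proof -
  have obj: "W \<in> Obj C" "X \<in> Obj C" "Y \<in> Obj C" "Z \<in> Obj C" using assms by auto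
  note s = f X obj
  let ?D = "Dom C"
  let ?m = "\<a> Y X Z \<cdot> (\<s> X Y \<otimes>\<^sub>a \<iota> Z) \<cdot> ainv X Y Z"
  let ?m' = "\<a> (?D h) (?D g) (?D k) \<cdot> (\<s> (?D g) (?D h) \<otimes>\<^sub>a \<iota> (?D k)) \<cdot> ainv (?D g) (?D h) (?D k)"
  have m: "?m \<cdot> (g \<otimes>\<^sub>a (h \<otimes>\<^sub>a k)) = (h \<otimes>\<^sub>a (g \<otimes>\<^sub>a k)) \<cdot> ?m'"
  proof -
    have "?m \<cdot> (g \<otimes>\<^sub>a (h \<otimes>\<^sub>a k))
        = \<a> Y X Z \<cdot> (\<s> X Y \<otimes>\<^sub>a \<iota> Z) \<cdot> ((g \<otimes>\<^sub>a h) \<otimes>\<^sub>a k) \<cdot> ainv (?D g) (?D h) (?D k)"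
      using s by (simp add: ainv_nat)
    also have "\<dots> = \<a> Y X Z \<cdot> ((h \<otimes>\<^sub>a g) \<otimes>\<^sub>a k) \<cdot> (\<s> (?D g) (?D h) \<otimes>\<^sub>a \<iota> (?D k))
        \<cdot> ainv (?D g) (?D h) (?D k)"
      using s by (simp add: merge s_nat)
    also have "\<dots> = (h \<otimes>\<^sub>a (g \<otimes>\<^sub>a k)) \<cdot> ?m'"
      using s by (simp add: comp_extend[OF assoc_nat])
    finally show ?thesis .
  qed
  have "mid W X Y Z \<cdot> ((f \<otimes>\<^sub>a g) \<otimes>\<^sub>a (h \<otimes>\<^sub>a k))
      = ainv W Y (X \<otimes>\<^sub>o Z) \<cdot> (\<iota> W \<otimes>\<^sub>a ?m) \<cdot> (f \<otimes>\<^sub>a (g \<otimes>\<^sub>a (h \<otimes>\<^sub>a k)))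
        \<cdot> \<a> (?D f) (?D g) (?D h \<otimes>\<^sub>o ?D k)"
    using s by (simp add: middle_four_def assoc_nat)
  also have "(\<iota> W \<otimes>\<^sub>a ?m) \<cdot> (f \<otimes>\<^sub>a (g \<otimes>\<^sub>a (h \<otimes>\<^sub>a k))) \<cdot> \<a> (?D f) (?D g) (?D h \<otimes>\<^sub>o ?D k)
      = (f \<otimes>\<^sub>a (h \<otimes>\<^sub>a (g \<otimes>\<^sub>a k))) \<cdot> (\<iota> (?D f) \<otimes>\<^sub>a ?m') \<cdot> \<a> (?D f) (?D g) (?D h \<otimes>\<^sub>o ?D k)"
  proof -
    have "(\<iota> W \<otimes>\<^sub>a ?m) \<cdot> (f \<otimes>\<^sub>a (g \<otimes>\<^sub>a (h \<otimes>\<^sub>a k))) = (\<iota> W \<cdot> f) \<otimes>\<^sub>a (?m \<cdot> (g \<otimes>\<^sub>a (h \<otimes>\<^sub>a k)))"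
      by (rule interchange) (use s in simp_all)
    also have "\<dots> = (f \<cdot> \<iota> (?D f)) \<otimes>\<^sub>a ((h \<otimes>\<^sub>a (g \<otimes>\<^sub>a k)) \<cdot> ?m')"
      unfolding m using s by simp
    also have "\<dots> = (f \<otimes>\<^sub>a (h \<otimes>\<^sub>a (g \<otimes>\<^sub>a k))) \<cdot> (\<iota> (?D f) \<otimes>\<^sub>a ?m')"
      by (rule interchange[symmetric]) (use s in simp_all)
    finally have e: "(\<iota> W \<otimes>\<^sub>a ?m) \<cdot> (f \<otimes>\<^sub>a (g \<otimes>\<^sub>a (h \<otimes>\<^sub>a k)))
        = (f \<otimes>\<^sub>a (h \<otimes>\<^sub>a (g \<otimes>\<^sub>a k))) \<cdot> (\<iota> (?D f) \<otimes>\<^sub>a ?m')" .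
    show ?thesis
      using comp_extend[OF e, of "\<a> (?D f) (?D g) (?D h \<otimes>\<^sub>o ?D k)"] s by simp
  qed
  also have "ainv W Y (X \<otimes>\<^sub>o Z) \<cdot> \<dots>
      = ((f \<otimes>\<^sub>a h) \<otimes>\<^sub>a (g \<otimes>\<^sub>a k)) \<cdot> mid (?D f) (?D g) (?D h) (?D k)"
    using s by (simp add: middle_four_def comp_extend[OF ainv_nat])
  finally show ?thesis .
qed

lemma mid_unit_second:
  assumes XYZ: "X \<in> Obj C" "Y \<in> Obj C" "Z \<in> Obj C"
  shows "mid X \<I> Y Z \<cdot> (rinv X \<otimes>\<^sub>a \<iota> (Y \<otimes>\<^sub>o Z)) = (\<iota> (X \<otimes>\<^sub>o Y) \<otimes>\<^sub>a linv Z) \<cdot> ainv X Y Z"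
proof -
  let ?m = "\<a> Y \<I> Z \<cdot> (\<s> \<I> Y \<otimes>\<^sub>a \<iota> Z) \<cdot> ainv \<I> Y Z"
  have m: "?m \<cdot> linv (Y \<otimes>\<^sub>o Z) = \<iota> Y \<otimes>\<^sub>a linv Z"
    using XYZ by (simp add: ainv_linv merge braid_unit_inv assoc_rinv)
  have "mid X \<I> Y Z \<cdot> (rinv X \<otimes>\<^sub>a \<iota> (Y \<otimes>\<^sub>o Z))
      = ainv X Y (\<I> \<otimes>\<^sub>o Z) \<cdot> (\<iota> X \<otimes>\<^sub>a ?m) \<cdot> (\<iota> X \<otimes>\<^sub>a linv (Y \<otimes>\<^sub>o Z))"
    using XYZ by (simp add: middle_four_def assoc_rinv)
  also have "(\<iota> X \<otimes>\<^sub>a ?m) \<cdot> (\<iota> X \<otimes>\<^sub>a linv (Y \<otimes>\<^sub>o Z)) = \<iota> X \<otimes>\<^sub>a (\<iota> Y \<otimes>\<^sub>a linv Z)"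
    using XYZ m by (subst interchange) simp_all
  also have "ainv X Y (\<I> \<otimes>\<^sub>o Z) \<cdot> \<dots> = (\<iota> (X \<otimes>\<^sub>o Y) \<otimes>\<^sub>a linv Z) \<cdot> ainv X Y Z"
    using XYZ by (simp add: ainv_nat)
  finally show ?thesis .
qed

lemma mid_unit_second_pair:
  assumes XY: "X \<in> Obj C" "Y \<in> Obj C"
  shows "mid X Y \<I> \<I> \<cdot> (\<iota> (X \<otimes>\<^sub>o Y) \<otimes>\<^sub>a linv \<I>) \<cdot> rinv (X \<otimes>\<^sub>o Y) = rinv X \<otimes>\<^sub>a rinv Y"
proof -
  let ?m = "\<a> \<I> Y \<I> \<cdot> (\<s> Y \<I> \<otimes>\<^sub>a \<iota> \<I>) \<cdot> ainv Y \<I> \<I>"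
  have s: "\<s> Y \<I> \<cdot> rinv Y = linv Y"
    using XY by (simp add: comp_extend[OF Braid_Braid] flip: braid_unit_inv)
  have m: "?m \<cdot> ((\<iota> Y \<otimes>\<^sub>a linv \<I>) \<cdot> rinv Y) = (\<iota> \<I> \<otimes>\<^sub>a rinv Y) \<cdot> linv Y"
    using XY by (simp add: comp_extend[OF ainv_linv(1)] merge s comp_extend[OF assoc_linv] linv_nat)
  have "\<a> X Y (\<I> \<otimes>\<^sub>o \<I>) \<cdot> (\<iota> (X \<otimes>\<^sub>o Y) \<otimes>\<^sub>a linv \<I>) \<cdot> rinv (X \<otimes>\<^sub>o Y)
      = (\<iota> X \<otimes>\<^sub>a (\<iota> Y \<otimes>\<^sub>a linv \<I>)) \<cdot> \<a> X Y \<I> \<cdot> rinv (X \<otimes>\<^sub>o Y)"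
    using XY by (simp add: comp_extend[OF assoc_nat_idn])
  also have "\<dots> = \<iota> X \<otimes>\<^sub>a ((\<iota> Y \<otimes>\<^sub>a linv \<I>) \<cdot> rinv Y)"
    using XY by (simp add: assoc_rinv_ten merge)
  finally have "mid X Y \<I> \<I> \<cdot> (\<iota> (X \<otimes>\<^sub>o Y) \<otimes>\<^sub>a linv \<I>) \<cdot> rinv (X \<otimes>\<^sub>o Y)
      = ainv X \<I> (Y \<otimes>\<^sub>o \<I>) \<cdot> (\<iota> X \<otimes>\<^sub>a ?m) \<cdot> (\<iota> X \<otimes>\<^sub>a ((\<iota> Y \<otimes>\<^sub>a linv \<I>) \<cdot> rinv Y))"
    using XY by (simp add: middle_four_def)
  also have "(\<iota> X \<otimes>\<^sub>a ?m) \<cdot> (\<iota> X \<otimes>\<^sub>a ((\<iota> Y \<otimes>\<^sub>a linv \<I>) \<cdot> rinv Y))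
      = (\<iota> X \<otimes>\<^sub>a (\<iota> \<I> \<otimes>\<^sub>a rinv Y)) \<cdot> (\<iota> X \<otimes>\<^sub>a linv Y)"
    using XY m by (subst (1 2) interchange) simp_all
  also have "ainv X \<I> (Y \<otimes>\<^sub>o \<I>) \<cdot> \<dots>
      = (\<iota> (X \<otimes>\<^sub>o \<I>) \<otimes>\<^sub>a rinv Y) \<cdot> (rinv X \<otimes>\<^sub>a \<iota> Y)"
    using XY by (simp add: comp_extend[OF ainv_nat] ainv_linv)
  also have "\<dots> = rinv X \<otimes>\<^sub>a rinv Y"
    using XY by (simp add: merge)
  finally show ?thesis .
qed

end

section \<open>Bimonoids\<close>

context symmetric_monoidal_category
begin

lemma comp_extend3:
  assumes "h \<cdot> g \<cdot> f = x"
    and "f \<in> Arr C" "g \<in> Arr C" "h \<in> Arr C" "Cod C f = Dom C g" "Cod C g = Dom C h"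
      "k \<in> Arr C" "Cod C k = Dom C f"
  shows "h \<cdot> g \<cdot> f \<cdot> k = x \<cdot> k"
  using assms comp_extend[of "h \<cdot> g" f x k] by simp

lemma bimonoid_simps [simp]:
  assumes "is_bimonoid C A"
  shows "Carrier A \<in> Obj C"
    "\<nabla> A \<in> Arr C" "Dom C (\<nabla> A) = Carrier A \<otimes>\<^sub>o Carrier A" "Cod C (\<nabla> A) = Carrier A"
    "\<eta> A \<in> Arr C" "Dom C (\<eta> A) = \<I>" "Cod C (\<eta> A) = Carrier A"
    "\<Delta> A \<in> Arr C" "Dom C (\<Delta> A) = Carrier A" "Cod C (\<Delta> A) = Carrier A \<otimes>\<^sub>o Carrier A"
    "\<epsilon> A \<in> Arr C" "Dom C (\<epsilon> A) = Carrier A" "Cod C (\<epsilon> A) = \<I>"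
  using assms by (simp_all add: is_bimonoid_def is_monoid_def is_comonoid_def Hom_iff Let_def)

lemma bimonoid_laws:
  assumes "is_bimonoid C A"
  shows mult_assoc: "\<nabla> A \<cdot> (\<nabla> A \<otimes>\<^sub>a \<iota> (Carrier A))
      = \<nabla> A \<cdot> (\<iota> (Carrier A) \<otimes>\<^sub>a \<nabla> A) \<cdot> \<a> (Carrier A) (Carrier A) (Carrier A)"
    and mult_unit_left: "\<nabla> A \<cdot> (\<eta> A \<otimes>\<^sub>a \<iota> (Carrier A)) = \<l> (Carrier A)"
    and mult_unit_right: "\<nabla> A \<cdot> (\<iota> (Carrier A) \<otimes>\<^sub>a \<eta> A) = \<r> (Carrier A)"
    and comult_assoc: "\<a> (Carrier A) (Carrier A) (Carrier A) \<cdot> (\<Delta> A \<otimes>\<^sub>a \<iota> (Carrier A)) \<cdot> \<Delta> A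
      = (\<iota> (Carrier A) \<otimes>\<^sub>a \<Delta> A) \<cdot> \<Delta> A"
    and comult_counit_left: "\<l> (Carrier A) \<cdot> (\<epsilon> A \<otimes>\<^sub>a \<iota> (Carrier A)) \<cdot> \<Delta> A = \<iota> (Carrier A)"
    and comult_counit_right: "\<r> (Carrier A) \<cdot> (\<iota> (Carrier A) \<otimes>\<^sub>a \<epsilon> A) \<cdot> \<Delta> A = \<iota> (Carrier A)"
    and comult_mult: "\<Delta> A \<cdot> \<nabla> A
      = (\<nabla> A \<otimes>\<^sub>a \<nabla> A) \<cdot> mid (Carrier A) (Carrier A) (Carrier A) (Carrier A) \<cdot> (\<Delta> A \<otimes>\<^sub>a \<Delta> A)"
    and counit_mult: "\<epsilon> A \<cdot> \<nabla> A = \<l> \<I> \<cdot> (\<epsilon> A \<otimes>\<^sub>a \<epsilon> A)"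
    and comult_unit: "\<Delta> A \<cdot> \<eta> A = (\<eta> A \<otimes>\<^sub>a \<eta> A) \<cdot> linv \<I>"
    and counit_unit: "\<epsilon> A \<cdot> \<eta> A = \<iota> \<I>"
  using assms unfolding is_bimonoid_def is_monoid_def is_comonoid_def Let_def by blast+

lemma counit_comult_inv:
  assumes A: "is_bimonoid C A"
  shows "(\<epsilon> A \<otimes>\<^sub>a \<iota> (Carrier A)) \<cdot> \<Delta> A = linv (Carrier A)"
    and "(\<iota> (Carrier A) \<otimes>\<^sub>a \<epsilon> A) \<cdot> \<Delta> A = rinv (Carrier A)"
proof -
  let ?A = "Carrier A"
  have "(\<epsilon> A \<otimes>\<^sub>a \<iota> ?A) \<cdot> \<Delta> A = linv ?A \<cdot> (\<l> ?A \<cdot> (\<epsilon> A \<otimes>\<^sub>a \<iota> ?A) \<cdot> \<Delta> A)"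
    using A by simp
  then show "(\<epsilon> A \<otimes>\<^sub>a \<iota> ?A) \<cdot> \<Delta> A = linv ?A"
    using A by (simp only: comult_counit_left) simp
  have "(\<iota> ?A \<otimes>\<^sub>a \<epsilon> A) \<cdot> \<Delta> A = rinv ?A \<cdot> (\<r> ?A \<cdot> (\<iota> ?A \<otimes>\<^sub>a \<epsilon> A) \<cdot> \<Delta> A)"
    using A by simp
  then show "(\<iota> ?A \<otimes>\<^sub>a \<epsilon> A) \<cdot> \<Delta> A = rinv ?A"
    using A by (simp only: comult_counit_right) simp
qed

lemma mult_unit_unit:
  assumes "is_bimonoid C A"
  shows "\<nabla> A \<cdot> (\<eta> A \<otimes>\<^sub>a \<eta> A) \<cdot> linv \<I> = \<eta> A"
proof -
  have "\<nabla> A \<cdot> (\<eta> A \<otimes>\<^sub>a \<eta> A) \<cdot> linv \<I> = \<nabla> A \<cdot> (\<eta> A \<otimes>\<^sub>a \<iota> (Carrier A)) \<cdot> (\<iota> \<I> \<otimes>\<^sub>a \<eta> A) \<cdot> linv \<I>"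
    using assms by (simp add: merge)
  also have "\<dots> = \<eta> A"
    using assms
    by (simp add: comp_extend[OF mult_unit_left] comp_extend[OF l_nat])
  finally show ?thesis .
qed

lemma bimonoid_homD:
  assumes "bimonoid_hom C A B f"
  shows "f \<in> Arr C" "Dom C f = Carrier A" "Cod C f = Carrier B"
    "f \<cdot> \<nabla> A = \<nabla> B \<cdot> (f \<otimes>\<^sub>a f)" "f \<cdot> \<eta> A = \<eta> B"
    "\<Delta> B \<cdot> f = (f \<otimes>\<^sub>a f) \<cdot> \<Delta> A" "\<epsilon> B \<cdot> f = \<epsilon> A"
  using assms by (auto simp: bimonoid_hom_def Hom_iff)

lemma hopf_bimonoid [simp]: "is_hopf_monoid C A \<Longrightarrow> is_bimonoid C A"
  by (simp add: is_hopf_monoid_def)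

text \<open>Cocommutativity allows the two middle factors of \<open>x\<^sub>1 \<otimes> x\<^sub>2 \<otimes> x\<^sub>3 \<otimes> x\<^sub>4\<close> to be exchanged.
  This is the compatibility of \<open>\<Delta> A\<close> with comultiplications that lets \<open>\<Delta> A\<close> restrict to
  stabilized objects.\<close>

lemma mid_comult:
  assumes A: "is_bimonoid C A" and bc: "is_bicommutative C A"
  shows "mid (Carrier A) (Carrier A) (Carrier A) (Carrier A) \<cdot> (\<Delta> A \<otimes>\<^sub>a \<Delta> A) \<cdot> \<Delta> A
    = (\<Delta> A \<otimes>\<^sub>a \<Delta> A) \<cdot> \<Delta> A"
proof -
  let ?A = "Carrier A"
  let ?m = "\<a> ?A ?A ?A \<cdot> (\<s> ?A ?A \<otimes>\<^sub>a \<iota> ?A) \<cdot> ainv ?A ?A ?A"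
  have sD: "\<s> ?A ?A \<cdot> \<Delta> A = \<Delta> A" using bc by (simp add: is_bicommutative_def)
  have ainvD: "ainv ?A ?A ?A \<cdot> (\<iota> ?A \<otimes>\<^sub>a \<Delta> A) \<cdot> \<Delta> A = (\<Delta> A \<otimes>\<^sub>a \<iota> ?A) \<cdot> \<Delta> A"
    using A by (simp flip: comult_assoc)
  have m: "?m \<cdot> (\<iota> ?A \<otimes>\<^sub>a \<Delta> A) \<cdot> \<Delta> A = (\<iota> ?A \<otimes>\<^sub>a \<Delta> A) \<cdot> \<Delta> A"
    using A by (simp add: ainvD merge sD comult_assoc)
  have *: "\<a> ?A ?A (?A \<otimes>\<^sub>o ?A) \<cdot> (\<Delta> A \<otimes>\<^sub>a \<Delta> A) \<cdot> \<Delta> A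
      = (\<iota> ?A \<otimes>\<^sub>a ((\<iota> ?A \<otimes>\<^sub>a \<Delta> A) \<cdot> \<Delta> A)) \<cdot> \<Delta> A"
  proof -
    have "\<a> ?A ?A (?A \<otimes>\<^sub>o ?A) \<cdot> (\<Delta> A \<otimes>\<^sub>a \<Delta> A) \<cdot> \<Delta> A
        = \<a> ?A ?A (?A \<otimes>\<^sub>o ?A) \<cdot> (\<iota> (?A \<otimes>\<^sub>o ?A) \<otimes>\<^sub>a \<Delta> A) \<cdot> (\<Delta> A \<otimes>\<^sub>a \<iota> ?A) \<cdot> \<Delta> A"
      using A by (simp add: merge)
    also have "\<dots> = (\<iota> ?A \<otimes>\<^sub>a (\<iota> ?A \<otimes>\<^sub>a \<Delta> A)) \<cdot> (\<iota> ?A \<otimes>\<^sub>a \<Delta> A) \<cdot> \<Delta> A"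
      using A by (simp add: comp_extend[OF assoc_nat_idn] comult_assoc)
    finally show ?thesis using A by (simp add: merge)
  qed
  have "mid ?A ?A ?A ?A \<cdot> (\<Delta> A \<otimes>\<^sub>a \<Delta> A) \<cdot> \<Delta> A
      = ainv ?A ?A (?A \<otimes>\<^sub>o ?A) \<cdot> (\<iota> ?A \<otimes>\<^sub>a ?m) \<cdot> (\<iota> ?A \<otimes>\<^sub>a ((\<iota> ?A \<otimes>\<^sub>a \<Delta> A) \<cdot> \<Delta> A)) \<cdot> \<Delta> A"
    using A by (simp add: middle_four_def *)
  also have "\<dots> = ainv ?A ?A (?A \<otimes>\<^sub>o ?A) \<cdot> (\<iota> ?A \<otimes>\<^sub>a (?m \<cdot> (\<iota> ?A \<otimes>\<^sub>a \<Delta> A) \<cdot> \<Delta> A)) \<cdot> \<Delta> A"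
    using A by (subst comp_extend[OF interchange]) simp_all
  also have "\<dots> = ainv ?A ?A (?A \<otimes>\<^sub>o ?A) \<cdot> \<a> ?A ?A (?A \<otimes>\<^sub>o ?A) \<cdot> (\<Delta> A \<otimes>\<^sub>a \<Delta> A) \<cdot> \<Delta> A"
    unfolding m * ..
  also have "\<dots> = (\<Delta> A \<otimes>\<^sub>a \<Delta> A) \<cdot> \<Delta> A" using A by simp
  finally show ?thesis .
qed

text \<open>Every axiom can be tested after composition with one of the monomorphisms \<open>e\<close>,
  \<open>e \<otimes> e\<close> and \<open>e \<otimes> (e \<otimes> e)\<close>, where it becomes the same axiom for \<open>A\<close>; the triple power serves
  coassociativity.\<close>

lemma sub_bimonoid:
  fixes A :: "('o, 'm) bimonoid"
  assumes A: "is_bimonoid C A"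
    and e: "mono_arrow C e" "mono_arrow C (e \<otimes>\<^sub>a e)" "mono_arrow C (e \<otimes>\<^sub>a (e \<otimes>\<^sub>a e))"
      "Dom C e = E" "Cod C e = Carrier A"
    and m: "m \<in> Arr C" "Dom C m = E \<otimes>\<^sub>o E" "Cod C m = E" "e \<cdot> m = \<nabla> A \<cdot> (e \<otimes>\<^sub>a e)"
    and u: "u \<in> Arr C" "Dom C u = \<I>" "Cod C u = E" "e \<cdot> u = \<eta> A"
    and d: "d \<in> Arr C" "Dom C d = E" "Cod C d = E \<otimes>\<^sub>o E" "(e \<otimes>\<^sub>a e) \<cdot> d = \<Delta> A \<cdot> e"
    and c: "c = \<epsilon> A \<cdot> e"
    and S: "S = \<lparr>Carrier = E, Mult = m, Unit = u, Comult = d, Counit = c\<rparr>"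
  shows "is_bimonoid C S" and "bimonoid_hom C S A e"
    and "is_bicommutative C A \<Longrightarrow> is_bicommutative C S"
proof -
  let ?A = "Carrier A"
  have arr: "e \<in> Arr C" using e(1) by (simp add: mono_arrow_def)
  then have E: "E \<in> Obj C" using e by auto
  have cs: "c \<in> Arr C" "Dom C c = E" "Cod C c = \<I>" using c arr e A by simp_all
  note s = A arr e(4,5) E m(1-3) u(1-3) d(1-3) cs
  note em = m(4) comp_extend[OF m(4)] and eu = u(4) comp_extend[OF u(4)]
    and ed = d(4) comp_extend[OF d(4)]
  have ec: "c = \<epsilon> A \<cdot> e" "\<And>k. k \<in> Arr C \<Longrightarrow> Cod C k = E \<Longrightarrow> \<epsilon> A \<cdot> e \<cdot> k = c \<cdot> k"
    using c s by simp_all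
  have assoc: "m \<cdot> (m \<otimes>\<^sub>a \<iota> E) = m \<cdot> (\<iota> E \<otimes>\<^sub>a m) \<cdot> \<a> E E E"
  proof (rule mono_arrowD[OF e(1)])
    have "e \<cdot> m \<cdot> (m \<otimes>\<^sub>a \<iota> E) = \<nabla> A \<cdot> (\<nabla> A \<otimes>\<^sub>a \<iota> ?A) \<cdot> ((e \<otimes>\<^sub>a e) \<otimes>\<^sub>a e)"
      using s by (simp add: em merge)
    also have "\<dots> = \<nabla> A \<cdot> (\<iota> ?A \<otimes>\<^sub>a \<nabla> A) \<cdot> (e \<otimes>\<^sub>a (e \<otimes>\<^sub>a e)) \<cdot> \<a> E E E"
      using s by (simp add: comp_extend[OF mult_assoc] assoc_nat)
    also have "\<dots> = e \<cdot> m \<cdot> (\<iota> E \<otimes>\<^sub>a m) \<cdot> \<a> E E E"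
      using s by (simp add: em merge)
    finally show "e \<cdot> m \<cdot> (m \<otimes>\<^sub>a \<iota> E) = e \<cdot> m \<cdot> (\<iota> E \<otimes>\<^sub>a m) \<cdot> \<a> E E E" .
  qed (use s in simp_all)
  have unit_l: "m \<cdot> (u \<otimes>\<^sub>a \<iota> E) = \<l> E"
  proof (rule mono_arrowD[OF e(1)])
    have "e \<cdot> m \<cdot> (u \<otimes>\<^sub>a \<iota> E) = \<nabla> A \<cdot> (\<eta> A \<otimes>\<^sub>a \<iota> ?A) \<cdot> (\<iota> \<I> \<otimes>\<^sub>a e)"
      using s by (simp add: em eu merge)
    then show "e \<cdot> m \<cdot> (u \<otimes>\<^sub>a \<iota> E) = e \<cdot> \<l> E"
      using s by (simp add: comp_extend[OF mult_unit_left] l_nat)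
  qed (use s in simp_all)
  have unit_r: "m \<cdot> (\<iota> E \<otimes>\<^sub>a u) = \<r> E"
  proof (rule mono_arrowD[OF e(1)])
    have "e \<cdot> m \<cdot> (\<iota> E \<otimes>\<^sub>a u) = \<nabla> A \<cdot> (\<iota> ?A \<otimes>\<^sub>a \<eta> A) \<cdot> (e \<otimes>\<^sub>a \<iota> \<I>)"
      using s by (simp add: em eu merge)
    then show "e \<cdot> m \<cdot> (\<iota> E \<otimes>\<^sub>a u) = e \<cdot> \<r> E"
      using s by (simp add: comp_extend[OF mult_unit_right] r_nat)
  qed (use s in simp_all)
  have coassoc: "\<a> E E E \<cdot> (d \<otimes>\<^sub>a \<iota> E) \<cdot> d = (\<iota> E \<otimes>\<^sub>a d) \<cdot> d"
  proof (rule mono_arrowD[OF e(3)])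
    have "(e \<otimes>\<^sub>a (e \<otimes>\<^sub>a e)) \<cdot> \<a> E E E \<cdot> (d \<otimes>\<^sub>a \<iota> E) \<cdot> d
        = \<a> ?A ?A ?A \<cdot> ((e \<otimes>\<^sub>a e) \<otimes>\<^sub>a e) \<cdot> (d \<otimes>\<^sub>a \<iota> E) \<cdot> d"
      using s by (simp add: comp_extend[OF assoc_nat])
    also have "((e \<otimes>\<^sub>a e) \<otimes>\<^sub>a e) \<cdot> (d \<otimes>\<^sub>a \<iota> E) \<cdot> d = (\<Delta> A \<otimes>\<^sub>a \<iota> ?A) \<cdot> (e \<otimes>\<^sub>a e) \<cdot> d"
    proof -
      have "((e \<otimes>\<^sub>a e) \<otimes>\<^sub>a e) \<cdot> (d \<otimes>\<^sub>a \<iota> E) = (\<Delta> A \<otimes>\<^sub>a \<iota> ?A) \<cdot> (e \<otimes>\<^sub>a e)"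
        using s by (simp add: merge ed)
      from comp_extend[OF this, of d] show ?thesis using s by simp
    qed
    also have "\<a> ?A ?A ?A \<cdot> \<dots> = (\<iota> ?A \<otimes>\<^sub>a \<Delta> A) \<cdot> (e \<otimes>\<^sub>a e) \<cdot> d"
      using s by (simp add: ed comp_extend3[OF comult_assoc])
    also have "\<dots> = (e \<otimes>\<^sub>a (e \<otimes>\<^sub>a e)) \<cdot> (\<iota> E \<otimes>\<^sub>a d) \<cdot> d"
    proof -
      have "(e \<otimes>\<^sub>a (e \<otimes>\<^sub>a e)) \<cdot> (\<iota> E \<otimes>\<^sub>a d) = (\<iota> ?A \<otimes>\<^sub>a \<Delta> A) \<cdot> (e \<otimes>\<^sub>a e)"
        using s by (simp add: merge ed)
      from comp_extend[OF this, of d] show ?thesis using s by simp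
    qed
    finally show "(e \<otimes>\<^sub>a (e \<otimes>\<^sub>a e)) \<cdot> \<a> E E E \<cdot> (d \<otimes>\<^sub>a \<iota> E) \<cdot> d
      = (e \<otimes>\<^sub>a (e \<otimes>\<^sub>a e)) \<cdot> (\<iota> E \<otimes>\<^sub>a d) \<cdot> d" .
  qed (use s in simp_all)
  have counit_l: "\<l> E \<cdot> (c \<otimes>\<^sub>a \<iota> E) \<cdot> d = \<iota> E"
  proof (rule mono_arrowD[OF e(1)])
    have "e \<cdot> \<l> E \<cdot> (c \<otimes>\<^sub>a \<iota> E) \<cdot> d = \<l> ?A \<cdot> (\<iota> \<I> \<otimes>\<^sub>a e) \<cdot> (c \<otimes>\<^sub>a \<iota> E) \<cdot> d"
      using s by (simp add: comp_extend[OF l_nat])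
    also have "\<dots> = \<l> ?A \<cdot> (\<epsilon> A \<otimes>\<^sub>a \<iota> ?A) \<cdot> (e \<otimes>\<^sub>a e) \<cdot> d"
      using s by (simp add: merge c)
    also have "\<dots> = e \<cdot> \<iota> E"
      using s by (simp add: ed comp_extend3[OF comult_counit_left])
    finally show "e \<cdot> \<l> E \<cdot> (c \<otimes>\<^sub>a \<iota> E) \<cdot> d = e \<cdot> \<iota> E" .
  qed (use s in simp_all)
  have counit_r: "\<r> E \<cdot> (\<iota> E \<otimes>\<^sub>a c) \<cdot> d = \<iota> E"
  proof (rule mono_arrowD[OF e(1)])
    have "e \<cdot> \<r> E \<cdot> (\<iota> E \<otimes>\<^sub>a c) \<cdot> d = \<r> ?A \<cdot> (e \<otimes>\<^sub>a \<iota> \<I>) \<cdot> (\<iota> E \<otimes>\<^sub>a c) \<cdot> d"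
      using s by (simp add: comp_extend[OF r_nat])
    also have "\<dots> = \<r> ?A \<cdot> (\<iota> ?A \<otimes>\<^sub>a \<epsilon> A) \<cdot> (e \<otimes>\<^sub>a e) \<cdot> d"
      using s by (simp add: merge c)
    also have "\<dots> = e \<cdot> \<iota> E"
      using s by (simp add: ed comp_extend3[OF comult_counit_right])
    finally show "e \<cdot> \<r> E \<cdot> (\<iota> E \<otimes>\<^sub>a c) \<cdot> d = e \<cdot> \<iota> E" .
  qed (use s in simp_all)
  have bim: "d \<cdot> m = (m \<otimes>\<^sub>a m) \<cdot> mid E E E E \<cdot> (d \<otimes>\<^sub>a d)"
  proof (rule mono_arrowD[OF e(2)])
    have "(e \<otimes>\<^sub>a e) \<cdot> d \<cdot> m = \<Delta> A \<cdot> \<nabla> A \<cdot> (e \<otimes>\<^sub>a e)"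
      using s by (simp add: em ed)
    also have "\<dots> = (\<nabla> A \<otimes>\<^sub>a \<nabla> A) \<cdot> mid ?A ?A ?A ?A \<cdot> ((e \<otimes>\<^sub>a e) \<otimes>\<^sub>a (e \<otimes>\<^sub>a e)) \<cdot> (d \<otimes>\<^sub>a d)"
      using s by (simp add: comp_extend[OF comult_mult] merge ed)
    also have "\<dots> = (\<nabla> A \<otimes>\<^sub>a \<nabla> A) \<cdot> ((e \<otimes>\<^sub>a e) \<otimes>\<^sub>a (e \<otimes>\<^sub>a e)) \<cdot> mid E E E E \<cdot> (d \<otimes>\<^sub>a d)"
      using s by (simp add: comp_extend[OF mid_nat])
    also have "\<dots> = (e \<otimes>\<^sub>a e) \<cdot> (m \<otimes>\<^sub>a m) \<cdot> mid E E E E \<cdot> (d \<otimes>\<^sub>a d)"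
      using s by (simp add: merge em)
    finally show "(e \<otimes>\<^sub>a e) \<cdot> d \<cdot> m = (e \<otimes>\<^sub>a e) \<cdot> (m \<otimes>\<^sub>a m) \<cdot> mid E E E E \<cdot> (d \<otimes>\<^sub>a d)" .
  qed (use s in simp_all)
  have counit_m: "c \<cdot> m = \<l> \<I> \<cdot> (c \<otimes>\<^sub>a c)"
    using s by (simp add: c em comp_extend[OF counit_mult] merge)
  have unit_d: "d \<cdot> u = (u \<otimes>\<^sub>a u) \<cdot> linv \<I>"
  proof (rule mono_arrowD[OF e(2)])
    show "(e \<otimes>\<^sub>a e) \<cdot> d \<cdot> u = (e \<otimes>\<^sub>a e) \<cdot> (u \<otimes>\<^sub>a u) \<cdot> linv \<I>"
      using s by (simp add: ed eu comult_unit merge)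
  qed (use s in simp_all)
  have cu: "c \<cdot> u = \<iota> \<I>" using s by (simp add: c eu counit_unit)
  show "is_bimonoid C S"
    unfolding is_bimonoid_def is_monoid_def is_comonoid_def Let_def S
    using s assoc unit_l unit_r coassoc counit_l counit_r bim counit_m unit_d cu
    by (simp add: Hom_iff)
  show "bimonoid_hom C S A e"
    unfolding bimonoid_hom_def S using s m u d c by (simp add: Hom_iff)
  assume bc: "is_bicommutative C A"
  have "m \<cdot> \<s> E E = m"
  proof (rule mono_arrowD[OF e(1)])
    have "e \<cdot> m \<cdot> \<s> E E = \<nabla> A \<cdot> \<s> ?A ?A \<cdot> (e \<otimes>\<^sub>a e)"
      using s by (simp add: em s_nat)
    also have "\<dots> = e \<cdot> m"
      using s bc comp_extend[of "\<nabla> A" "\<s> ?A ?A" "\<nabla> A" "e \<otimes>\<^sub>a e"]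
      by (simp add: is_bicommutative_def em)
    finally show "e \<cdot> m \<cdot> \<s> E E = e \<cdot> m" .
  qed (use s in simp_all)
  moreover have "\<s> E E \<cdot> d = d"
  proof (rule mono_arrowD[OF e(2)])
    have "(e \<otimes>\<^sub>a e) \<cdot> \<s> E E \<cdot> d = \<s> ?A ?A \<cdot> (e \<otimes>\<^sub>a e) \<cdot> d"
      using s by (simp add: comp_extend[OF s_nat])
    also have "\<dots> = (e \<otimes>\<^sub>a e) \<cdot> d"
      using s bc comp_extend[of "\<s> ?A ?A" "\<Delta> A" "\<Delta> A" "e"]
      by (simp add: is_bicommutative_def ed)
    finally show "(e \<otimes>\<^sub>a e) \<cdot> \<s> E E \<cdot> d = (e \<otimes>\<^sub>a e) \<cdot> d" .
  qed (use s in simp_all)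
  ultimately show "is_bicommutative C S" by (simp add: is_bicommutative_def S)
qed

end

section \<open>Kernels are computed as stabilized objects\<close>

context symmetric_monoidal_category
begin

definition coaction_along :: "('o, 'm) bimonoid \<Rightarrow> 'm \<Rightarrow> 'm" where
  "coaction_along A f = (\<iota> (Carrier A) \<otimes>\<^sub>a f) \<cdot> \<Delta> A"

definition trivial_coaction :: "'o \<Rightarrow> ('o, 'm) bimonoid \<Rightarrow> 'm" where
  "trivial_coaction X B = (\<iota> X \<otimes>\<^sub>a \<eta> B) \<cdot> rinv X"

lemma trivial_coaction_simps [simp]:
  assumes "is_bimonoid C B" "X \<in> Obj C"
  shows "trivial_coaction X B \<in> Arr C" "Dom C (trivial_coaction X B) = X"
    "Cod C (trivial_coaction X B) = X \<otimes>\<^sub>o Carrier B"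
  using assms by (simp_all add: trivial_coaction_def)

lemma coaction_along_simps [simp]:
  assumes "is_bimonoid C A" "bimonoid_hom C A B f"
  shows "coaction_along A f \<in> Arr C" "Dom C (coaction_along A f) = Carrier A"
    "Cod C (coaction_along A f) = Carrier A \<otimes>\<^sub>o Carrier B"
  using assms(1) bimonoid_homD[OF assms(2)] by (simp_all add: coaction_along_def)

lemma right_coaction_trivial:
  assumes B: "is_bimonoid C B" and X: "X \<in> Obj C"
  shows "right_coaction C B (trivial_coaction X B) X"
proof -
  let ?B = "Carrier B" and ?t = "trivial_coaction X B"
  have "\<a> X ?B ?B \<cdot> (?t \<otimes>\<^sub>a \<iota> ?B) \<cdot> ?t
      = \<a> X ?B ?B \<cdot> ((\<iota> X \<otimes>\<^sub>a \<eta> B) \<otimes>\<^sub>a \<eta> B) \<cdot> (rinv X \<otimes>\<^sub>a \<iota> \<I>) \<cdot> rinv X"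
    using B X by (simp add: trivial_coaction_def merge)
  also have "\<dots> = (\<iota> X \<otimes>\<^sub>a (\<eta> B \<otimes>\<^sub>a \<eta> B)) \<cdot> (\<iota> X \<otimes>\<^sub>a linv \<I>) \<cdot> rinv X"
    using B X by (simp add: comp_extend[OF assoc_nat] comp_extend[OF assoc_rinv])
  also have "\<dots> = (\<iota> X \<otimes>\<^sub>a \<Delta> B) \<cdot> ?t"
    using B X by (simp add: trivial_coaction_def merge comult_unit)
  finally have "\<a> X ?B ?B \<cdot> (?t \<otimes>\<^sub>a \<iota> ?B) \<cdot> ?t = (\<iota> X \<otimes>\<^sub>a \<Delta> B) \<cdot> ?t" .
  moreover have "\<r> X \<cdot> (\<iota> X \<otimes>\<^sub>a \<epsilon> B) \<cdot> ?t = \<iota> X"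
    using B X by (simp add: trivial_coaction_def merge counit_unit)
  ultimately show ?thesis
    using B X by (simp add: right_coaction_def Hom_iff)
qed

lemma right_coaction_along:
  assumes A: "is_bimonoid C A" and B: "is_bimonoid C B" and f: "bimonoid_hom C A B f"
  shows "right_coaction C B (coaction_along A f) (Carrier A)"
proof -
  let ?A = "Carrier A" and ?B = "Carrier B" and ?b = "coaction_along A f"
  note f' = bimonoid_homD[OF f]
  have "\<a> ?A ?B ?B \<cdot> (?b \<otimes>\<^sub>a \<iota> ?B) \<cdot> ?b
      = \<a> ?A ?B ?B \<cdot> ((\<iota> ?A \<otimes>\<^sub>a f) \<otimes>\<^sub>a f) \<cdot> (\<Delta> A \<otimes>\<^sub>a \<iota> ?A) \<cdot> \<Delta> A"
    using A B f' by (simp add: coaction_along_def merge)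
  also have "\<dots> = (\<iota> ?A \<otimes>\<^sub>a (f \<otimes>\<^sub>a f)) \<cdot> (\<iota> ?A \<otimes>\<^sub>a \<Delta> A) \<cdot> \<Delta> A"
    using A B f' by (simp add: comp_extend[OF assoc_nat] comult_assoc)
  also have "\<dots> = (\<iota> ?A \<otimes>\<^sub>a \<Delta> B) \<cdot> ?b"
    using A B f' by (simp add: coaction_along_def merge)
  finally have "\<a> ?A ?B ?B \<cdot> (?b \<otimes>\<^sub>a \<iota> ?B) \<cdot> ?b = (\<iota> ?A \<otimes>\<^sub>a \<Delta> B) \<cdot> ?b" .
  moreover have "\<r> ?A \<cdot> (\<iota> ?A \<otimes>\<^sub>a \<epsilon> B) \<cdot> ?b = \<iota> ?A"
    using A B f' by (simp add: coaction_along_def merge comult_counit_right)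
  ultimately show ?thesis
    using A B f' coaction_along_simps[OF A f] by (simp add: right_coaction_def Hom_iff)
qed

lemma equalizer_iso:
  assumes R: "is_equalizer C f g R r" and t: "iso_arrow C t" "Cod C t = R"
  shows "is_equalizer C f g (Dom C t) (r \<cdot> t)"
proof (rule equalizerI)
  note r = equalizer_arrow[OF R]
  show "f \<in> Arr C" "g \<in> Arr C" "Dom C g = Dom C f" "Cod C g = Cod C f" by (fact r)+
  show "mono_arrow C (r \<cdot> t)"
    by (rule mono_comp) (use r t equalizer_mono[OF R] iso_mono[OF t(1)] in simp_all)
  show "Dom C (r \<cdot> t) = Dom C t" "Cod C (r \<cdot> t) = Dom C f" using r t by simp_all
  show "f \<cdot> r \<cdot> t = g \<cdot> r \<cdot> t"
    using comp_extend[OF r(8), of t] r t by simp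
  fix h
  assume h: "h \<in> Arr C" "Cod C h = Dom C f" "f \<cdot> h = g \<cdot> h"
  obtain u where "u \<in> Arr C" "Dom C u = Dom C h" "Cod C u = R" "r \<cdot> u = h"
    by (rule equalizer_factor[OF R h])
  then show "\<exists>u. u \<in> Arr C \<and> Dom C u = Dom C h \<and> Cod C u = Dom C t \<and> (r \<cdot> t) \<cdot> u = h"
    using r t by (intro exI[of _ "inv_arrow C t \<cdot> u"]) simp
qed

text \<open>Costability compares \<open>E \<otimes> E'\<close> with some equalizer of the tensor coaction; since the
  comparison is invertible, \<open>E \<otimes> E'\<close> is itself such an equalizer.\<close>

lemma costable_equalizer:
  assumes eq: "has_equalizers C" and st: "right_costable C"
    and b: "right_coaction C B \<beta> Y" "right_coaction_stabilized C B \<beta> Y E e"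
    and b': "right_coaction C B' \<beta>' Y'" "right_coaction_stabilized C B' \<beta>' Y' E' e'"
  shows "is_equalizer C (mid Y (Carrier B) Y' (Carrier B') \<cdot> (\<beta> \<otimes>\<^sub>a \<beta>'))
    ((\<iota> (Y \<otimes>\<^sub>o Y') \<otimes>\<^sub>a ((\<eta> B \<otimes>\<^sub>a \<eta> B') \<cdot> linv \<I>)) \<cdot> rinv (Y \<otimes>\<^sub>o Y')) (E \<otimes>\<^sub>o E') (e \<otimes>\<^sub>a e')"
    (is "is_equalizer C ?f ?g _ _")
proof -
  have "parallel C ?f ?g"
    using b(1) b'(1) by (simp add: parallel_def right_coaction_def Hom_iff)
  then obtain R r where R: "is_equalizer C ?f ?g R r"
    using eq unfolding has_equalizers_def by blast
  then have "right_coaction_stabilized C (bimonoid_tensor C B B')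
      (right_coaction_tensor C B \<beta> Y B' \<beta>' Y') (Y \<otimes>\<^sub>o Y') R r"
    by (simp add: right_coaction_stabilized_def right_coaction_tensor_def bimonoid_tensor_def Let_def)
  then obtain g where g: "g \<in> Hom C (E \<otimes>\<^sub>o E') R" "r \<cdot> g = e \<otimes>\<^sub>a e'" "iso_arrow C g"
    using st b b' unfolding right_costable_def by blast
  then show ?thesis using equalizer_iso[OF R g(3)] by (simp add: Hom_iff)
qed

lemma trivial_coaction_stabilized:
  assumes "is_bimonoid C B" "X \<in> Obj C"
  shows "right_coaction_stabilized C B (trivial_coaction X B) X X (\<iota> X)"
  unfolding right_coaction_stabilized_def
proof (rule equalizerI)
  show "mono_arrow C (\<iota> X)" using assms by (intro iso_mono iso_idn(1))
  fix h
  assume "h \<in> Arr C" "Cod C h = Dom C (trivial_coaction X B)"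
  then show "\<exists>u. u \<in> Arr C \<and> Dom C u = Dom C h \<and> Cod C u = X \<and> \<iota> X \<cdot> u = h"
    using assms by (intro exI[of _ h]) simp
qed (use assms trivial_coaction_simps[OF assms] in \<open>simp_all add: trivial_coaction_def\<close>)

text \<open>The object \<open>X\<close> is the stabilized object of its own trivial coaction, so costability makes
  \<open>e \<otimes> \<iota> X\<close> an equalizer.  In a general monoidal category tensoring does not preserve
  monomorphisms.\<close>

lemma stabilized_ten_mono:
  assumes "has_equalizers C" "right_costable C"
    and "right_coaction C B \<beta> Y" "right_coaction_stabilized C B \<beta> Y E e" and X: "X \<in> Obj C"
  shows "mono_arrow C (e \<otimes>\<^sub>a \<iota> X)"
proof -
  have B: "is_bimonoid C B" using assms(3) by (simp add: right_coaction_def)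
  show ?thesis
    using costable_equalizer[OF assms(1-4) right_coaction_trivial[OF B X]
        trivial_coaction_stabilized[OF B X]]
    by (rule equalizer_mono)
qed

lemma braid_iso: "X \<in> Obj C \<Longrightarrow> Y \<in> Obj C \<Longrightarrow> iso_arrow C (\<s> X Y)"
  unfolding iso_arrow_def inverse_arrows_def by (intro exI[of _ "\<s> Y X"]) (simp add: Hom_iff)

text \<open>The symmetry and the associator move a factor \<open>e\<close> standing anywhere in a tensor product to
  the left end, where the assumption applies; a tensor power of \<open>e\<close> is a composite of such arrows
  with a single factor \<open>e\<close>.\<close>

lemma ten_powers_mono:
  assumes arr: "e \<in> Arr C" "Dom C e = E" "Cod C e = Y"
    and mono: "\<And>X. X \<in> Obj C \<Longrightarrow> mono_arrow C (e \<otimes>\<^sub>a \<iota> X)"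
  shows "mono_arrow C (e \<otimes>\<^sub>a e)" and "mono_arrow C (e \<otimes>\<^sub>a (e \<otimes>\<^sub>a e))"
proof -
  have obj: "E \<in> Obj C" "Y \<in> Obj C" using arr by auto
  note s = arr obj
  have right: "mono_arrow C (\<iota> X \<otimes>\<^sub>a e)" if X: "X \<in> Obj C" for X
  proof -
    have "\<iota> X \<otimes>\<^sub>a e = \<s> Y X \<cdot> (e \<otimes>\<^sub>a \<iota> X) \<cdot> \<s> X E"
      using s X by (simp add: comp_extend[OF s_nat])
    then show ?thesis
      using s X mono[OF X] by (simp add: mono_comp iso_mono braid_iso)
  qed
  have middle: "mono_arrow C (\<iota> X \<otimes>\<^sub>a (e \<otimes>\<^sub>a \<iota> Z))" if XZ: "X \<in> Obj C" "Z \<in> Obj C" for X Z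
  proof -
    have "ainv X Y Z \<cdot> (\<iota> X \<otimes>\<^sub>a (e \<otimes>\<^sub>a \<iota> Z)) = ((\<iota> X \<otimes>\<^sub>a e) \<otimes>\<^sub>a \<iota> Z) \<cdot> ainv X E Z"
      using s XZ by (simp add: ainv_nat)
    also have "(\<iota> X \<otimes>\<^sub>a e) \<otimes>\<^sub>a \<iota> Z
        = (\<s> Y X \<otimes>\<^sub>a \<iota> Z) \<cdot> ((e \<otimes>\<^sub>a \<iota> X) \<otimes>\<^sub>a \<iota> Z) \<cdot> (\<s> X E \<otimes>\<^sub>a \<iota> Z)"
      using s XZ by (simp add: merge comp_extend[OF s_nat])
    also have "(e \<otimes>\<^sub>a \<iota> X) \<otimes>\<^sub>a \<iota> Z = ainv Y X Z \<cdot> (e \<otimes>\<^sub>a \<iota> (X \<otimes>\<^sub>o Z)) \<cdot> \<a> E X Z"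
      using s XZ by (simp add: comp_extend[OF ainv_nat_idn])
    finally have "\<iota> X \<otimes>\<^sub>a (e \<otimes>\<^sub>a \<iota> Z) = \<a> X Y Z \<cdot> ((\<s> Y X \<otimes>\<^sub>a \<iota> Z)
        \<cdot> (ainv Y X Z \<cdot> (e \<otimes>\<^sub>a \<iota> (X \<otimes>\<^sub>o Z)) \<cdot> \<a> E X Z) \<cdot> (\<s> X E \<otimes>\<^sub>a \<iota> Z)) \<cdot> ainv X E Z"
      using s XZ by - (rule iso_mono_cancel[of "ainv X Y Z"], simp_all add: iso_inv_arrow)
    then show ?thesis
      using s XZ mono[of "X \<otimes>\<^sub>o Z"]
      by (simp add: mono_comp iso_mono iso_inv_arrow iso_ten iso_idn braid_iso)
  qed
  have last: "mono_arrow C (\<iota> X \<otimes>\<^sub>a (\<iota> Z \<otimes>\<^sub>a e))" if XZ: "X \<in> Obj C" "Z \<in> Obj C" for X Z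
  proof -
    have "\<iota> X \<otimes>\<^sub>a (\<iota> Z \<otimes>\<^sub>a e) = \<a> X Z Y \<cdot> (\<iota> (X \<otimes>\<^sub>o Z) \<otimes>\<^sub>a e) \<cdot> ainv X Z E"
      using s XZ by (simp add: comp_extend[OF assoc_nat_idn])
    then show ?thesis
      using s XZ right[of "X \<otimes>\<^sub>o Z"] by (simp add: mono_comp iso_mono iso_inv_arrow)
  qed
  have "e \<otimes>\<^sub>a e = (e \<otimes>\<^sub>a \<iota> Y) \<cdot> (\<iota> E \<otimes>\<^sub>a e)" using s by (simp add: merge)
  then show "mono_arrow C (e \<otimes>\<^sub>a e)" using s mono right by (simp add: mono_comp)
  have "e \<otimes>\<^sub>a (e \<otimes>\<^sub>a e)
      = (e \<otimes>\<^sub>a \<iota> (Y \<otimes>\<^sub>o Y)) \<cdot> (\<iota> E \<otimes>\<^sub>a (e \<otimes>\<^sub>a \<iota> Y)) \<cdot> (\<iota> E \<otimes>\<^sub>a (\<iota> E \<otimes>\<^sub>a e))"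
    using s by (simp add: merge)
  then show "mono_arrow C (e \<otimes>\<^sub>a (e \<otimes>\<^sub>a e))"
    using s mono middle last by (simp add: mono_comp)
qed

end

locale bicommutative_hopf_hom = symmetric_monoidal_category C
  for C :: "('o, 'm, 'z) smc_scheme" (structure) +
  fixes A B :: "('o, 'm) bimonoid" and \<xi> :: 'm
  assumes A: "is_hopf_monoid C A" "is_bicommutative C A"
    and B: "is_hopf_monoid C B" "is_bicommutative C B"
    and \<xi>: "bimonoid_hom C A B \<xi>"
begin

abbreviation "\<beta> \<equiv> coaction_along A \<xi>"

lemmas \<xi>_simps = bimonoid_homD(1-3)[OF \<xi>]
lemmas \<xi>_hom = bimonoid_homD(4-7)[OF \<xi>]
lemmas \<xi>_rewrite = \<xi>_hom \<xi>_hom[THEN comp_extend]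

declare A(1) [simp] B(1) [simp] \<xi>_simps [simp]

lemma \<beta>_simps [simp]: "\<beta> \<in> Arr C" "Dom C \<beta> = Carrier A" "Cod C \<beta> = Carrier A \<otimes>\<^sub>o Carrier B"
  by (simp_all add: coaction_along_simps[OF _ \<xi>])

lemma \<beta>_mult:
  "\<beta> \<cdot> \<nabla> A = (\<nabla> A \<otimes>\<^sub>a \<nabla> B) \<cdot> mid (Carrier A) (Carrier B) (Carrier A) (Carrier B) \<cdot> (\<beta> \<otimes>\<^sub>a \<beta>)"
proof -
  let ?A = "Carrier A" and ?B = "Carrier B"
  have "\<beta> \<cdot> \<nabla> A = (\<iota> ?A \<otimes>\<^sub>a \<xi>) \<cdot> (\<nabla> A \<otimes>\<^sub>a \<nabla> A) \<cdot> mid ?A ?A ?A ?A \<cdot> (\<Delta> A \<otimes>\<^sub>a \<Delta> A)"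
    by (simp add: coaction_along_def comult_mult)
  also have "\<dots> = (\<nabla> A \<otimes>\<^sub>a \<nabla> B) \<cdot> (\<iota> (?A \<otimes>\<^sub>o ?A) \<otimes>\<^sub>a (\<xi> \<otimes>\<^sub>a \<xi>)) \<cdot> mid ?A ?A ?A ?A \<cdot> (\<Delta> A \<otimes>\<^sub>a \<Delta> A)"
    by (simp add: merge \<xi>_rewrite)
  also have "(\<iota> (?A \<otimes>\<^sub>o ?A) \<otimes>\<^sub>a (\<xi> \<otimes>\<^sub>a \<xi>)) \<cdot> mid ?A ?A ?A ?A \<cdot> (\<Delta> A \<otimes>\<^sub>a \<Delta> A)
      = mid ?A ?B ?A ?B \<cdot> ((\<iota> ?A \<otimes>\<^sub>a \<xi>) \<otimes>\<^sub>a (\<iota> ?A \<otimes>\<^sub>a \<xi>)) \<cdot> (\<Delta> A \<otimes>\<^sub>a \<Delta> A)"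
    by (simp add: comp_extend[OF mid_nat])
  finally show ?thesis by (simp add: coaction_along_def merge)
qed

text \<open>The left \<open>A\<close>-module structure \<open>x (y \<otimes> b) = x y \<otimes> b\<close> on \<open>A \<otimes> B\<close>.  The invariance of the
  antipode is checked with this action alone, which avoids the tensor product monoid \<open>A \<otimes> B\<close>.\<close>

definition act :: 'm where
  "act = (\<nabla> A \<otimes>\<^sub>a \<iota> (Carrier B)) \<cdot> ainv (Carrier A) (Carrier A) (Carrier B)"

lemma act_simps [simp]:
  "act \<in> Arr C" "Dom C act = Carrier A \<otimes>\<^sub>o (Carrier A \<otimes>\<^sub>o Carrier B)"
  "Cod C act = Carrier A \<otimes>\<^sub>o Carrier B"
  by (simp_all add: act_def)

lemma act_unit: "act \<cdot> (\<eta> A \<otimes>\<^sub>a \<iota> (Carrier A \<otimes>\<^sub>o Carrier B)) \<cdot> linv (Carrier A \<otimes>\<^sub>o Carrier B)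
  = \<iota> (Carrier A \<otimes>\<^sub>o Carrier B)"
proof -
  let ?A = "Carrier A" and ?B = "Carrier B"
  have "act \<cdot> (\<eta> A \<otimes>\<^sub>a \<iota> (?A \<otimes>\<^sub>o ?B)) \<cdot> linv (?A \<otimes>\<^sub>o ?B)
      = (\<nabla> A \<otimes>\<^sub>a \<iota> ?B) \<cdot> ((\<eta> A \<otimes>\<^sub>a \<iota> ?A) \<otimes>\<^sub>a \<iota> ?B) \<cdot> (linv ?A \<otimes>\<^sub>a \<iota> ?B)"
    by (simp add: act_def comp_extend[OF ainv_nat_idn] ainv_linv)
  also have "\<dots> = \<iota> (?A \<otimes>\<^sub>o ?B)"
    by (simp add: merge comp_extend[OF mult_unit_left])
  finally show ?thesis .
qed

lemma act_mult: "act \<cdot> (\<nabla> A \<otimes>\<^sub>a \<iota> (Carrier A \<otimes>\<^sub>o Carrier B))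
  = act \<cdot> (\<iota> (Carrier A) \<otimes>\<^sub>a act) \<cdot> \<a> (Carrier A) (Carrier A) (Carrier A \<otimes>\<^sub>o Carrier B)"
proof -
  let ?A = "Carrier A" and ?B = "Carrier B"
  have pent: "ainv ?A (?A \<otimes>\<^sub>o ?A) ?B \<cdot> (\<iota> ?A \<otimes>\<^sub>a ainv ?A ?A ?B) \<cdot> \<a> ?A ?A (?A \<otimes>\<^sub>o ?B)
      = (\<a> ?A ?A ?A \<otimes>\<^sub>a \<iota> ?B) \<cdot> ainv (?A \<otimes>\<^sub>o ?A) ?A ?B"
    (is "?L = ?R")
  proof (rule iso_epi_cancel[of "\<a> (?A \<otimes>\<^sub>o ?A) ?A ?B"])
    show "?L \<cdot> \<a> (?A \<otimes>\<^sub>o ?A) ?A ?B = ?R \<cdot> \<a> (?A \<otimes>\<^sub>o ?A) ?A ?B"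
      by (simp add: pentagon merge)
  qed simp_all
  have "act \<cdot> (\<nabla> A \<otimes>\<^sub>a \<iota> (?A \<otimes>\<^sub>o ?B))
      = (\<nabla> A \<otimes>\<^sub>a \<iota> ?B) \<cdot> ((\<nabla> A \<otimes>\<^sub>a \<iota> ?A) \<otimes>\<^sub>a \<iota> ?B) \<cdot> ainv (?A \<otimes>\<^sub>o ?A) ?A ?B"
    by (simp add: act_def ainv_nat_idn)
  also have "\<dots> = (\<nabla> A \<otimes>\<^sub>a \<iota> ?B) \<cdot> ((\<iota> ?A \<otimes>\<^sub>a \<nabla> A) \<otimes>\<^sub>a \<iota> ?B) \<cdot> ?R"
    by (simp add: merge mult_assoc)
  also have "\<dots> = (\<nabla> A \<otimes>\<^sub>a \<iota> ?B) \<cdot> ((\<iota> ?A \<otimes>\<^sub>a \<nabla> A) \<otimes>\<^sub>a \<iota> ?B) \<cdot> ?L"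
    by (simp only: pent)
  also have "\<dots> = act \<cdot> (\<iota> ?A \<otimes>\<^sub>a (\<nabla> A \<otimes>\<^sub>a \<iota> ?B)) \<cdot> (\<iota> ?A \<otimes>\<^sub>a ainv ?A ?A ?B) \<cdot> \<a> ?A ?A (?A \<otimes>\<^sub>o ?B)"
    by (simp add: act_def comp_extend[OF ainv_nat])
  also have "\<dots> = act \<cdot> (\<iota> ?A \<otimes>\<^sub>a act) \<cdot> \<a> ?A ?A (?A \<otimes>\<^sub>o ?B)"
    by (simp add: act_def merge)
  finally show ?thesis .
qed

text \<open>Since \<open>\<beta>\<close> is multiplicative, \<open>\<beta>(x y) = \<beta>(x) \<beta>(y) = (x \<otimes> 1) \<beta>(y) = x \<beta>(y)\<close> when the
  coaction on \<open>x\<close> is trivial.\<close>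

lemma \<beta>_mult_invariant:
  assumes e: "e \<in> Arr C" "Cod C e = Carrier A"
    and inv: "\<beta> \<cdot> e = trivial_coaction (Carrier A) B \<cdot> e"
  shows "\<beta> \<cdot> \<nabla> A \<cdot> (e \<otimes>\<^sub>a \<iota> (Carrier A)) = act \<cdot> (e \<otimes>\<^sub>a \<beta>)"
proof -
  let ?A = "Carrier A" and ?B = "Carrier B"
  have "\<beta> \<cdot> \<nabla> A \<cdot> (e \<otimes>\<^sub>a \<iota> ?A)
      = (\<nabla> A \<otimes>\<^sub>a \<nabla> B) \<cdot> mid ?A ?B ?A ?B \<cdot> (\<beta> \<otimes>\<^sub>a \<beta>) \<cdot> (e \<otimes>\<^sub>a \<iota> ?A)"
    using e by (simp add: comp_extend[OF \<beta>_mult])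
  also have "\<dots> = (\<nabla> A \<otimes>\<^sub>a \<nabla> B) \<cdot> mid ?A ?B ?A ?B
      \<cdot> ((\<iota> ?A \<otimes>\<^sub>a \<eta> B) \<otimes>\<^sub>a (\<iota> ?A \<otimes>\<^sub>a \<iota> ?B)) \<cdot> (rinv ?A \<otimes>\<^sub>a \<iota> (?A \<otimes>\<^sub>o ?B)) \<cdot> (e \<otimes>\<^sub>a \<beta>)"
    using e by (simp add: merge inv trivial_coaction_def)
  also have "\<dots> = (\<nabla> A \<otimes>\<^sub>a \<nabla> B) \<cdot> (\<iota> (?A \<otimes>\<^sub>o ?A) \<otimes>\<^sub>a (\<eta> B \<otimes>\<^sub>a \<iota> ?B))
      \<cdot> mid ?A \<I> ?A ?B \<cdot> (rinv ?A \<otimes>\<^sub>a \<iota> (?A \<otimes>\<^sub>o ?B)) \<cdot> (e \<otimes>\<^sub>a \<beta>)"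
    using e by (subst comp_extend[OF mid_nat]) simp_all
  also have "\<dots> = (\<nabla> A \<otimes>\<^sub>a \<nabla> B) \<cdot> (\<iota> (?A \<otimes>\<^sub>o ?A) \<otimes>\<^sub>a (\<eta> B \<otimes>\<^sub>a \<iota> ?B))
      \<cdot> (\<iota> (?A \<otimes>\<^sub>o ?A) \<otimes>\<^sub>a linv ?B) \<cdot> ainv ?A ?A ?B \<cdot> (e \<otimes>\<^sub>a \<beta>)"
    using e by (simp add: comp_extend[OF mid_unit_second])
  also have "\<dots> = act \<cdot> (e \<otimes>\<^sub>a \<beta>)"
    using e by (simp add: act_def merge comp_extend[OF mult_unit_left])
  finally show ?thesis .
qed

text \<open>The antipode preserves invariance.  In terms of elements, for \<open>x\<close> in the stabilized object
  \<open>\<beta>(S x) = (S x\<^sub>1) x\<^sub>2 \<beta>(S x\<^sub>3) = (S x\<^sub>1) \<beta>(x\<^sub>2 (S x\<^sub>3)) = (S x) \<beta>(1)\<close>, where the middle step is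
  \<open>\<beta>_mult_invariant\<close>.\<close>

lemma antipode_invariant:
  assumes e: "e \<in> Arr C" "Dom C e = E" "Cod C e = Carrier A"
    and inv: "\<beta> \<cdot> e = trivial_coaction (Carrier A) B \<cdot> e"
    and d: "d \<in> Arr C" "Dom C d = E" "Cod C d = E \<otimes>\<^sub>o E" "(e \<otimes>\<^sub>a e) \<cdot> d = \<Delta> A \<cdot> e"
    and coassoc: "\<a> E E E \<cdot> (d \<otimes>\<^sub>a \<iota> E) \<cdot> d = (\<iota> E \<otimes>\<^sub>a d) \<cdot> d"
    and counit: "((\<epsilon> A \<cdot> e) \<otimes>\<^sub>a \<iota> E) \<cdot> d = linv E" "(\<iota> E \<otimes>\<^sub>a (\<epsilon> A \<cdot> e)) \<cdot> d = rinv E"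
    and S: "is_antipode C A S"
  shows "\<beta> \<cdot> S \<cdot> e = trivial_coaction (Carrier A) B \<cdot> S \<cdot> e"
proof -
  let ?A = "Carrier A" and ?B = "Carrier B"
  have E: "E \<in> Obj C" using e by auto
  have S': "S \<in> Arr C" "Dom C S = ?A" "Cod C S = ?A"
    "\<nabla> A \<cdot> (S \<otimes>\<^sub>a \<iota> ?A) \<cdot> \<Delta> A = \<eta> A \<cdot> \<epsilon> A" "\<nabla> A \<cdot> (\<iota> ?A \<otimes>\<^sub>a S) \<cdot> \<Delta> A = \<eta> A \<cdot> \<epsilon> A"
    using S by (simp_all add: is_antipode_def Hom_iff)
  note s = e E d(1-3) S'(1-3)
  define f where "f = \<beta> \<cdot> S \<cdot> e"
  have f: "f \<in> Arr C" "Dom C f = E" "Cod C f = ?A \<otimes>\<^sub>o ?B" using s by (simp_all add: f_def)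
  let ?\<eta>\<eta> = "(\<eta> A \<otimes>\<^sub>a \<eta> B) \<cdot> linv \<I>"
  have \<beta>\<eta>: "\<beta> \<cdot> \<eta> A = ?\<eta>\<eta>"
    by (simp add: coaction_along_def comult_unit merge \<xi>_rewrite)
  have right: "act \<cdot> (e \<otimes>\<^sub>a f) \<cdot> d = ?\<eta>\<eta> \<cdot> \<epsilon> A \<cdot> e"
  proof -
    have "act \<cdot> (e \<otimes>\<^sub>a f) \<cdot> d = (act \<cdot> (e \<otimes>\<^sub>a \<beta>)) \<cdot> (\<iota> E \<otimes>\<^sub>a (S \<cdot> e)) \<cdot> d"
      using s by (simp add: f_def merge)
    also have "\<dots> = (\<beta> \<cdot> \<nabla> A \<cdot> (e \<otimes>\<^sub>a \<iota> ?A)) \<cdot> (\<iota> E \<otimes>\<^sub>a (S \<cdot> e)) \<cdot> d"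
      using s by (simp only: \<beta>_mult_invariant[OF e(1,3) inv])
    also have "\<dots> = \<beta> \<cdot> \<nabla> A \<cdot> (\<iota> ?A \<otimes>\<^sub>a S) \<cdot> (e \<otimes>\<^sub>a e) \<cdot> d"
      using s by (simp add: merge)
    also have "\<dots> = \<beta> \<cdot> \<eta> A \<cdot> \<epsilon> A \<cdot> e"
      using s by (simp add: d(4) comp_extend3[OF S'(5)])
    finally show ?thesis using s by (simp add: comp_extend[OF \<beta>\<eta>])
  qed
  have left: "\<nabla> A \<cdot> ((S \<cdot> e) \<otimes>\<^sub>a e) \<cdot> d = \<eta> A \<cdot> \<epsilon> A \<cdot> e"
  proof -
    have "\<nabla> A \<cdot> ((S \<cdot> e) \<otimes>\<^sub>a e) \<cdot> d = \<nabla> A \<cdot> (S \<otimes>\<^sub>a \<iota> ?A) \<cdot> (e \<otimes>\<^sub>a e) \<cdot> d"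
      using s by (simp add: merge)
    also have "\<dots> = \<eta> A \<cdot> \<epsilon> A \<cdot> e"
      using s by (simp add: d(4) comp_extend3[OF S'(4)])
    finally show ?thesis .
  qed
  have "f = act \<cdot> (\<eta> A \<otimes>\<^sub>a \<iota> (?A \<otimes>\<^sub>o ?B)) \<cdot> linv (?A \<otimes>\<^sub>o ?B) \<cdot> f"
    using s f by (simp add: comp_extend3[OF act_unit])
  also have "\<dots> = act \<cdot> (\<eta> A \<otimes>\<^sub>a f) \<cdot> linv E"
    using s f by (simp add: linv_nat merge)
  also have "\<dots> = act \<cdot> ((\<eta> A \<cdot> \<epsilon> A \<cdot> e) \<otimes>\<^sub>a f) \<cdot> d"
    using s f by (simp add: merge flip: counit(1))
  also have "\<dots> = act \<cdot> (\<nabla> A \<otimes>\<^sub>a \<iota> (?A \<otimes>\<^sub>o ?B)) \<cdot> (((S \<cdot> e) \<otimes>\<^sub>a e) \<otimes>\<^sub>a f) \<cdot> (d \<otimes>\<^sub>a \<iota> E) \<cdot> d"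
    unfolding left[symmetric] using s f by (simp add: merge)
  also have "\<dots> = act \<cdot> (\<iota> ?A \<otimes>\<^sub>a act) \<cdot> ((S \<cdot> e) \<otimes>\<^sub>a (e \<otimes>\<^sub>a f)) \<cdot> (\<iota> E \<otimes>\<^sub>a d) \<cdot> d"
    using s f by (simp add: comp_extend[OF act_mult] comp_extend[OF assoc_nat] coassoc)
  also have "\<dots> = act \<cdot> ((S \<cdot> e) \<otimes>\<^sub>a (act \<cdot> (e \<otimes>\<^sub>a f) \<cdot> d)) \<cdot> d"
    using s f by (simp add: merge)
  also have "\<dots> = act \<cdot> (\<iota> ?A \<otimes>\<^sub>a ?\<eta>\<eta>) \<cdot> ((S \<cdot> e) \<otimes>\<^sub>a \<iota> \<I>) \<cdot> (\<iota> E \<otimes>\<^sub>a (\<epsilon> A \<cdot> e)) \<cdot> d"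
    unfolding right using s f by (simp add: merge)
  also have "\<dots> = act \<cdot> (\<iota> ?A \<otimes>\<^sub>a ?\<eta>\<eta>) \<cdot> rinv ?A \<cdot> S \<cdot> e"
    using s f by (simp add: counit(2) rinv_nat)
  also have "\<dots> = (\<nabla> A \<otimes>\<^sub>a \<iota> ?B) \<cdot> ((\<iota> ?A \<otimes>\<^sub>a \<eta> A) \<otimes>\<^sub>a \<eta> B) \<cdot> (rinv ?A \<otimes>\<^sub>a \<iota> \<I>) \<cdot> rinv ?A \<cdot> S \<cdot> e"
  proof -
    have "\<iota> ?A \<otimes>\<^sub>a ?\<eta>\<eta> = (\<iota> ?A \<otimes>\<^sub>a (\<eta> A \<otimes>\<^sub>a \<eta> B)) \<cdot> (\<iota> ?A \<otimes>\<^sub>a linv \<I>)"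
      by (simp add: merge)
    then show ?thesis
      using s by (simp add: act_def comp_extend[OF ainv_nat] comp_extend[OF ainv_linv(1)])
  qed
  also have "\<dots> = trivial_coaction ?A B \<cdot> S \<cdot> e"
    using s by (simp add: trivial_coaction_def merge comp_extend[OF mult_unit_right])
  finally show ?thesis by (simp add: f_def)
qed

end

context symmetric_monoidal_category
begin

text \<open>As for sub-bimonoids, compatibility with each structure map is tested after composition with
  \<open>e\<close> or \<open>e \<otimes> e\<close>.\<close>

lemma factor_hom:
  assumes S: "is_bimonoid C S" and W: "is_bimonoid C W"
    and e: "bimonoid_hom C S A e" "mono_arrow C e" "mono_arrow C (e \<otimes>\<^sub>a e)"
    and h: "bimonoid_hom C W A h" and A: "is_bimonoid C A"
    and v: "v \<in> Arr C" "Dom C v = Carrier W" "Cod C v = Carrier S" "e \<cdot> v = h"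
  shows "bimonoid_hom C W S v"
proof -
  note e' = bimonoid_homD[OF e(1)] and h' = bimonoid_homD[OF h]
  note s = S W A e'(1-3) h'(1-3) v(1-3)
  note ev = v(4) comp_extend[OF v(4)]
  note eh = e'(4-7) e'(4-7)[THEN comp_extend] h'(4-7)
  have "v \<cdot> \<nabla> W = \<nabla> S \<cdot> (v \<otimes>\<^sub>a v)"
  proof (rule mono_arrowD[OF e(2)])
    show "e \<cdot> v \<cdot> \<nabla> W = e \<cdot> \<nabla> S \<cdot> (v \<otimes>\<^sub>a v)"
      using s by (simp add: ev eh merge)
  qed (use s in simp_all)
  moreover have "v \<cdot> \<eta> W = \<eta> S"
  proof (rule mono_arrowD[OF e(2)])
    show "e \<cdot> v \<cdot> \<eta> W = e \<cdot> \<eta> S" using s by (simp add: ev eh)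
  qed (use s in simp_all)
  moreover have "\<Delta> S \<cdot> v = (v \<otimes>\<^sub>a v) \<cdot> \<Delta> W"
  proof (rule mono_arrowD[OF e(3)])
    have "(e \<otimes>\<^sub>a e) \<cdot> \<Delta> S \<cdot> v = \<Delta> A \<cdot> e \<cdot> v"
      using s by (simp add: comp_extend[OF e'(6)])
    also have "\<dots> = (e \<otimes>\<^sub>a e) \<cdot> (v \<otimes>\<^sub>a v) \<cdot> \<Delta> W"
      using s by (simp add: ev eh merge)
    finally show "(e \<otimes>\<^sub>a e) \<cdot> \<Delta> S \<cdot> v = (e \<otimes>\<^sub>a e) \<cdot> (v \<otimes>\<^sub>a v) \<cdot> \<Delta> W" .
  qed (use s in simp_all)
  moreover have "\<epsilon> S \<cdot> v = \<epsilon> W"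
  proof -
    have "\<epsilon> S \<cdot> v = \<epsilon> A \<cdot> e \<cdot> v" using s by (simp add: comp_extend[OF e'(7)])
    then show ?thesis using s by (simp add: v(4) h')
  qed
  ultimately show ?thesis using s by (simp add: bimonoid_hom_def Hom_iff)
qed

lemma is_KerD:
  assumes "is_Ker C A B \<xi> K k"
  shows "is_hopf_monoid C K" "is_bicommutative C K" "bimonoid_hom C K A k"
    "\<xi> \<cdot> k = trivial_hom C A B \<cdot> k"
    "\<lbrakk>is_hopf_monoid C W; is_bicommutative C W; bimonoid_hom C W A h;
      \<xi> \<cdot> h = trivial_hom C A B \<cdot> h\<rbrakk> \<Longrightarrow> \<exists>!u. bimonoid_hom C W K u \<and> k \<cdot> u = h"
proof -
  let ?D = "Hopf_bc C"
  let ?f = "(A, \<xi>, B)" and ?g = "(A, trivial_hom C A B, B)"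
  have E: "is_equalizer ?D ?f ?g K (K, k, A)" using assms by (simp add: is_Ker_def)
  have par: "?f \<in> Arr ?D" using E by (simp add: is_equalizer_def parallel_def)
  have "(K, k, A) \<in> Hom ?D K A" using E by (simp add: is_equalizer_def Hopf_bc_def)
  then show K: "is_hopf_monoid C K" "is_bicommutative C K" "bimonoid_hom C K A k"
    by (simp_all add: Hom_iff Hopf_bc_def)
  show "\<xi> \<cdot> k = trivial_hom C A B \<cdot> k"
    using E by (simp add: is_equalizer_def Hopf_bc_def)
  assume W: "is_hopf_monoid C W" "is_bicommutative C W" "bimonoid_hom C W A h"
    "\<xi> \<cdot> h = trivial_hom C A B \<cdot> h"
  have "(W, h, A) \<in> Hom ?D W (Dom ?D ?f) \<and> ?f \<cdot>\<^bsub>?D\<^esub> (W, h, A) = ?g \<cdot>\<^bsub>?D\<^esub> (W, h, A)"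
    using W par by (simp add: Hom_iff Hopf_bc_def)
  then have ex: "\<exists>!u. u \<in> Hom ?D W K \<and> (K, k, A) \<cdot>\<^bsub>?D\<^esub> u = (W, h, A)"
    using E unfolding is_equalizer_def by blast
  have iff: "u \<in> Hom ?D W K \<and> (K, k, A) \<cdot>\<^bsub>?D\<^esub> u = (W, h, A)
      \<longleftrightarrow> (\<exists>u'. u = (W, u', K) \<and> bimonoid_hom C W K u' \<and> k \<cdot> u' = h)" for u
    using W K by (cases u) (auto simp: Hom_iff Hopf_bc_def)
  show "\<exists>!u. bimonoid_hom C W K u \<and> k \<cdot> u = h"
    using ex unfolding iff by blast
qed

lemma trivial_hom_hom:
  assumes X: "is_bimonoid C X" and Y: "is_bimonoid C Y"
  shows "bimonoid_hom C X Y (trivial_hom C X Y)"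
proof -
  have "(\<eta> Y \<cdot> \<epsilon> X) \<cdot> \<nabla> X = \<nabla> Y \<cdot> ((\<eta> Y \<cdot> \<epsilon> X) \<otimes>\<^sub>a (\<eta> Y \<cdot> \<epsilon> X))"
  proof -
    have "\<nabla> Y \<cdot> ((\<eta> Y \<cdot> \<epsilon> X) \<otimes>\<^sub>a (\<eta> Y \<cdot> \<epsilon> X))
        = (\<nabla> Y \<cdot> (\<eta> Y \<otimes>\<^sub>a \<eta> Y) \<cdot> linv \<I>) \<cdot> \<l> \<I> \<cdot> (\<epsilon> X \<otimes>\<^sub>a \<epsilon> X)"
      using X Y by (simp add: merge)
    then show ?thesis
      unfolding mult_unit_unit[OF Y] using X Y by (simp add: counit_mult)
  qed
  moreover have "\<Delta> Y \<cdot> \<eta> Y \<cdot> \<epsilon> X = ((\<eta> Y \<cdot> \<epsilon> X) \<otimes>\<^sub>a (\<eta> Y \<cdot> \<epsilon> X)) \<cdot> \<Delta> X"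
  proof -
    have "((\<eta> Y \<cdot> \<epsilon> X) \<otimes>\<^sub>a (\<eta> Y \<cdot> \<epsilon> X)) \<cdot> \<Delta> X
        = (\<eta> Y \<otimes>\<^sub>a \<eta> Y) \<cdot> (\<iota> \<I> \<otimes>\<^sub>a \<epsilon> X) \<cdot> (\<epsilon> X \<otimes>\<^sub>a \<iota> (Carrier X)) \<cdot> \<Delta> X"
      using X Y by (simp add: merge)
    also have "\<dots> = (\<eta> Y \<otimes>\<^sub>a \<eta> Y) \<cdot> (\<iota> \<I> \<otimes>\<^sub>a \<epsilon> X) \<cdot> linv (Carrier X)"
      unfolding counit_comult_inv[OF X] ..
    also have "\<dots> = \<Delta> Y \<cdot> \<eta> Y \<cdot> \<epsilon> X"
      using X Y by (simp add: comp_extend[OF comult_unit] linv_nat)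
    finally show ?thesis by simp
  qed
  ultimately show ?thesis
    using X Y comp_extend[OF counit_unit[OF Y], of "\<epsilon> X"]
    by (simp add: trivial_hom_def bimonoid_hom_def Hom_iff counit_unit)
qed

lemma idn_hom: "is_bimonoid C A \<Longrightarrow> bimonoid_hom C A A (\<iota> (Carrier A))"
  by (simp add: bimonoid_hom_def Hom_iff)

lemma comp_hom:
  assumes "is_bimonoid C X" "is_bimonoid C Y" "is_bimonoid C Z"
    "bimonoid_hom C X Y f" "bimonoid_hom C Y Z g"
  shows "bimonoid_hom C X Z (g \<cdot> f)"
proof -
  note f = bimonoid_homD[OF assms(4)] and g = bimonoid_homD[OF assms(5)]
  have "(g \<cdot> f) \<cdot> \<nabla> X = \<nabla> Z \<cdot> ((g \<cdot> f) \<otimes>\<^sub>a (g \<cdot> f))"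
    using assms(1-3) f(1-3) g(1-3) by (simp add: f(4) comp_extend[OF g(4)] merge)
  moreover have "\<Delta> Z \<cdot> g \<cdot> f = ((g \<cdot> f) \<otimes>\<^sub>a (g \<cdot> f)) \<cdot> \<Delta> X"
    using assms(1-3) f(1-3) g(1-3) by (simp add: f(6) comp_extend[OF g(6)] merge)
  ultimately show ?thesis
    using assms(1-3) f g comp_extend[OF g(7), of f]
    by (simp add: bimonoid_hom_def Hom_iff)
qed

end

context bicommutative_hopf_hom
begin

text \<open>For a homomorphism \<open>h\<close> one has \<open>\<beta>(h(w)) = h(w\<^sub>1) \<otimes> \<xi>(h(w\<^sub>2))\<close>, which is
  \<open>h(w) \<otimes> 1\<close> as soon as \<open>\<xi> h\<close> is trivial.\<close>

lemma invariant_if_trivial: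
  assumes W: "is_bimonoid C W" and h: "bimonoid_hom C W A h"
    and triv: "\<xi> \<cdot> h = trivial_hom C A B \<cdot> h"
  shows "\<beta> \<cdot> h = trivial_coaction (Carrier A) B \<cdot> h"
proof -
  note h' = bimonoid_homD[OF h]
  have \<xi>h: "\<xi> \<cdot> h = \<eta> B \<cdot> \<epsilon> W"
    using triv h' W by (simp add: trivial_hom_def)
  have "\<beta> \<cdot> h = (h \<otimes>\<^sub>a \<eta> B) \<cdot> (\<iota> (Carrier W) \<otimes>\<^sub>a \<epsilon> W) \<cdot> \<Delta> W"
    using W h' by (simp add: coaction_along_def merge \<xi>h)
  also have "\<dots> = (h \<otimes>\<^sub>a \<eta> B) \<cdot> rinv (Carrier W)"
    using W by (simp only: counit_comult_inv)
  also have "\<dots> = trivial_coaction (Carrier A) B \<cdot> h"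
    using W h' by (simp add: trivial_coaction_def rinv_nat merge)
  finally show ?thesis .
qed

text \<open>Apply the counit of \<open>A\<close> to the first factor of \<open>x\<^sub>1 \<otimes> \<xi>(x\<^sub>2) = x \<otimes> 1\<close>.\<close>

lemma trivial_if_invariant:
  assumes e: "e \<in> Arr C" "Cod C e = Carrier A"
    and inv: "\<beta> \<cdot> e = trivial_coaction (Carrier A) B \<cdot> e"
  shows "\<xi> \<cdot> e = trivial_hom C A B \<cdot> e"
proof -
  let ?A = "Carrier A" and ?B = "Carrier B"
  have "\<xi> \<cdot> e = \<xi> \<cdot> \<l> ?A \<cdot> (\<epsilon> A \<otimes>\<^sub>a \<iota> ?A) \<cdot> \<Delta> A \<cdot> e"
    using e by (simp add: comp_extend3[OF comult_counit_left])
  also have "\<dots> = \<l> ?B \<cdot> (\<iota> \<I> \<otimes>\<^sub>a \<xi>) \<cdot> (\<epsilon> A \<otimes>\<^sub>a \<iota> ?A) \<cdot> \<Delta> A \<cdot> e"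
    using e by (simp add: comp_extend[OF l_nat])
  also have "\<dots> = \<l> ?B \<cdot> (\<epsilon> A \<otimes>\<^sub>a \<iota> ?B) \<cdot> \<beta> \<cdot> e"
    using e by (simp add: coaction_along_def merge)
  also have "\<dots> = \<l> ?B \<cdot> (\<iota> \<I> \<otimes>\<^sub>a \<eta> B) \<cdot> (\<epsilon> A \<otimes>\<^sub>a \<iota> \<I>) \<cdot> rinv ?A \<cdot> e"
    using e by (simp add: inv trivial_coaction_def merge)
  also have "\<dots> = \<eta> B \<cdot> \<r> \<I> \<cdot> (\<epsilon> A \<otimes>\<^sub>a \<iota> \<I>) \<cdot> rinv ?A \<cdot> e"
    using e by (simp add: comp_extend[OF l_nat] l_unit)
  also have "\<dots> = trivial_hom C A B \<cdot> e"
    using e by (simp add: comp_extend[OF r_nat] trivial_hom_def)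
  finally show ?thesis .
qed

text \<open>Costability identifies \<open>E \<otimes> E\<close> with the stabilized object of the tensor square of \<open>\<beta>\<close>.  This
  is what makes the comultiplication of \<open>A\<close> restrict to \<open>E\<close>, and it also gives the closure under
  multiplication; the antipode restricts by \<open>antipode_invariant\<close>.\<close>

lemma stabilized_hopf:
  assumes eq: "has_equalizers C" and st: "right_costable C"
    and E: "is_equalizer C \<beta> (trivial_coaction (Carrier A) B) E e"
  obtains S where "Carrier S = E" "is_hopf_monoid C S" "is_bicommutative C S"
    "bimonoid_hom C S A e" "mono_arrow C (e \<otimes>\<^sub>a e)"
proof -
  let ?A = "Carrier A" and ?B = "Carrier B" and ?t = "trivial_coaction (Carrier A) B"
  note e = equalizer_arrow(5-8)[OF E]
  have EO: "E \<in> Obj C" using e by auto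
  have e_cod: "Cod C e = ?A" using e by simp
  note s = e(1,2) e_cod EO
  have coact: "right_coaction C B \<beta> ?A" by (rule right_coaction_along[OF _ _ \<xi>]) simp_all
  have stab: "right_coaction_stabilized C B \<beta> ?A E e"
    using E by (simp add: right_coaction_stabilized_def trivial_coaction_def)
  have mono: "mono_arrow C e" by (rule equalizer_mono[OF E])
  note mono2 = ten_powers_mono[OF e(1,2) e_cod stabilized_ten_mono[OF eq st coact stab]]
  note EE = costable_equalizer[OF eq st coact stab coact stab]
  let ?f2 = "mid ?A ?B ?A ?B \<cdot> (\<beta> \<otimes>\<^sub>a \<beta>)"
    and ?g2 = "(\<iota> (?A \<otimes>\<^sub>o ?A) \<otimes>\<^sub>a ((\<eta> B \<otimes>\<^sub>a \<eta> B) \<cdot> linv \<I>)) \<cdot> rinv (?A \<otimes>\<^sub>o ?A)"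
  \<comment> \<open>This equation is all that closure under multiplication needs, since \<open>\<beta>\<close> is multiplicative.\<close>
  have ee: "?f2 \<cdot> (e \<otimes>\<^sub>a e) = ?g2 \<cdot> (e \<otimes>\<^sub>a e)" by (rule equalizer_arrow(8)[OF EE])

  have "\<beta> \<cdot> \<nabla> A \<cdot> (e \<otimes>\<^sub>a e) = ?t \<cdot> \<nabla> A \<cdot> (e \<otimes>\<^sub>a e)"
  proof -
    have "\<beta> \<cdot> \<nabla> A \<cdot> (e \<otimes>\<^sub>a e) = (\<nabla> A \<otimes>\<^sub>a \<nabla> B) \<cdot> (?f2 \<cdot> (e \<otimes>\<^sub>a e))"
      using s by (simp add: comp_extend[OF \<beta>_mult])
    also have "\<dots> = (\<nabla> A \<otimes>\<^sub>a (\<nabla> B \<cdot> (\<eta> B \<otimes>\<^sub>a \<eta> B) \<cdot> linv \<I>)) \<cdot> rinv (?A \<otimes>\<^sub>o ?A) \<cdot> (e \<otimes>\<^sub>a e)"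
      unfolding ee using s by (simp add: merge)
    also have "\<dots> = ?t \<cdot> \<nabla> A \<cdot> (e \<otimes>\<^sub>a e)"
      using s by (simp add: mult_unit_unit trivial_coaction_def comp_extend[OF rinv_nat] merge)
    finally show ?thesis .
  qed
  then obtain m where m: "m \<in> Arr C" "Dom C m = E \<otimes>\<^sub>o E" "Cod C m = E" "e \<cdot> m = \<nabla> A \<cdot> (e \<otimes>\<^sub>a e)"
    using equalizer_factor[OF E, of "\<nabla> A \<cdot> (e \<otimes>\<^sub>a e)"] s by auto

  have "\<beta> \<cdot> \<eta> A = ?t \<cdot> \<eta> A"
    by (simp add: coaction_along_def trivial_coaction_def comult_unit rinv_nat merge \<xi>_rewrite l_unit)
  then obtain u where u: "u \<in> Arr C" "Dom C u = \<I>" "Cod C u = E" "e \<cdot> u = \<eta> A"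
    using equalizer_factor[OF E, of "\<eta> A"] s by auto

  \<comment> \<open>By cocommutativity \<open>x\<^sub>1 \<otimes> x\<^sub>3 \<otimes> \<xi>(x\<^sub>2) \<otimes> \<xi>(x\<^sub>4) = x\<^sub>1 \<otimes> x\<^sub>2 \<otimes> \<xi>(x\<^sub>3) \<otimes> \<xi>(x\<^sub>4)\<close>, which depends
    on \<open>x\<close> only through \<open>\<beta>(x)\<close>.\<close>
  have "?f2 \<cdot> \<Delta> A \<cdot> e = ?g2 \<cdot> \<Delta> A \<cdot> e"
  proof -
    have "?f2 \<cdot> \<Delta> A \<cdot> e
        = mid ?A ?B ?A ?B \<cdot> ((\<iota> ?A \<otimes>\<^sub>a \<xi>) \<otimes>\<^sub>a (\<iota> ?A \<otimes>\<^sub>a \<xi>)) \<cdot> (\<Delta> A \<otimes>\<^sub>a \<Delta> A) \<cdot> \<Delta> A \<cdot> e"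
      using s by (simp add: coaction_along_def merge)
    also have "\<dots> = (\<iota> (?A \<otimes>\<^sub>o ?A) \<otimes>\<^sub>a (\<xi> \<otimes>\<^sub>a \<xi>)) \<cdot> (\<Delta> A \<otimes>\<^sub>a \<Delta> A) \<cdot> \<Delta> A \<cdot> e"
      using s A(2) by (simp add: comp_extend[OF mid_nat] comp_extend3[OF mid_comult])
    also have "\<dots> = (\<Delta> A \<otimes>\<^sub>a \<Delta> B) \<cdot> (\<beta> \<cdot> e)"
      using s by (simp add: coaction_along_def merge \<xi>_rewrite)
    also have "\<dots> = (\<Delta> A \<otimes>\<^sub>a ((\<eta> B \<otimes>\<^sub>a \<eta> B) \<cdot> linv \<I>)) \<cdot> rinv ?A \<cdot> e"
      unfolding e(4) using s by (simp add: trivial_coaction_def merge comult_unit)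
    also have "\<dots> = ?g2 \<cdot> \<Delta> A \<cdot> e"
      using s by (simp add: comp_extend[OF rinv_nat] merge)
    finally show ?thesis .
  qed
  then obtain d where d: "d \<in> Arr C" "Dom C d = E" "Cod C d = E \<otimes>\<^sub>o E" "(e \<otimes>\<^sub>a e) \<cdot> d = \<Delta> A \<cdot> e"
    using equalizer_factor[OF EE, of "\<Delta> A \<cdot> e"] s by auto

  define S where "S = \<lparr>Carrier = E, Mult = m, Unit = u, Comult = d, Counit = \<epsilon> A \<cdot> e\<rparr>"
  have S: "is_bimonoid C S" "bimonoid_hom C S A e" "is_bicommutative C S"
    using sub_bimonoid[OF _ mono mono2 e(2) e_cod m u d refl S_def] A by simp_all
  have sel: "Carrier S = E" "\<nabla> S = m" "\<eta> S = u" "\<Delta> S = d" "\<epsilon> S = \<epsilon> A \<cdot> e"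
    by (simp_all add: S_def)
  obtain SA where SA: "is_antipode C A SA" using A(1) by (auto simp: is_hopf_monoid_def)
  then have SA': "SA \<in> Arr C" "Dom C SA = ?A" "Cod C SA = ?A"
    "\<nabla> A \<cdot> (SA \<otimes>\<^sub>a \<iota> ?A) \<cdot> \<Delta> A = \<eta> A \<cdot> \<epsilon> A" "\<nabla> A \<cdot> (\<iota> ?A \<otimes>\<^sub>a SA) \<cdot> \<Delta> A = \<eta> A \<cdot> \<epsilon> A"
    by (simp_all add: is_antipode_def Hom_iff)
  have "\<beta> \<cdot> SA \<cdot> e = ?t \<cdot> SA \<cdot> e"
    using antipode_invariant[OF e(1,2) e_cod e(4) d _ _ _ SA] comult_assoc[OF S(1)]
      counit_comult_inv[OF S(1)]
    by (simp add: sel)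
  then obtain z where z: "z \<in> Arr C" "Dom C z = E" "Cod C z = E" "e \<cdot> z = SA \<cdot> e"
    using equalizer_factor[OF E, of "SA \<cdot> e"] s SA' by auto
  have "m \<cdot> (z \<otimes>\<^sub>a \<iota> E) \<cdot> d = u \<cdot> \<epsilon> A \<cdot> e"
  proof (rule mono_arrowD[OF mono])
    have "e \<cdot> m \<cdot> (z \<otimes>\<^sub>a \<iota> E) \<cdot> d = \<nabla> A \<cdot> (SA \<otimes>\<^sub>a \<iota> ?A) \<cdot> (e \<otimes>\<^sub>a e) \<cdot> d"
      using s m(1-3) z d(1-3) SA' by (simp add: comp_extend[OF m(4)] merge)
    also have "\<dots> = e \<cdot> u \<cdot> \<epsilon> A \<cdot> e"
      using s SA'(1-3) u d by (simp add: comp_extend3[OF SA'(4)] comp_extend[OF u(4)])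
    finally show "e \<cdot> m \<cdot> (z \<otimes>\<^sub>a \<iota> E) \<cdot> d = e \<cdot> u \<cdot> \<epsilon> A \<cdot> e" .
  qed (use s m z d u in simp_all)
  moreover have "m \<cdot> (\<iota> E \<otimes>\<^sub>a z) \<cdot> d = u \<cdot> \<epsilon> A \<cdot> e"
  proof (rule mono_arrowD[OF mono])
    have "e \<cdot> m \<cdot> (\<iota> E \<otimes>\<^sub>a z) \<cdot> d = \<nabla> A \<cdot> (\<iota> ?A \<otimes>\<^sub>a SA) \<cdot> (e \<otimes>\<^sub>a e) \<cdot> d"
      using s m(1-3) z d(1-3) SA' by (simp add: comp_extend[OF m(4)] merge)
    also have "\<dots> = e \<cdot> u \<cdot> \<epsilon> A \<cdot> e"
      using s SA'(1-3) u d by (simp add: comp_extend3[OF SA'(5)] comp_extend[OF u(4)])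
    finally show "e \<cdot> m \<cdot> (\<iota> E \<otimes>\<^sub>a z) \<cdot> d = e \<cdot> u \<cdot> \<epsilon> A \<cdot> e" .
  qed (use s m z d u in simp_all)
  ultimately have "is_antipode C S z"
    using z by (simp add: is_antipode_def sel Hom_iff)
  then have "is_hopf_monoid C S" using S(1) by (auto simp: is_hopf_monoid_def)
  then show thesis using that[of S] S sel mono2 by simp
qed

text \<open>The equalizer \<open>E\<close> formed in \<open>C\<close> is a bicommutative Hopf monoid on which \<open>\<xi>\<close> is trivial, so
  it maps to the kernel \<open>K\<close>; and \<open>k\<close> is invariant, so \<open>K\<close> maps to \<open>E\<close>.  The two maps are
  mutually inverse by the two universal properties.\<close>

lemma kernel_equalizer:
  assumes eq: "has_equalizers C" and st: "right_costable C" and K: "is_Ker C A B \<xi> K k"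
  shows "is_equalizer C \<beta> (trivial_coaction (Carrier A) B) (Carrier K) k"
proof -
  note K' = is_KerD[OF K]
  note k' = bimonoid_homD[OF K'(3)]
  have "parallel C \<beta> (trivial_coaction (Carrier A) B)"
    by (simp add: parallel_def)
  then obtain E e where E: "is_equalizer C \<beta> (trivial_coaction (Carrier A) B) E e"
    using eq unfolding has_equalizers_def by blast
  note e = equalizer_arrow(5-8)[OF E]
  obtain S where S: "Carrier S = E" "is_hopf_monoid C S" "is_bicommutative C S"
      "bimonoid_hom C S A e" "mono_arrow C (e \<otimes>\<^sub>a e)"
    using stabilized_hopf[OF eq st E] .
  have "\<xi> \<cdot> e = trivial_hom C A B \<cdot> e"
    using e by (intro trivial_if_invariant) simp_all
  then obtain u where u: "bimonoid_hom C S K u" "k \<cdot> u = e"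
    using K'(5)[OF S(2,3,4)] by blast
  note u' = bimonoid_homD[OF u(1)]
  have "\<beta> \<cdot> k = trivial_coaction (Carrier A) B \<cdot> k"
    using K' by (intro invariant_if_trivial) simp_all
  then obtain v where v: "v \<in> Arr C" "Dom C v = Carrier K" "Cod C v = E" "e \<cdot> v = k"
    using equalizer_factor[OF E, of k] k' by auto
  have v_hom: "bimonoid_hom C K S v"
    using factor_hom[OF _ _ S(4) equalizer_mono[OF E] S(5) K'(3)] S K' v by simp
  have "v \<cdot> u = \<iota> E"
  proof (rule mono_arrowD[OF equalizer_mono[OF E]])
    show "e \<cdot> v \<cdot> u = e \<cdot> \<iota> E"
      using comp_extend[OF v(4), of u] e v u u' S by simp
    show "\<iota> E \<in> Arr C" using S by auto
  qed (use e v u u' S in auto)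
  moreover have "u \<cdot> v = \<iota> (Carrier K)"
  proof -
    have "k \<cdot> u \<cdot> v = k"
      using comp_extend[OF u(2), of v] v u' k' S by simp
    moreover have "bimonoid_hom C K K (u \<cdot> v)"
      using K' S v_hom u(1) by (intro comp_hom[of K S K]) simp_all
    moreover have "bimonoid_hom C K K (\<iota> (Carrier K))" "k \<cdot> \<iota> (Carrier K) = k"
      using K' k' by (simp_all add: idn_hom)
    ultimately show ?thesis
      using K'(5)[OF K'(1-4)] by blast
  qed
  ultimately have "inverse_arrows C v u"
    using v u' S by (simp add: inverse_arrows_def Hom_iff)
  then show ?thesis
    using equalizer_iso[OF E, of v] v by (auto simp: iso_arrow_def)
qed

end

section \<open>Integrals of kernels and integrals along quotients\<close>

context symmetric_monoidal_category
begin

lemma bicommutativeD: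
  assumes "is_bicommutative C A"
  shows "\<nabla> A \<cdot> \<s> (Carrier A) (Carrier A) = \<nabla> A" "\<s> (Carrier A) (Carrier A) \<cdot> \<Delta> A = \<Delta> A"
  using assms by (simp_all add: is_bicommutative_def)

lemma normalized_integralD:
  assumes "is_hopf_monoid C K" "normalized_integral C K \<phi>"
  shows "\<phi> \<in> Arr C" "Dom C \<phi> = \<I>" "Cod C \<phi> = Carrier K" "\<epsilon> K \<cdot> \<phi> = \<iota> \<I>"
    "\<nabla> K \<cdot> (\<iota> (Carrier K) \<otimes>\<^sub>a \<phi>) \<cdot> rinv (Carrier K) = \<phi> \<cdot> \<epsilon> K"
proof -
  let ?K = "Carrier K"
  have K: "is_bimonoid C K" using assms by simp
  have \<phi>: "\<phi> \<in> Arr C" "Dom C \<phi> = \<I>" "Cod C \<phi> = ?K" "\<epsilon> K \<cdot> \<phi> = \<iota> \<I>"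
    and int: "\<nabla> K \<cdot> (\<iota> ?K \<otimes>\<^sub>a \<phi>) = \<l> ?K \<cdot> (\<epsilon> K \<otimes>\<^sub>a \<phi>)"
    using assms(2) by (simp_all add: normalized_integral_def integral_def Hom_iff)
  show "\<phi> \<in> Arr C" "Dom C \<phi> = \<I>" "Cod C \<phi> = ?K" "\<epsilon> K \<cdot> \<phi> = \<iota> \<I>" by (fact \<phi>)+
  have "\<nabla> K \<cdot> (\<iota> ?K \<otimes>\<^sub>a \<phi>) \<cdot> rinv ?K = \<l> ?K \<cdot> (\<iota> \<I> \<otimes>\<^sub>a \<phi>) \<cdot> (\<epsilon> K \<otimes>\<^sub>a \<iota> \<I>) \<cdot> rinv ?K"
    using K \<phi> by (simp add: comp_extend[OF int] merge)
  also have "\<dots> = \<phi> \<cdot> \<r> \<I> \<cdot> (\<epsilon> K \<otimes>\<^sub>a \<iota> \<I>) \<cdot> rinv ?K"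
    using K \<phi> by (simp add: comp_extend[OF l_nat] l_unit)
  also have "\<dots> = \<phi> \<cdot> \<epsilon> K"
    using K \<phi> by (simp add: comp_extend[OF r_nat])
  finally show "\<nabla> K \<cdot> (\<iota> ?K \<otimes>\<^sub>a \<phi>) \<cdot> rinv ?K = \<phi> \<cdot> \<epsilon> K" .
qed

text \<open>Multiplication by the image \<open>p\<close> of a normalized integral of \<open>K\<close> is constant on the orbits of
  \<open>K\<close>, hence factors through the quotient \<open>\<pi>\<close> of \<open>A\<close> by \<open>K\<close>; the factor is an integral along
  \<open>\<pi>\<close>, and it is a section of \<open>\<pi>\<close> because \<open>\<pi> p = 1\<close>.\<close>

lemma integral_along_quotient:
  assumes hopf: "is_hopf_monoid C K" "is_hopf_monoid C A" "is_hopf_monoid C I"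
    and k: "bimonoid_hom C K A k" and \<pi>: "bimonoid_hom C A I \<pi>"
    and \<pi>k: "\<pi> \<cdot> k = \<eta> I \<cdot> \<epsilon> K"
    and Q: "is_coequalizer C (\<nabla> A \<cdot> (\<iota> (Carrier A) \<otimes>\<^sub>a k))
      (\<r> (Carrier A) \<cdot> (\<iota> (Carrier A) \<otimes>\<^sub>a \<epsilon> K)) (Carrier I) \<pi>"
    and \<phi>: "normalized_integral C K \<phi>"
  obtains \<mu> where "left_integral_along C A I \<pi> \<mu>" "\<pi> \<cdot> \<mu> = \<iota> (Carrier I)"
proof -
  let ?A = "Carrier A" and ?K = "Carrier K" and ?I = "Carrier I"
  note k' = bimonoid_homD[OF k] and \<pi>' = bimonoid_homD[OF \<pi>]
  note \<phi>' = normalized_integralD[OF hopf(1) \<phi>]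
  note \<pi>_rw = \<pi>'(4-7) \<pi>'(4-7)[THEN comp_extend] and k_rw = k'(4-7) k'(4-7)[THEN comp_extend]
  define p where "p = k \<cdot> \<phi>"
  define m where "m = \<nabla> A \<cdot> (\<iota> ?A \<otimes>\<^sub>a p) \<cdot> rinv ?A"
  have p: "p \<in> Arr C" "Dom C p = \<I>" "Cod C p = ?A" using k' \<phi>' by (simp_all add: p_def)
  have m: "m \<in> Arr C" "Dom C m = ?A" "Cod C m = ?A" using p hopf by (simp_all add: m_def)
  note s = hopf k'(1-3) \<pi>'(1-3) \<phi>'(1-3) p m

  have orbit: "m \<cdot> \<nabla> A \<cdot> (\<iota> ?A \<otimes>\<^sub>a k) = m \<cdot> \<r> ?A \<cdot> (\<iota> ?A \<otimes>\<^sub>a \<epsilon> K)"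
  proof -
    have "m \<cdot> \<nabla> A \<cdot> (\<iota> ?A \<otimes>\<^sub>a k)
        = \<nabla> A \<cdot> (\<nabla> A \<otimes>\<^sub>a \<iota> ?A) \<cdot> ((\<iota> ?A \<otimes>\<^sub>a k) \<otimes>\<^sub>a p) \<cdot> rinv (?A \<otimes>\<^sub>o ?K)"
      using s by (simp add: m_def rinv_nat comp_extend[OF rinv_nat] merge)
    also have "\<dots> = \<nabla> A \<cdot> (\<iota> ?A \<otimes>\<^sub>a \<nabla> A) \<cdot> (\<iota> ?A \<otimes>\<^sub>a (k \<otimes>\<^sub>a p)) \<cdot> (\<iota> ?A \<otimes>\<^sub>a rinv ?K)"
      using s by (simp add: comp_extend[OF mult_assoc] comp_extend[OF assoc_nat] assoc_rinv_ten)
    also have "\<dots> = \<nabla> A \<cdot> (\<iota> ?A \<otimes>\<^sub>a (k \<cdot> \<nabla> K \<cdot> (\<iota> ?K \<otimes>\<^sub>a \<phi>) \<cdot> rinv ?K))"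
      using s by (simp add: merge k_rw p_def)
    also have "\<dots> = \<nabla> A \<cdot> (\<iota> ?A \<otimes>\<^sub>a p) \<cdot> (\<iota> ?A \<otimes>\<^sub>a \<epsilon> K)"
      unfolding \<phi>'(5) using s by (simp add: merge p_def)
    also have "\<dots> = m \<cdot> \<r> ?A \<cdot> (\<iota> ?A \<otimes>\<^sub>a \<epsilon> K)"
      using s by (simp add: m_def)
    finally show ?thesis .
  qed
  then obtain \<mu> where \<mu>: "\<mu> \<in> Arr C" "Dom C \<mu> = ?I" "Cod C \<mu> = ?A" "\<mu> \<cdot> \<pi> = m"
    using coequalizer_factor[OF Q, of m] s by auto
  note s = s \<mu>(1-3)
  have epi: "epi_arrow C \<pi>" by (rule coequalizer_epi[OF Q])
  have \<pi>p: "\<pi> \<cdot> p = \<eta> I"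
    using comp_extend[OF \<pi>k, of \<phi>] s by (simp add: p_def \<phi>'(4))
  have \<pi>m: "\<pi> \<cdot> m = \<pi>"
  proof -
    have "\<pi> \<cdot> m = \<nabla> I \<cdot> (\<iota> ?I \<otimes>\<^sub>a \<eta> I) \<cdot> (\<pi> \<otimes>\<^sub>a \<iota> \<I>) \<cdot> rinv ?A"
      using s by (simp add: m_def \<pi>_rw merge \<pi>p)
    then show ?thesis
      using s by (simp add: comp_extend[OF mult_unit_right] comp_extend[OF r_nat])
  qed
  have retract: "\<pi> \<cdot> \<mu> = \<iota> ?I"
    using s \<pi>m \<mu>(4) by - (rule epi_arrowD[OF epi], simp_all)

  have "\<nabla> A \<cdot> (\<iota> ?A \<otimes>\<^sub>a \<mu>) = \<mu> \<cdot> \<nabla> I \<cdot> (\<pi> \<otimes>\<^sub>a \<iota> ?I)"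
  proof (rule epi_arrowD[of "\<iota> ?A \<otimes>\<^sub>a \<pi>"])
    \<comment> \<open>Tensoring need not preserve epimorphisms, but it preserves split ones.\<close>
    show "epi_arrow C (\<iota> ?A \<otimes>\<^sub>a \<pi>)"
      using s retract by (intro split_epi[of _ "\<iota> ?A \<otimes>\<^sub>a \<mu>"]) (simp_all add: merge)
    have "(\<mu> \<cdot> \<nabla> I \<cdot> (\<pi> \<otimes>\<^sub>a \<iota> ?I)) \<cdot> (\<iota> ?A \<otimes>\<^sub>a \<pi>) = m \<cdot> \<nabla> A"
      using s by (simp add: merge \<pi>_rw flip: \<mu>(4))
    also have "\<dots> = \<nabla> A \<cdot> (\<nabla> A \<otimes>\<^sub>a \<iota> ?A) \<cdot> (\<iota> (?A \<otimes>\<^sub>o ?A) \<otimes>\<^sub>a p) \<cdot> rinv (?A \<otimes>\<^sub>o ?A)"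
      using s by (simp add: m_def rinv_nat merge)
    also have "\<dots> = \<nabla> A \<cdot> (\<iota> ?A \<otimes>\<^sub>a \<nabla> A) \<cdot> (\<iota> ?A \<otimes>\<^sub>a (\<iota> ?A \<otimes>\<^sub>a p)) \<cdot> (\<iota> ?A \<otimes>\<^sub>a rinv ?A)"
      using s by (simp add: comp_extend[OF mult_assoc] comp_extend[OF assoc_nat_idn] assoc_rinv_ten)
    also have "\<dots> = (\<nabla> A \<cdot> (\<iota> ?A \<otimes>\<^sub>a \<mu>)) \<cdot> (\<iota> ?A \<otimes>\<^sub>a \<pi>)"
      using s by (simp add: merge m_def \<mu>(4))
    finally show "(\<nabla> A \<cdot> (\<iota> ?A \<otimes>\<^sub>a \<mu>)) \<cdot> (\<iota> ?A \<otimes>\<^sub>a \<pi>)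
      = (\<mu> \<cdot> \<nabla> I \<cdot> (\<pi> \<otimes>\<^sub>a \<iota> ?I)) \<cdot> (\<iota> ?A \<otimes>\<^sub>a \<pi>)" by simp
  qed (use s in simp_all)
  moreover have "(\<iota> ?I \<otimes>\<^sub>a \<mu>) \<cdot> \<Delta> I = (\<pi> \<otimes>\<^sub>a \<iota> ?A) \<cdot> \<Delta> A \<cdot> \<mu>"
  proof (rule epi_arrowD[OF epi])
    \<comment> \<open>\<open>\<pi>(p\<^sub>1) \<otimes> p\<^sub>2 = 1 \<otimes> p\<close>, because \<open>p\<close> comes from \<open>K\<close>, where \<open>\<pi>\<close> is trivial\<close>
    have dp: "(\<pi> \<otimes>\<^sub>a \<iota> ?A) \<cdot> \<Delta> A \<cdot> p = (\<eta> I \<otimes>\<^sub>a p) \<cdot> linv \<I>"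
    proof -
      have "(\<pi> \<otimes>\<^sub>a \<iota> ?A) \<cdot> \<Delta> A \<cdot> p = (\<eta> I \<otimes>\<^sub>a k) \<cdot> ((\<epsilon> K \<otimes>\<^sub>a \<iota> ?K) \<cdot> \<Delta> K) \<cdot> \<phi>"
        using s by (simp add: p_def k_rw merge \<pi>k)
      also have "\<dots> = (\<eta> I \<otimes>\<^sub>a k) \<cdot> linv ?K \<cdot> \<phi>"
        using s by (simp only: counit_comult_inv hopf_bimonoid)
      also have "\<dots> = (\<eta> I \<otimes>\<^sub>a p) \<cdot> linv \<I>"
        using s by (simp add: linv_nat merge p_def)
      finally show ?thesis .
    qed
    have "((\<pi> \<otimes>\<^sub>a \<iota> ?A) \<cdot> \<Delta> A \<cdot> \<mu>) \<cdot> \<pi> = (\<pi> \<otimes>\<^sub>a \<iota> ?A) \<cdot> \<Delta> A \<cdot> m"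
      using s \<mu>(4) by simp
    also have "\<dots> = (\<pi> \<otimes>\<^sub>a \<iota> ?A) \<cdot> (\<nabla> A \<otimes>\<^sub>a \<nabla> A) \<cdot> mid ?A ?A ?A ?A \<cdot> (\<Delta> A \<otimes>\<^sub>a (\<Delta> A \<cdot> p)) \<cdot> rinv ?A"
      using s by (simp add: m_def comp_extend[OF comult_mult] merge)
    also have "\<dots> = (\<nabla> I \<otimes>\<^sub>a \<nabla> A) \<cdot> ((\<pi> \<otimes>\<^sub>a \<pi>) \<otimes>\<^sub>a (\<iota> ?A \<otimes>\<^sub>a \<iota> ?A)) \<cdot> mid ?A ?A ?A ?A
        \<cdot> (\<Delta> A \<otimes>\<^sub>a (\<Delta> A \<cdot> p)) \<cdot> rinv ?A"
      using s by (simp add: merge \<pi>_rw)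
    also have "\<dots> = (\<nabla> I \<otimes>\<^sub>a \<nabla> A) \<cdot> mid ?I ?A ?I ?A
        \<cdot> ((\<pi> \<otimes>\<^sub>a \<iota> ?A) \<otimes>\<^sub>a (\<pi> \<otimes>\<^sub>a \<iota> ?A)) \<cdot> (\<Delta> A \<otimes>\<^sub>a (\<Delta> A \<cdot> p)) \<cdot> rinv ?A"
      using s comp_extend[OF mid_nat[of \<pi> "\<iota> ?A" \<pi> "\<iota> ?A" ?I ?A ?I ?A],
          of "(\<Delta> A \<otimes>\<^sub>a (\<Delta> A \<cdot> p)) \<cdot> rinv ?A"] by simp
    also have "\<dots> = (\<nabla> I \<otimes>\<^sub>a \<nabla> A) \<cdot> mid ?I ?A ?I ?A
        \<cdot> (((\<pi> \<otimes>\<^sub>a \<iota> ?A) \<cdot> \<Delta> A) \<otimes>\<^sub>a ((\<pi> \<otimes>\<^sub>a \<iota> ?A) \<cdot> \<Delta> A \<cdot> p)) \<cdot> rinv ?A"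
      using s by (simp add: merge)
    also have "\<dots> = (\<nabla> I \<otimes>\<^sub>a \<nabla> A) \<cdot> mid ?I ?A ?I ?A
        \<cdot> ((\<iota> ?I \<otimes>\<^sub>a \<iota> ?A) \<otimes>\<^sub>a (\<eta> I \<otimes>\<^sub>a p)) \<cdot> (((\<pi> \<otimes>\<^sub>a \<iota> ?A) \<cdot> \<Delta> A) \<otimes>\<^sub>a linv \<I>) \<cdot> rinv ?A"
      unfolding dp using s by (simp add: merge)
    also have "\<dots> = (\<nabla> I \<otimes>\<^sub>a \<nabla> A) \<cdot> ((\<iota> ?I \<otimes>\<^sub>a \<eta> I) \<otimes>\<^sub>a (\<iota> ?A \<otimes>\<^sub>a p)) \<cdot> mid ?I ?A \<I> \<I>
        \<cdot> (((\<pi> \<otimes>\<^sub>a \<iota> ?A) \<cdot> \<Delta> A) \<otimes>\<^sub>a linv \<I>) \<cdot> rinv ?A"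
      using s comp_extend[OF mid_nat[of "\<iota> ?I" "\<iota> ?A" "\<eta> I" p ?I ?A ?I ?A],
          of "(((\<pi> \<otimes>\<^sub>a \<iota> ?A) \<cdot> \<Delta> A) \<otimes>\<^sub>a linv \<I>) \<cdot> rinv ?A"] by simp
    also have "\<dots> = (\<nabla> I \<otimes>\<^sub>a \<nabla> A) \<cdot> ((\<iota> ?I \<otimes>\<^sub>a \<eta> I) \<otimes>\<^sub>a (\<iota> ?A \<otimes>\<^sub>a p)) \<cdot> (mid ?I ?A \<I> \<I>
        \<cdot> (\<iota> (?I \<otimes>\<^sub>o ?A) \<otimes>\<^sub>a linv \<I>) \<cdot> rinv (?I \<otimes>\<^sub>o ?A)) \<cdot> (\<pi> \<otimes>\<^sub>a \<iota> ?A) \<cdot> \<Delta> A"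
      using s by (simp add: rinv_nat comp_extend[OF rinv_nat] merge)
    also have "\<dots> = (\<nabla> I \<otimes>\<^sub>a \<nabla> A) \<cdot> ((\<iota> ?I \<otimes>\<^sub>a \<eta> I) \<otimes>\<^sub>a (\<iota> ?A \<otimes>\<^sub>a p)) \<cdot> (rinv ?I \<otimes>\<^sub>a rinv ?A)
        \<cdot> (\<pi> \<otimes>\<^sub>a \<iota> ?A) \<cdot> \<Delta> A"
      using s by (simp only: mid_unit_second_pair bimonoid_simps hopf_bimonoid)
    also have "\<dots> = (\<iota> ?I \<otimes>\<^sub>a m) \<cdot> (\<pi> \<otimes>\<^sub>a \<iota> ?A) \<cdot> \<Delta> A"
      using s by (simp add: merge m_def comp_extend[OF mult_unit_right])
    also have "\<dots> = ((\<iota> ?I \<otimes>\<^sub>a \<mu>) \<cdot> \<Delta> I) \<cdot> \<pi>"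
      using s by (simp add: merge \<pi>_rw \<mu>(4))
    finally show "((\<iota> ?I \<otimes>\<^sub>a \<mu>) \<cdot> \<Delta> I) \<cdot> \<pi> = ((\<pi> \<otimes>\<^sub>a \<iota> ?A) \<cdot> \<Delta> A \<cdot> \<mu>) \<cdot> \<pi>" by simp
  qed (use s in simp_all)
  ultimately have "left_integral_along C A I \<pi> \<mu>"
    using s by (simp add: left_integral_along_def Hom_iff)
  with that retract show thesis by blast
qed

lemma left_integral_along_comp:
  assumes bim: "is_bimonoid C X" "is_bimonoid C Y" "is_bimonoid C Z"
    and f: "bimonoid_hom C X Y f" and g: "bimonoid_hom C Y Z g"
    and \<mu>: "left_integral_along C X Y f \<mu>" and \<nu>: "left_integral_along C Y Z g \<nu>"
  shows "left_integral_along C X Z (g \<cdot> f) (\<mu> \<cdot> \<nu>)"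
proof -
  let ?X = "Carrier X" and ?Y = "Carrier Y" and ?Z = "Carrier Z"
  note f' = bimonoid_homD[OF f] and g' = bimonoid_homD[OF g]
  have \<mu>': "\<mu> \<in> Arr C" "Dom C \<mu> = ?Y" "Cod C \<mu> = ?X"
    "\<nabla> X \<cdot> (\<iota> ?X \<otimes>\<^sub>a \<mu>) = \<mu> \<cdot> \<nabla> Y \<cdot> (f \<otimes>\<^sub>a \<iota> ?Y)"
    "(\<iota> ?Y \<otimes>\<^sub>a \<mu>) \<cdot> \<Delta> Y = (f \<otimes>\<^sub>a \<iota> ?X) \<cdot> \<Delta> X \<cdot> \<mu>"
    using \<mu> by (simp_all add: left_integral_along_def Hom_iff)
  have \<nu>': "\<nu> \<in> Arr C" "Dom C \<nu> = ?Z" "Cod C \<nu> = ?Y"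
    "\<nabla> Y \<cdot> (\<iota> ?Y \<otimes>\<^sub>a \<nu>) = \<nu> \<cdot> \<nabla> Z \<cdot> (g \<otimes>\<^sub>a \<iota> ?Z)"
    "(\<iota> ?Z \<otimes>\<^sub>a \<nu>) \<cdot> \<Delta> Z = (g \<otimes>\<^sub>a \<iota> ?Y) \<cdot> \<Delta> Y \<cdot> \<nu>"
    using \<nu> by (simp_all add: left_integral_along_def Hom_iff)
  note s = bim f'(1-3) g'(1-3) \<mu>'(1-3) \<nu>'(1-3)
  have "\<nabla> X \<cdot> (\<iota> ?X \<otimes>\<^sub>a (\<mu> \<cdot> \<nu>)) = (\<nabla> X \<cdot> (\<iota> ?X \<otimes>\<^sub>a \<mu>)) \<cdot> (\<iota> ?X \<otimes>\<^sub>a \<nu>)"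
    using s by (simp add: merge)
  also have "\<dots> = \<mu> \<cdot> (\<nabla> Y \<cdot> (\<iota> ?Y \<otimes>\<^sub>a \<nu>)) \<cdot> (f \<otimes>\<^sub>a \<iota> ?Z)"
    unfolding \<mu>'(4) using s by (simp add: merge)
  also have "\<dots> = (\<mu> \<cdot> \<nu>) \<cdot> \<nabla> Z \<cdot> ((g \<cdot> f) \<otimes>\<^sub>a \<iota> ?Z)"
    unfolding \<nu>'(4) using s by (simp add: merge)
  finally have 1: "\<nabla> X \<cdot> (\<iota> ?X \<otimes>\<^sub>a (\<mu> \<cdot> \<nu>)) = (\<mu> \<cdot> \<nu>) \<cdot> \<nabla> Z \<cdot> ((g \<cdot> f) \<otimes>\<^sub>a \<iota> ?Z)" .
  have "(\<iota> ?Z \<otimes>\<^sub>a (\<mu> \<cdot> \<nu>)) \<cdot> \<Delta> Z = (\<iota> ?Z \<otimes>\<^sub>a \<mu>) \<cdot> ((\<iota> ?Z \<otimes>\<^sub>a \<nu>) \<cdot> \<Delta> Z)"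
    using s by (simp add: merge)
  also have "\<dots> = (g \<otimes>\<^sub>a \<iota> ?X) \<cdot> ((\<iota> ?Y \<otimes>\<^sub>a \<mu>) \<cdot> \<Delta> Y) \<cdot> \<nu>"
    unfolding \<nu>'(5) using s by (simp add: merge)
  also have "\<dots> = ((g \<cdot> f) \<otimes>\<^sub>a \<iota> ?X) \<cdot> \<Delta> X \<cdot> \<mu> \<cdot> \<nu>"
    unfolding \<mu>'(5) using s by (simp add: merge)
  finally show ?thesis
    using 1 s by (simp add: left_integral_along_def Hom_iff)
qed

end

context bicommutative_hopf_hom
begin

lemma left_integral_alongD:
  assumes "left_integral_along C A B \<xi> \<mu>"
  shows "\<mu> \<in> Arr C" "Dom C \<mu> = Carrier B" "Cod C \<mu> = Carrier A"
    "\<nabla> A \<cdot> (\<iota> (Carrier A) \<otimes>\<^sub>a \<mu>) = \<mu> \<cdot> \<nabla> B \<cdot> (\<xi> \<otimes>\<^sub>a \<iota> (Carrier B))"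
    "(\<iota> (Carrier B) \<otimes>\<^sub>a \<mu>) \<cdot> \<Delta> B = (\<xi> \<otimes>\<^sub>a \<iota> (Carrier A)) \<cdot> \<Delta> A \<cdot> \<mu>"
  using assms by (simp_all add: left_integral_along_def Hom_iff)

lemma right_integral_alongD:
  assumes "right_integral_along C A B \<xi> \<mu>"
  shows "\<mu> \<in> Arr C" "Dom C \<mu> = Carrier B" "Cod C \<mu> = Carrier A"
    "\<nabla> A \<cdot> (\<mu> \<otimes>\<^sub>a \<iota> (Carrier A)) = \<mu> \<cdot> \<nabla> B \<cdot> (\<iota> (Carrier B) \<otimes>\<^sub>a \<xi>)"
    "(\<mu> \<otimes>\<^sub>a \<iota> (Carrier B)) \<cdot> \<Delta> B = (\<iota> (Carrier A) \<otimes>\<^sub>a \<xi>) \<cdot> \<Delta> A \<cdot> \<mu>"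
  using assms by (simp_all add: right_integral_along_def Hom_iff)

text \<open>Commutativity exchanges the two linearity conditions and cocommutativity the two
  colinearity conditions, through the naturality of the symmetry.\<close>

lemma right_integral_iff_left:
  "right_integral_along C A B \<xi> \<mu> \<longleftrightarrow> left_integral_along C A B \<xi> \<mu>"
proof
  let ?A = "Carrier A" and ?B = "Carrier B"
  note bc = bicommutativeD[OF A(2)] bicommutativeD[OF B(2)]
  {
    assume "right_integral_along C A B \<xi> \<mu>"
    note \<mu> = right_integral_alongD[OF this]
    have "\<nabla> A \<cdot> (\<iota> ?A \<otimes>\<^sub>a \<mu>) = (\<nabla> A \<cdot> \<s> ?A ?A) \<cdot> (\<iota> ?A \<otimes>\<^sub>a \<mu>)" unfolding bc ..
    also have "\<dots> = (\<nabla> A \<cdot> (\<mu> \<otimes>\<^sub>a \<iota> ?A)) \<cdot> \<s> ?A ?B"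
      using \<mu>(1-3) by (simp add: s_nat)
    also have "\<dots> = \<mu> \<cdot> (\<nabla> B \<cdot> \<s> ?B ?B) \<cdot> (\<xi> \<otimes>\<^sub>a \<iota> ?B)"
      unfolding \<mu>(4) using \<mu>(1-3) by (simp add: s_nat)
    finally have 1: "\<nabla> A \<cdot> (\<iota> ?A \<otimes>\<^sub>a \<mu>) = \<mu> \<cdot> \<nabla> B \<cdot> (\<xi> \<otimes>\<^sub>a \<iota> ?B)" unfolding bc .
    have "(\<iota> ?B \<otimes>\<^sub>a \<mu>) \<cdot> \<Delta> B = (\<iota> ?B \<otimes>\<^sub>a \<mu>) \<cdot> \<s> ?B ?B \<cdot> \<Delta> B" unfolding bc ..
    also have "\<dots> = \<s> ?A ?B \<cdot> ((\<mu> \<otimes>\<^sub>a \<iota> ?B) \<cdot> \<Delta> B)"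
      using \<mu>(1-3) by (simp add: comp_extend[OF s_nat])
    also have "\<dots> = (\<xi> \<otimes>\<^sub>a \<iota> ?A) \<cdot> (\<s> ?A ?A \<cdot> \<Delta> A) \<cdot> \<mu>"
      unfolding \<mu>(5) using \<mu>(1-3) by (simp add: comp_extend[OF s_nat])
    finally show "left_integral_along C A B \<xi> \<mu>"
      using 1 \<mu>(1-3) unfolding bc by (simp add: left_integral_along_def Hom_iff)
  next
    assume "left_integral_along C A B \<xi> \<mu>"
    note \<mu> = left_integral_alongD[OF this]
    have "\<nabla> A \<cdot> (\<mu> \<otimes>\<^sub>a \<iota> ?A) = (\<nabla> A \<cdot> \<s> ?A ?A) \<cdot> (\<mu> \<otimes>\<^sub>a \<iota> ?A)" unfolding bc ..
    also have "\<dots> = (\<nabla> A \<cdot> (\<iota> ?A \<otimes>\<^sub>a \<mu>)) \<cdot> \<s> ?B ?A"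
      using \<mu>(1-3) by (simp add: s_nat)
    also have "\<dots> = \<mu> \<cdot> (\<nabla> B \<cdot> \<s> ?B ?B) \<cdot> (\<iota> ?B \<otimes>\<^sub>a \<xi>)"
      unfolding \<mu>(4) using \<mu>(1-3) by (simp add: s_nat)
    finally have 1: "\<nabla> A \<cdot> (\<mu> \<otimes>\<^sub>a \<iota> ?A) = \<mu> \<cdot> \<nabla> B \<cdot> (\<iota> ?B \<otimes>\<^sub>a \<xi>)" unfolding bc .
    have "(\<mu> \<otimes>\<^sub>a \<iota> ?B) \<cdot> \<Delta> B = (\<mu> \<otimes>\<^sub>a \<iota> ?B) \<cdot> \<s> ?B ?B \<cdot> \<Delta> B" unfolding bc ..
    also have "\<dots> = \<s> ?B ?A \<cdot> ((\<iota> ?B \<otimes>\<^sub>a \<mu>) \<cdot> \<Delta> B)"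
      using \<mu>(1-3) by (simp add: comp_extend[OF s_nat])
    also have "\<dots> = (\<iota> ?A \<otimes>\<^sub>a \<xi>) \<cdot> (\<s> ?A ?A \<cdot> \<Delta> A) \<cdot> \<mu>"
      unfolding \<mu>(5) using \<mu>(1-3) by (simp add: comp_extend[OF s_nat])
    finally show "right_integral_along C A B \<xi> \<mu>"
      using 1 \<mu>(1-3) unfolding bc by (simp add: right_integral_along_def Hom_iff)
  }
qed

text \<open>Evaluate \<open>\<xi> \<mu> \<xi> = \<xi>\<close> at the unit, which \<open>\<xi>\<close> preserves.\<close>

lemma normalized_unit:
  assumes "\<mu> \<in> Arr C" "Dom C \<mu> = Carrier B" "Cod C \<mu> = Carrier A" "normalized_along C \<xi> \<mu>"
  shows "\<xi> \<cdot> \<mu> \<cdot> \<eta> B = \<eta> B"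
proof -
  have "\<xi> \<cdot> \<mu> \<cdot> \<eta> B = (\<xi> \<cdot> \<mu> \<cdot> \<xi>) \<cdot> \<eta> A"
    using assms(1-3) by (simp add: \<xi>_rewrite)
  also have "\<dots> = \<eta> B"
    using assms(4) by (simp add: normalized_along_def \<xi>_rewrite)
  finally show ?thesis .
qed

text \<open>Write \<open>p = \<mu>(1)\<close>.  Computing \<open>p \<mu>'(b)\<close> with the linearity of \<open>\<mu>\<close> gives \<open>\<mu>(\<xi>(\<mu>'(b)))\<close>;
  computing it with the linearity of \<open>\<mu>'\<close> gives \<open>\<mu>'(\<xi>(p) b) = \<mu>'(b)\<close>, since \<open>\<xi>(p) = 1\<close> when
  \<open>\<mu>\<close> is normalized.\<close>

lemma normalized_integral_absorbs:
  assumes \<mu>: "right_integral_along C A B \<xi> \<mu>" "normalized_along C \<xi> \<mu>"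
    and \<mu>': "left_integral_along C A B \<xi> \<mu>'"
  shows "\<mu> \<cdot> \<xi> \<cdot> \<mu>' = \<mu>'"
proof -
  let ?A = "Carrier A" and ?B = "Carrier B"
  note m = right_integral_alongD[OF \<mu>(1)] and m' = left_integral_alongD[OF \<mu>']
  note s = m(1-3) m'(1-3)
  have "\<mu> \<cdot> \<xi> \<cdot> \<mu>' \<cdot> \<l> ?B = \<mu> \<cdot> \<nabla> B \<cdot> (\<eta> B \<otimes>\<^sub>a \<iota> ?B) \<cdot> (\<iota> \<I> \<otimes>\<^sub>a (\<xi> \<cdot> \<mu>'))"
    using s by (simp add: comp_extend[OF mult_unit_left] l_nat)
  also have "\<dots> = (\<mu> \<cdot> \<nabla> B \<cdot> (\<iota> ?B \<otimes>\<^sub>a \<xi>)) \<cdot> (\<eta> B \<otimes>\<^sub>a \<mu>')"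
    using s by (simp add: merge)
  also have "\<dots> = (\<nabla> A \<cdot> (\<iota> ?A \<otimes>\<^sub>a \<mu>')) \<cdot> ((\<mu> \<cdot> \<eta> B) \<otimes>\<^sub>a \<iota> ?B)"
    unfolding m(4)[symmetric] using s by (simp add: merge)
  also have "\<dots> = \<mu>' \<cdot> \<nabla> B \<cdot> ((\<xi> \<cdot> \<mu> \<cdot> \<eta> B) \<otimes>\<^sub>a \<iota> ?B)"
    unfolding m'(4) using s by (simp add: merge)
  also have "\<dots> = \<mu>' \<cdot> \<l> ?B"
    using s by (simp add: normalized_unit[OF m(1-3) \<mu>(2)] mult_unit_left)
  finally show ?thesis
    using s by - (rule iso_epi_cancel[of "\<l> ?B"], simp_all)
qed

text \<open>A normalized integral \<open>\<mu>\<close> along \<open>\<xi>\<close> sends \<open>1\<close> to an element on which \<open>B\<close> coacts trivially,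
  that is, to an element of the kernel, and the linearity of \<open>\<mu>\<close> makes it an integral there.\<close>

lemma kernel_normalized_integral:
  assumes K: "is_hopf_monoid C K" and k: "bimonoid_hom C K A k"
    and E: "is_equalizer C \<beta> (trivial_coaction (Carrier A) B) (Carrier K) k"
    and \<mu>: "right_integral_along C A B \<xi> \<mu>" "left_integral_along C A B \<xi> \<mu>" "normalized_along C \<xi> \<mu>"
  obtains \<phi> where "normalized_integral C K \<phi>"
proof -
  let ?A = "Carrier A" and ?B = "Carrier B" and ?K = "Carrier K"
  note k' = bimonoid_homD[OF k]
  note r = right_integral_alongD[OF \<mu>(1)] and l = left_integral_alongD[OF \<mu>(2)]
  note \<mu>' = r(1-3)
  have mono: "mono_arrow C k" by (rule equalizer_mono[OF E])
  have "\<beta> \<cdot> \<mu> \<cdot> \<eta> B = ((\<mu> \<otimes>\<^sub>a \<iota> ?B) \<cdot> \<Delta> B) \<cdot> \<eta> B"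
    unfolding r(5) using \<mu>' by (simp add: coaction_along_def)
  also have "\<dots> = trivial_coaction ?A B \<cdot> \<mu> \<cdot> \<eta> B"
    using \<mu>' by (simp add: trivial_coaction_def comult_unit rinv_nat comp_extend[OF rinv_nat] merge l_unit)
  finally obtain \<phi> where \<phi>: "\<phi> \<in> Arr C" "Dom C \<phi> = \<I>" "Cod C \<phi> = ?K" "k \<cdot> \<phi> = \<mu> \<cdot> \<eta> B"
    using equalizer_factor[OF E, of "\<mu> \<cdot> \<eta> B"] \<mu>' by auto
  note s = K k'(1-3) \<mu>' \<phi>(1-3)
  have \<xi>k: "\<xi> \<cdot> k = \<eta> B \<cdot> \<epsilon> K"
    using trivial_if_invariant[of k] equalizer_arrow(8)[OF E] k' by (simp add: trivial_hom_def)
  have kk: "k \<cdot> \<nabla> K \<cdot> x = \<nabla> A \<cdot> (k \<otimes>\<^sub>a k) \<cdot> x" if "x \<in> Arr C" "Cod C x = ?K \<otimes>\<^sub>o ?K" for x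
    using s that by (simp add: comp_extend[OF k'(4)])
  have "\<nabla> K \<cdot> (\<phi> \<otimes>\<^sub>a \<iota> ?K) = \<r> ?K \<cdot> (\<phi> \<otimes>\<^sub>a \<epsilon> K)"
  proof (rule mono_arrowD[OF mono])
    have "k \<cdot> \<nabla> K \<cdot> (\<phi> \<otimes>\<^sub>a \<iota> ?K) = (\<nabla> A \<cdot> (\<mu> \<otimes>\<^sub>a \<iota> ?A)) \<cdot> (\<eta> B \<otimes>\<^sub>a k)"
      using s by (simp add: kk merge \<phi>(4))
    also have "\<dots> = \<mu> \<cdot> \<nabla> B \<cdot> (\<iota> ?B \<otimes>\<^sub>a \<eta> B) \<cdot> (\<eta> B \<otimes>\<^sub>a \<epsilon> K)"
      unfolding r(4) using s by (simp add: merge \<xi>k)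
    also have "\<dots> = \<mu> \<cdot> \<r> ?B \<cdot> (\<eta> B \<otimes>\<^sub>a \<epsilon> K)"
      using s by (simp add: comp_extend[OF mult_unit_right])
    also have "\<dots> = \<mu> \<cdot> \<r> ?B \<cdot> (\<eta> B \<otimes>\<^sub>a \<iota> \<I>) \<cdot> (\<iota> \<I> \<otimes>\<^sub>a \<epsilon> K)"
      using s by (simp add: merge)
    also have "\<dots> = (\<mu> \<cdot> \<eta> B) \<cdot> \<r> \<I> \<cdot> (\<iota> \<I> \<otimes>\<^sub>a \<epsilon> K)"
      using s by (simp add: comp_extend[OF r_nat])
    also have "\<dots> = k \<cdot> \<r> ?K \<cdot> (\<phi> \<otimes>\<^sub>a \<iota> \<I>) \<cdot> (\<iota> \<I> \<otimes>\<^sub>a \<epsilon> K)"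
      unfolding \<phi>(4)[symmetric] using s by (simp add: comp_extend[OF r_nat])
    also have "\<dots> = k \<cdot> \<r> ?K \<cdot> (\<phi> \<otimes>\<^sub>a \<epsilon> K)"
      using s by (simp add: merge)
    finally show "k \<cdot> \<nabla> K \<cdot> (\<phi> \<otimes>\<^sub>a \<iota> ?K) = k \<cdot> \<r> ?K \<cdot> (\<phi> \<otimes>\<^sub>a \<epsilon> K)" .
  qed (use s in simp_all)
  moreover have "\<nabla> K \<cdot> (\<iota> ?K \<otimes>\<^sub>a \<phi>) = \<l> ?K \<cdot> (\<epsilon> K \<otimes>\<^sub>a \<phi>)"
  proof (rule mono_arrowD[OF mono])
    have "k \<cdot> \<nabla> K \<cdot> (\<iota> ?K \<otimes>\<^sub>a \<phi>) = (\<nabla> A \<cdot> (\<iota> ?A \<otimes>\<^sub>a \<mu>)) \<cdot> (k \<otimes>\<^sub>a \<eta> B)"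
      using s by (simp add: kk merge \<phi>(4))
    also have "\<dots> = \<mu> \<cdot> \<nabla> B \<cdot> (\<eta> B \<otimes>\<^sub>a \<iota> ?B) \<cdot> (\<epsilon> K \<otimes>\<^sub>a \<eta> B)"
      unfolding l(4) using s by (simp add: merge \<xi>k)
    also have "\<dots> = \<mu> \<cdot> \<l> ?B \<cdot> (\<epsilon> K \<otimes>\<^sub>a \<eta> B)"
      using s by (simp add: comp_extend[OF mult_unit_left])
    also have "\<dots> = \<mu> \<cdot> \<l> ?B \<cdot> (\<iota> \<I> \<otimes>\<^sub>a \<eta> B) \<cdot> (\<epsilon> K \<otimes>\<^sub>a \<iota> \<I>)"
      using s by (simp add: merge)
    also have "\<dots> = (\<mu> \<cdot> \<eta> B) \<cdot> \<l> \<I> \<cdot> (\<epsilon> K \<otimes>\<^sub>a \<iota> \<I>)"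
      using s by (simp add: comp_extend[OF l_nat])
    also have "\<dots> = k \<cdot> \<l> ?K \<cdot> (\<iota> \<I> \<otimes>\<^sub>a \<phi>) \<cdot> (\<epsilon> K \<otimes>\<^sub>a \<iota> \<I>)"
      unfolding \<phi>(4)[symmetric] using s by (simp add: comp_extend[OF l_nat])
    also have "\<dots> = k \<cdot> \<l> ?K \<cdot> (\<epsilon> K \<otimes>\<^sub>a \<phi>)"
      using s by (simp add: merge)
    finally show "k \<cdot> \<nabla> K \<cdot> (\<iota> ?K \<otimes>\<^sub>a \<phi>) = k \<cdot> \<l> ?K \<cdot> (\<epsilon> K \<otimes>\<^sub>a \<phi>)" .
  qed (use s in simp_all)
  moreover have "\<epsilon> K \<cdot> \<phi> = \<iota> \<I>"
  proof -
    have "\<epsilon> K \<cdot> \<phi> = \<epsilon> A \<cdot> k \<cdot> \<phi>" using s by (simp add: comp_extend[OF k'(7)])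
    also have "\<dots> = \<epsilon> B \<cdot> \<xi> \<cdot> \<mu> \<cdot> \<eta> B" using s by (simp add: \<phi>(4) \<xi>_rewrite)
    also have "\<dots> = \<iota> \<I>" by (simp add: normalized_unit[OF \<mu>' \<mu>(3)] counit_unit)
    finally show ?thesis .
  qed
  ultimately show thesis
    using that[of \<phi>] s by (simp add: normalized_integral_def integral_def Hom_iff)
qed

end

section \<open>Duality\<close>

text \<open>The coherence isomorphisms have to be inverted, because those of \<open>C\<close> point the wrong way in
  the opposite category; the inverse of \<open>\<s> X Y\<close> is \<open>\<s> Y X\<close>.\<close>

definition op_smc :: "('o, 'm) smc \<Rightarrow> ('o, 'm) smc" where
  "op_smc C = \<lparr>Obj = Obj C, Arr = Arr C, Dom = Cod C, Cod = Dom C, Idn = Idn C,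
     Comp = (\<lambda>g f. Comp C f g), TenO = TenO C, TenA = TenA C, UnitO = UnitO C,
     Assoc = (\<lambda>X Y Z. inv_arrow C (Assoc C X Y Z)),
     LUnit = (\<lambda>X. inv_arrow C (LUnit C X)), RUnit = (\<lambda>X. inv_arrow C (RUnit C X)),
     Braid = (\<lambda>X Y. Braid C Y X)\<rparr>"

definition op_bimonoid :: "('o, 'm) bimonoid \<Rightarrow> ('o, 'm) bimonoid" where
  "op_bimonoid A = \<lparr>Carrier = Carrier A, Mult = \<Delta> A, Unit = \<epsilon> A, Comult = \<nabla> A, Counit = \<eta> A\<rparr>"

lemma op_smc_simps [simp]:
  "Obj (op_smc C) = Obj C" "Arr (op_smc C) = Arr C" "Dom (op_smc C) = Cod C" "Cod (op_smc C) = Dom C"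
  "Idn (op_smc C) = Idn C" "Comp (op_smc C) g f = Comp C f g" "TenO (op_smc C) = TenO C"
  "TenA (op_smc C) = TenA C" "UnitO (op_smc C) = UnitO C"
  "Assoc (op_smc C) X Y Z = inv_arrow C (Assoc C X Y Z)"
  "LUnit (op_smc C) X = inv_arrow C (LUnit C X)" "RUnit (op_smc C) X = inv_arrow C (RUnit C X)"
  "Braid (op_smc C) X Y = Braid C Y X"
  by (simp_all add: op_smc_def)

lemma op_bimonoid_simps [simp]:
  "Carrier (op_bimonoid A) = Carrier A" "\<nabla> (op_bimonoid A) = \<Delta> A" "\<eta> (op_bimonoid A) = \<epsilon> A"
  "\<Delta> (op_bimonoid A) = \<nabla> A" "\<epsilon> (op_bimonoid A) = \<eta> A" "op_bimonoid (op_bimonoid A) = A"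
  by (simp_all add: op_bimonoid_def)

lemma op_Hom [simp]: "Hom (op_smc C) X Y = Hom C Y X"
  by (auto simp: Hom_def)

lemma op_inverse_arrows: "inverse_arrows (op_smc C) f g \<longleftrightarrow> inverse_arrows C f g"
  by (auto simp: inverse_arrows_def)

lemma op_iso [simp]: "iso_arrow (op_smc C) f \<longleftrightarrow> iso_arrow C f"
  and op_inv [simp]: "inv_arrow (op_smc C) f = inv_arrow C f"
  by (simp_all add: iso_arrow_def inv_arrow_def op_inverse_arrows)

lemma op_parallel [simp]: "parallel (op_smc C) f g \<longleftrightarrow> parallel C f g"
  by (auto simp: parallel_def)

lemma op_equalizer [simp]: "is_equalizer (op_smc C) f g E e \<longleftrightarrow> is_coequalizer C f g E e"
  and op_coequalizer [simp]: "is_coequalizer (op_smc C) f g E e \<longleftrightarrow> is_equalizer C f g E e"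
  by (simp_all add: is_equalizer_def is_coequalizer_def)

lemma op_has_equalizers: "has_equalizers (op_smc C) \<longleftrightarrow> has_coequalizers C"
  by (simp add: has_equalizers_def has_coequalizers_def)

context category
begin

lemma inv_comp:
  assumes "iso_arrow C f" "iso_arrow C g" "Cod C f = Dom C g"
  shows "iso_arrow C (g \<cdot> f)" "inv_arrow C (g \<cdot> f) = inv_arrow C f \<cdot> inv_arrow C g"
proof -
  have *: "inverse_arrows C (g \<cdot> f) (inv_arrow C f \<cdot> inv_arrow C g)"
    using assms by (simp add: inverse_arrows_def Hom_iff)
  show "iso_arrow C (g \<cdot> f)" using * by (auto simp: iso_arrow_def)
  show "inv_arrow C (g \<cdot> f) = inv_arrow C f \<cdot> inv_arrow C g" by (rule inv_arrow_eq[OF *])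
qed

lemma eq_inv_comp_iff:
  assumes "iso_arrow C t" "f \<in> Arr C" "g \<in> Arr C" "Cod C f = Dom C t" "Cod C g = Cod C t"
  shows "f = inv_arrow C t \<cdot> g \<longleftrightarrow> t \<cdot> f = g"
  using assms by auto

lemma comp_inv_eq_iff:
  assumes "iso_arrow C t" "f \<in> Arr C" "g \<in> Arr C" "Dom C f = Cod C t" "Dom C g = Dom C t"
  shows "g \<cdot> inv_arrow C t = f \<longleftrightarrow> g = f \<cdot> t"
  using assms by auto

end

context symmetric_monoidal_category
begin

lemma inv_braid: "X \<in> Obj C \<Longrightarrow> Y \<in> Obj C \<Longrightarrow> inv_arrow C (\<s> X Y) = \<s> Y X"
  by (rule inv_arrow_eq) (simp add: inverse_arrows_def Hom_iff)

lemma pentagon_inv: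
  assumes "W \<in> Obj C" "X \<in> Obj C" "Y \<in> Obj C" "Z \<in> Obj C"
  shows "ainv (W \<otimes>\<^sub>o X) Y Z \<cdot> ainv W X (Y \<otimes>\<^sub>o Z)
    = (ainv W X Y \<otimes>\<^sub>a \<iota> Z) \<cdot> ainv W (X \<otimes>\<^sub>o Y) Z \<cdot> (\<iota> W \<otimes>\<^sub>a ainv X Y Z)"
  using arg_cong[OF pentagon[OF assms], of "inv_arrow C"] assms
  by (simp add: inv_comp iso_ten iso_idn)

lemma hexagon_inv:
  assumes "X \<in> Obj C" "Y \<in> Obj C" "Z \<in> Obj C"
  shows "ainv X Y Z \<cdot> \<s> (Y \<otimes>\<^sub>o Z) X \<cdot> ainv Y Z X
    = (\<s> Y X \<otimes>\<^sub>a \<iota> Z) \<cdot> ainv Y X Z \<cdot> (\<iota> Y \<otimes>\<^sub>a \<s> Z X)"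
  using arg_cong[OF hexagon[OF assms], of "inv_arrow C"] assms
  by (simp add: inv_comp iso_ten iso_idn braid_iso inv_braid)

end

lemma op_symmetric_monoidal:
  fixes C :: "('o, 'm) smc"
  assumes "symmetric_monoidal_category C"
  shows "symmetric_monoidal_category (op_smc C)"
proof -
  interpret symmetric_monoidal_category C by fact
  show ?thesis
  proof (unfold_locales, goal_cases)
    case 10
    then show ?case by (simp add: TenA_Hom)
  next
    case 12
    then show ?case by (simp add: Hom_iff interchange)
  qed (auto simp: Hom_iff merge ainv_nat linv_nat rinv_nat s_nat pentagon_inv hexagon_inv ainv_linv
      iso_inv_arrow)
qed

locale opposite_monoidal = symmetric_monoidal_category C
  for C :: "('o, 'm) smc" (structure)
begin

sublocale op: symmetric_monoidal_category "op_smc C"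
  by (rule op_symmetric_monoidal) (rule symmetric_monoidal_category_axioms)

text \<open>Reversing the arrows inverts the exchange of the two middle factors, and the inverse is the
  exchange with the middle indices interchanged.\<close>

lemma op_mid:
  assumes "W \<in> Obj C" "X \<in> Obj C" "Y \<in> Obj C" "Z \<in> Obj C"
  shows "middle_four (op_smc C) W X Y Z = mid W Y X Z"
  using assms by (simp add: middle_four_def iso_inv_arrow)

lemma op_monoid: "is_monoid (op_smc C) M m u \<longleftrightarrow> is_comonoid C M m u"
proof (cases "M \<in> Obj C \<and> m \<in> Hom C M (M \<otimes>\<^sub>o M) \<and> u \<in> Hom C M \<I>")
  case True
  then have "(m \<otimes>\<^sub>a \<iota> M) \<cdot> m = (ainv M M M \<cdot> (\<iota> M \<otimes>\<^sub>a m)) \<cdot> m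
      \<longleftrightarrow> \<a> M M M \<cdot> (m \<otimes>\<^sub>a \<iota> M) \<cdot> m = (\<iota> M \<otimes>\<^sub>a m) \<cdot> m"
    "(u \<otimes>\<^sub>a \<iota> M) \<cdot> m = linv M \<longleftrightarrow> \<l> M \<cdot> (u \<otimes>\<^sub>a \<iota> M) \<cdot> m = \<iota> M"
    "(\<iota> M \<otimes>\<^sub>a u) \<cdot> m = rinv M \<longleftrightarrow> \<r> M \<cdot> (\<iota> M \<otimes>\<^sub>a u) \<cdot> m = \<iota> M"
    using eq_inv_comp_iff[of "\<a> M M M" "(m \<otimes>\<^sub>a \<iota> M) \<cdot> m" "(\<iota> M \<otimes>\<^sub>a m) \<cdot> m"]
      eq_inv_comp_iff[of "\<l> M" "(u \<otimes>\<^sub>a \<iota> M) \<cdot> m" "\<iota> M"]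
      eq_inv_comp_iff[of "\<r> M" "(\<iota> M \<otimes>\<^sub>a u) \<cdot> m" "\<iota> M"]
    by (simp_all add: Hom_iff)
  then show ?thesis using True by (simp add: is_monoid_def is_comonoid_def)
qed (auto simp: is_monoid_def is_comonoid_def)

lemma op_comonoid: "is_comonoid (op_smc C) M d e \<longleftrightarrow> is_monoid C M d e"
proof (cases "M \<in> Obj C \<and> d \<in> Hom C (M \<otimes>\<^sub>o M) M \<and> e \<in> Hom C \<I> M")
  case True
  then have "(d \<cdot> (d \<otimes>\<^sub>a \<iota> M)) \<cdot> ainv M M M = d \<cdot> (\<iota> M \<otimes>\<^sub>a d)
      \<longleftrightarrow> d \<cdot> (d \<otimes>\<^sub>a \<iota> M) = d \<cdot> (\<iota> M \<otimes>\<^sub>a d) \<cdot> \<a> M M M"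
    "(d \<cdot> (e \<otimes>\<^sub>a \<iota> M)) \<cdot> linv M = \<iota> M \<longleftrightarrow> d \<cdot> (e \<otimes>\<^sub>a \<iota> M) = \<l> M"
    "(d \<cdot> (\<iota> M \<otimes>\<^sub>a e)) \<cdot> rinv M = \<iota> M \<longleftrightarrow> d \<cdot> (\<iota> M \<otimes>\<^sub>a e) = \<r> M"
    using comp_inv_eq_iff[of "\<a> M M M" "d \<cdot> (\<iota> M \<otimes>\<^sub>a d)" "d \<cdot> (d \<otimes>\<^sub>a \<iota> M)"]
      comp_inv_eq_iff[of "\<l> M" "\<iota> M" "d \<cdot> (e \<otimes>\<^sub>a \<iota> M)"]
      comp_inv_eq_iff[of "\<r> M" "\<iota> M" "d \<cdot> (\<iota> M \<otimes>\<^sub>a e)"]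
    by (simp_all add: Hom_iff)
  then show ?thesis using True by (simp add: is_monoid_def is_comonoid_def)
qed (auto simp: is_monoid_def is_comonoid_def)

lemma op_is_bimonoid: "is_bimonoid (op_smc C) A \<longleftrightarrow> is_bimonoid C (op_bimonoid A)"
proof (cases "is_comonoid C (Carrier A) (\<nabla> A) (\<eta> A) \<and> is_monoid C (Carrier A) (\<Delta> A) (\<epsilon> A)")
  case True
  then have "Carrier A \<in> Obj C"
    "\<nabla> A \<in> Hom C (Carrier A) (Carrier A \<otimes>\<^sub>o Carrier A)" "\<eta> A \<in> Hom C (Carrier A) \<I>"
    "\<Delta> A \<in> Hom C (Carrier A \<otimes>\<^sub>o Carrier A) (Carrier A)" "\<epsilon> A \<in> Hom C \<I> (Carrier A)"
    by (simp_all add: is_monoid_def is_comonoid_def)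
  then show ?thesis
    by (simp add: is_bimonoid_def op_monoid op_comonoid op_mid Let_def Hom_iff iso_inv_arrow) blast
qed (auto simp: is_bimonoid_def op_monoid op_comonoid Let_def)

lemma op_antipode:
  assumes "is_bimonoid C (op_bimonoid A)"
  shows "is_antipode (op_smc C) A S \<longleftrightarrow> is_antipode C (op_bimonoid A) S"
  using bimonoid_simps[OF assms] by (auto simp: is_antipode_def Hom_iff)

lemma op_hopf_monoid: "is_hopf_monoid (op_smc C) A \<longleftrightarrow> is_hopf_monoid C (op_bimonoid A)"
  by (auto simp: is_hopf_monoid_def op_is_bimonoid op_antipode)

lemma op_bicommutative: "is_bicommutative (op_smc C) A \<longleftrightarrow> is_bicommutative C (op_bimonoid A)"
  by (auto simp: is_bicommutative_def)

lemma op_bimonoid_hom: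
  "bimonoid_hom (op_smc C) A B f \<longleftrightarrow> bimonoid_hom C (op_bimonoid B) (op_bimonoid A) f"
  by (auto simp: bimonoid_hom_def)

lemma op_right_coaction: "right_coaction (op_smc C) B \<beta> Y \<longleftrightarrow> right_action C (op_bimonoid B) \<beta> Y"
proof (cases "is_bimonoid C (op_bimonoid B) \<and> Y \<in> Obj C \<and> \<beta> \<in> Hom C (Y \<otimes>\<^sub>o Carrier B) Y")
  case True
  let ?B = "Carrier B"
  have "is_bimonoid C (op_bimonoid B)" using True by simp
  from bimonoid_simps[OF this] True
  have "(\<beta> \<cdot> (\<beta> \<otimes>\<^sub>a \<iota> ?B)) \<cdot> ainv Y ?B ?B = \<beta> \<cdot> (\<iota> Y \<otimes>\<^sub>a \<Delta> B)
      \<longleftrightarrow> \<beta> \<cdot> (\<beta> \<otimes>\<^sub>a \<iota> ?B) = \<beta> \<cdot> (\<iota> Y \<otimes>\<^sub>a \<Delta> B) \<cdot> \<a> Y ?B ?B"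
    "(\<beta> \<cdot> (\<iota> Y \<otimes>\<^sub>a \<epsilon> B)) \<cdot> rinv Y = \<iota> Y \<longleftrightarrow> \<beta> \<cdot> (\<iota> Y \<otimes>\<^sub>a \<epsilon> B) = \<r> Y"
    using comp_inv_eq_iff[of "\<a> Y ?B ?B" "\<beta> \<cdot> (\<iota> Y \<otimes>\<^sub>a \<Delta> B)" "\<beta> \<cdot> (\<beta> \<otimes>\<^sub>a \<iota> ?B)"]
      comp_inv_eq_iff[of "\<r> Y" "\<iota> Y" "\<beta> \<cdot> (\<iota> Y \<otimes>\<^sub>a \<epsilon> B)"]
    by (simp_all add: Hom_iff)
  then show ?thesis
    using True by (simp add: right_coaction_def right_action_def op_is_bimonoid)
qed (auto simp: right_coaction_def right_action_def op_is_bimonoid)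

lemma op_right_coaction_stabilized:
  assumes "Y \<in> Obj C"
  shows "right_coaction_stabilized (op_smc C) B \<beta> Y E e
    \<longleftrightarrow> right_action_stabilized C (op_bimonoid B) \<beta> Y E e"
  using assms by (simp add: right_coaction_stabilized_def right_action_stabilized_def iso_inv_arrow)

lemma op_bimonoid_tensor:
  assumes "Carrier B \<in> Obj C" "Carrier B' \<in> Obj C"
  shows "op_bimonoid (bimonoid_tensor (op_smc C) B B')
    = bimonoid_tensor C (op_bimonoid B) (op_bimonoid B')"
  using assms by (simp add: op_bimonoid_def bimonoid_tensor_def op_mid Let_def iso_inv_arrow)

lemma op_right_costable:
  assumes "right_stable C"
  shows "right_costable (op_smc C)"
  unfolding right_costable_def
proof (intro allI impI, elim conjE)
  fix B \<beta> Y E e B' \<beta>' Y' E' e' R r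
  assume h: "right_coaction (op_smc C) B \<beta> Y" "right_coaction (op_smc C) B' \<beta>' Y'"
    "right_coaction_stabilized (op_smc C) B \<beta> Y E e"
    "right_coaction_stabilized (op_smc C) B' \<beta>' Y' E' e'"
    "right_coaction_stabilized (op_smc C) (bimonoid_tensor (op_smc C) B B')
      (right_coaction_tensor (op_smc C) B \<beta> Y B' \<beta>' Y') (Y \<otimes>\<^sub>o\<^bsub>op_smc C\<^esub> Y') R r"
  have act: "right_action C (op_bimonoid B) \<beta> Y" "right_action C (op_bimonoid B') \<beta>' Y'"
    using h by (simp_all add: op_right_coaction)
  then have obj: "Carrier B \<in> Obj C" "Carrier B' \<in> Obj C" "Y \<in> Obj C" "Y' \<in> Obj C"
    using bimonoid_simps(1)[of "op_bimonoid B"] bimonoid_simps(1)[of "op_bimonoid B'"]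
    by (simp_all add: right_action_def)
  have "right_coaction_tensor (op_smc C) B \<beta> Y B' \<beta>' Y'
      = right_action_tensor C (op_bimonoid B) \<beta> Y (op_bimonoid B') \<beta>' Y'"
    using obj by (simp add: right_coaction_tensor_def right_action_tensor_def op_mid)
  with h(5) have "right_action_stabilized C (bimonoid_tensor C (op_bimonoid B) (op_bimonoid B'))
      (right_action_tensor C (op_bimonoid B) \<beta> Y (op_bimonoid B') \<beta>' Y') (Y \<otimes>\<^sub>o Y') R r"
    using obj by (simp add: op_right_coaction_stabilized op_bimonoid_tensor)
  moreover have "right_action_stabilized C (op_bimonoid B) \<beta> Y E e"
    "right_action_stabilized C (op_bimonoid B') \<beta>' Y' E' e'"
    using h obj by (simp_all add: op_right_coaction_stabilized)
  ultimately show "\<exists>g\<in>Hom (op_smc C) (E \<otimes>\<^sub>o\<^bsub>op_smc C\<^esub> E') R.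
      r \<cdot>\<^bsub>op_smc C\<^esub> g = e \<otimes>\<^sub>a\<^bsub>op_smc C\<^esub> e' \<and> iso_arrow (op_smc C) g"
    using assms act unfolding right_stable_def by simp
qed

text \<open>The unit constraints in the two definitions stand on different sides of the equations, and
  naturality brings them together at the unit object, where \<open>\<l> \<I> = \<r> \<I>\<close>.\<close>

lemma op_normalized_integral:
  assumes Q: "is_bimonoid C Q"
  shows "normalized_integral (op_smc C) (op_bimonoid Q) \<psi> \<longleftrightarrow> normalized_cointegral C Q \<psi>"
proof (cases "\<psi> \<in> Hom C (Carrier Q) \<I>")
  case True
  let ?Q = "Carrier Q"
  have \<psi>: "\<psi> \<in> Arr C" "Dom C \<psi> = ?Q" "Cod C \<psi> = \<I>" using True by (simp_all add: Hom_iff)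
  have r: "(\<psi> \<otimes>\<^sub>a \<eta> Q) \<cdot> rinv ?Q = linv ?Q \<cdot> \<eta> Q \<cdot> \<psi>"
  proof -
    have "(\<psi> \<otimes>\<^sub>a \<eta> Q) \<cdot> rinv ?Q = (\<iota> \<I> \<otimes>\<^sub>a \<eta> Q) \<cdot> (\<psi> \<otimes>\<^sub>a \<iota> \<I>) \<cdot> rinv ?Q"
      using Q \<psi> by (simp add: merge)
    also have "\<dots> = (\<iota> \<I> \<otimes>\<^sub>a \<eta> Q) \<cdot> linv \<I> \<cdot> \<psi>"
      using Q \<psi> by (simp add: l_unit rinv_nat)
    also have "\<dots> = linv ?Q \<cdot> \<eta> Q \<cdot> \<psi>"
      using Q \<psi> by (simp add: comp_extend[OF linv_nat])
    finally show ?thesis .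
  qed
  have l: "(\<eta> Q \<otimes>\<^sub>a \<psi>) \<cdot> linv ?Q = rinv ?Q \<cdot> \<eta> Q \<cdot> \<psi>"
  proof -
    have "(\<eta> Q \<otimes>\<^sub>a \<psi>) \<cdot> linv ?Q = (\<eta> Q \<otimes>\<^sub>a \<iota> \<I>) \<cdot> (\<iota> \<I> \<otimes>\<^sub>a \<psi>) \<cdot> linv ?Q"
      using Q \<psi> by (simp add: merge)
    also have "\<dots> = (\<eta> Q \<otimes>\<^sub>a \<iota> \<I>) \<cdot> rinv \<I> \<cdot> \<psi>"
      using Q \<psi> by (simp add: linv_nat flip: l_unit)
    also have "\<dots> = rinv ?Q \<cdot> \<eta> Q \<cdot> \<psi>"
      using Q \<psi> by (simp add: comp_extend[OF rinv_nat])
    finally show ?thesis .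
  qed
  have "(\<psi> \<otimes>\<^sub>a \<iota> ?Q) \<cdot> \<Delta> Q = (\<psi> \<otimes>\<^sub>a \<eta> Q) \<cdot> rinv ?Q
      \<longleftrightarrow> \<l> ?Q \<cdot> (\<psi> \<otimes>\<^sub>a \<iota> ?Q) \<cdot> \<Delta> Q = \<eta> Q \<cdot> \<psi>"
    unfolding r using Q \<psi> by (intro eq_inv_comp_iff) simp_all
  moreover have "(\<iota> ?Q \<otimes>\<^sub>a \<psi>) \<cdot> \<Delta> Q = (\<eta> Q \<otimes>\<^sub>a \<psi>) \<cdot> linv ?Q
      \<longleftrightarrow> \<r> ?Q \<cdot> (\<iota> ?Q \<otimes>\<^sub>a \<psi>) \<cdot> \<Delta> Q = \<eta> Q \<cdot> \<psi>"
    unfolding l using Q \<psi> by (intro eq_inv_comp_iff) simp_all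
  ultimately show ?thesis
    using True by (simp add: normalized_integral_def integral_def normalized_cointegral_def
        cointegral_def)
qed (simp add: normalized_integral_def integral_def normalized_cointegral_def cointegral_def)

lemma op_integral_along:
  assumes "is_bimonoid C A" "is_bimonoid C B" "bimonoid_hom C A B f"
  shows "right_integral_along (op_smc C) (op_bimonoid B) (op_bimonoid A) f \<mu>
      \<longleftrightarrow> right_integral_along C A B f \<mu>"
    and "left_integral_along (op_smc C) (op_bimonoid B) (op_bimonoid A) f \<mu>
      \<longleftrightarrow> left_integral_along C A B f \<mu>"
  using assms bimonoid_homD[OF assms(3)]
  by (auto simp: right_integral_along_def left_integral_along_def Hom_iff)

lemma op_normalized_along:
  assumes "\<xi> \<in> Hom C X Y" "\<mu> \<in> Hom C Y X"
  shows "normalized_along (op_smc C) \<xi> \<mu> \<longleftrightarrow> normalized_along C \<xi> \<mu>"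
  using assms by (simp add: normalized_along_def Hom_iff)

text \<open>An arrow \<open>(X, f, Y)\<close> between Hopf monoids in \<open>C\<close> is an arrow \<open>(op Y, f, op X)\<close> between Hopf
  monoids in the opposite category, where \<open>op\<close> reverses the structure maps; so the universal
  property of a cokernel is that of a kernel.\<close>

lemma op_is_Ker:
  assumes "is_Cok C A B \<xi> Q q"
  shows "is_Ker (op_smc C) (op_bimonoid B) (op_bimonoid A) \<xi> (op_bimonoid Q) q"
proof -
  let ?D = "Hopf_bc C" and ?O = "Hopf_bc (op_smc C)"
  have arr: "(X, f, Y) \<in> Arr ?O \<longleftrightarrow> (op_bimonoid Y, f, op_bimonoid X) \<in> Arr ?D" for X f Y
    by (auto simp: Hopf_bc_def op_hopf_monoid op_bicommutative op_bimonoid_hom)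
  have triv: "trivial_hom (op_smc C) (op_bimonoid B) (op_bimonoid A) = trivial_hom C A B"
    by (simp add: trivial_hom_def)
  have E: "is_coequalizer ?D (A, \<xi>, B) (A, trivial_hom C A B, B) Q (B, q, Q)"
    using assms by (simp add: is_Cok_def)
  have sel: "Dom ?D (X, f, Y) = X" "Cod ?D (X, f, Y) = Y" "Dom ?O (X, f, Y) = X" "Cod ?O (X, f, Y) = Y"
    "(Y', g, Z) \<cdot>\<^bsub>?D\<^esub> (X, f, Y) = (X, g \<cdot> f, Z)" "(Y', g, Z) \<cdot>\<^bsub>?O\<^esub> (X, f, Y) = (X, f \<cdot> g, Z)"
    for X Y Y' Z f g
    by (simp_all add: Hopf_bc_def)
  show ?thesis
    unfolding is_Ker_def is_equalizer_def triv
  proof (intro conjI allI impI)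
    show "parallel ?O (op_bimonoid B, \<xi>, op_bimonoid A) (op_bimonoid B, trivial_hom C A B, op_bimonoid A)"
      using E by (simp add: is_coequalizer_def parallel_def arr sel)
    show "(op_bimonoid Q, q, op_bimonoid B)
      \<in> Hom ?O (op_bimonoid Q) (Dom ?O (op_bimonoid B, \<xi>, op_bimonoid A))"
      using E by (simp add: is_coequalizer_def arr sel Hom_iff)
    show "(op_bimonoid B, \<xi>, op_bimonoid A) \<cdot>\<^bsub>?O\<^esub> (op_bimonoid Q, q, op_bimonoid B)
      = (op_bimonoid B, trivial_hom C A B, op_bimonoid A) \<cdot>\<^bsub>?O\<^esub> (op_bimonoid Q, q, op_bimonoid B)"
      using E by (simp add: is_coequalizer_def sel)
    fix W h
    assume h: "h \<in> Hom ?O W (Dom ?O (op_bimonoid B, \<xi>, op_bimonoid A))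
      \<and> (op_bimonoid B, \<xi>, op_bimonoid A) \<cdot>\<^bsub>?O\<^esub> h
        = (op_bimonoid B, trivial_hom C A B, op_bimonoid A) \<cdot>\<^bsub>?O\<^esub> h"
    obtain h' where h': "h = (W, h', op_bimonoid B)"
      using h by (cases h) (auto simp: Hom_iff sel)
    have "(B, h', op_bimonoid W) \<in> Hom ?D (Cod ?D (A, \<xi>, B)) (op_bimonoid W)
      \<and> (B, h', op_bimonoid W) \<cdot>\<^bsub>?D\<^esub> (A, \<xi>, B) = (B, h', op_bimonoid W) \<cdot>\<^bsub>?D\<^esub> (A, trivial_hom C A B, B)"
      using h by (simp add: h' Hom_iff arr sel)
    then have ex: "\<exists>!u. u \<in> Hom ?D Q (op_bimonoid W) \<and> u \<cdot>\<^bsub>?D\<^esub> (B, q, Q) = (B, h', op_bimonoid W)"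
      using E unfolding is_coequalizer_def by blast
    have iff: "u \<in> Hom ?D Q (op_bimonoid W) \<and> u \<cdot>\<^bsub>?D\<^esub> (B, q, Q) = (B, h', op_bimonoid W)
      \<longleftrightarrow> (\<exists>u'. u = (Q, u', op_bimonoid W) \<and> (Q, u', op_bimonoid W) \<in> Arr ?D \<and> u' \<cdot> q = h')" for u
      by (cases u) (auto simp: Hom_iff sel)
    have iff': "v \<in> Hom ?O W (op_bimonoid Q) \<and> (op_bimonoid Q, q, op_bimonoid B) \<cdot>\<^bsub>?O\<^esub> v = h
      \<longleftrightarrow> (\<exists>u'. v = (W, u', op_bimonoid Q) \<and> (Q, u', op_bimonoid W) \<in> Arr ?D \<and> u' \<cdot> q = h')" for v
      by (cases v) (auto simp: Hom_iff sel arr h')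
    show "\<exists>!v. v \<in> Hom ?O W (op_bimonoid Q) \<and> (op_bimonoid Q, q, op_bimonoid B) \<cdot>\<^bsub>?O\<^esub> v = h"
      unfolding iff' using ex unfolding iff by blast
  qed
qed

end

section \<open>The existence criterion for normalized integrals\<close>

locale opposite_hopf_hom = bicommutative_hopf_hom C A B \<xi> + opposite_monoidal C
  for C :: "('o, 'm) smc" (structure) and A B :: "('o, 'm) bimonoid" and \<xi> :: 'm
begin

lemma op_hopf_hom: "bicommutative_hopf_hom (op_smc C) (op_bimonoid B) (op_bimonoid A) \<xi>"
  by unfold_locales
    (use A B \<xi> in \<open>simp_all add: op_hopf_monoid op_bicommutative op_bimonoid_hom\<close>)

text \<open>The second equation is the first one in the opposite category, since integrals along \<open>\<xi>\<close>
  are self-dual.\<close>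

lemma normalized_integral_generates:
  assumes \<mu>: "integral_along C A B \<xi> \<mu>" and norm: "normalized_along C \<xi> \<mu>"
    and \<mu>': "right_integral_along C A B \<xi> \<mu>' \<or> left_integral_along C A B \<xi> \<mu>'"
  shows "\<mu> \<cdot> \<xi> \<cdot> \<mu>' = \<mu>'" and "\<mu>' \<cdot> \<xi> \<cdot> \<mu> = \<mu>'"
proof -
  have r: "right_integral_along C A B \<xi> \<mu>" using \<mu> by (simp add: integral_along_def)
  have l: "left_integral_along C A B \<xi> \<mu>'" using \<mu>' right_integral_iff_left by blast
  show "\<mu> \<cdot> \<xi> \<cdot> \<mu>' = \<mu>'" by (rule normalized_integral_absorbs[OF r norm l])
  interpret O: bicommutative_hopf_hom "op_smc C" "op_bimonoid B" "op_bimonoid A" \<xi>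
    by (rule op_hopf_hom)
  have "\<mu> \<cdot>\<^bsub>op_smc C\<^esub> \<xi> \<cdot>\<^bsub>op_smc C\<^esub> \<mu>' = \<mu>'"
    using r l norm right_integral_alongD(1-3)[OF r]
    by (intro O.normalized_integral_absorbs)
      (simp_all add: op_integral_along[OF _ _ \<xi>] op_normalized_along[of _ "Carrier A" "Carrier B"] Hom_iff)
  then show "\<mu>' \<cdot> \<xi> \<cdot> \<mu> = \<mu>'"
    using right_integral_alongD(1-3)[OF r] left_integral_alongD(1-3)[OF l] by simp
qed

lemma normalized_generator:
  assumes "integral_along C A B \<xi> \<mu>" "normalized_along C \<xi> \<mu>"
  shows "generator_along C A B \<xi> \<mu>"
  using assms normalized_integral_generates unfolding generator_along_def by blast

text \<open>Each of two normalized integrals absorbs the other, so \<open>\<mu> \<xi> \<mu>'\<close> is equal to both.\<close>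

lemma normalized_integral_unique:
  assumes "integral_along C A B \<xi> \<mu>" "normalized_along C \<xi> \<mu>"
    and "integral_along C A B \<xi> \<mu>'" "normalized_along C \<xi> \<mu>'"
  shows "\<mu> = \<mu>'"
proof -
  have "\<mu> \<cdot> \<xi> \<cdot> \<mu>' = \<mu>'"
    using assms(3) by (intro normalized_integral_generates(1)[OF assms(1,2)])
      (simp add: integral_along_def)
  moreover have "\<mu> \<cdot> \<xi> \<cdot> \<mu>' = \<mu>"
    using assms(1) by (intro normalized_integral_generates(2)[OF assms(3,4)])
      (simp add: integral_along_def)
  ultimately show ?thesis by simp
qed

text \<open>The dual of \<open>kernel_equalizer\<close>.\<close>

lemma cokernel_coequalizer:
  assumes coeq: "has_coequalizers C" and st: "right_stable C" and Q: "is_Cok C A B \<xi> Q q"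
  shows "is_coequalizer C (\<nabla> B \<cdot> (\<iota> (Carrier B) \<otimes>\<^sub>a \<xi>)) (\<r> (Carrier B) \<cdot> (\<iota> (Carrier B) \<otimes>\<^sub>a \<epsilon> A))
    (Carrier Q) q"
proof -
  interpret O: bicommutative_hopf_hom "op_smc C" "op_bimonoid B" "op_bimonoid A" \<xi>
    by (rule op_hopf_hom)
  show ?thesis
    using O.kernel_equalizer[OF _ op_right_costable[OF st] op_is_Ker[OF Q]] coeq
    by (simp add: op_has_equalizers op.coaction_along_def op.trivial_coaction_def iso_inv_arrow)
qed

lemma is_CokD:
  assumes "is_Cok C A B \<xi> Q q"
  shows "is_hopf_monoid C Q" "is_bicommutative C Q" "bimonoid_hom C B Q q"
    "q \<cdot> \<xi> = q \<cdot> trivial_hom C A B"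
  using op.is_KerD(1-4)[OF op_is_Ker[OF assms]]
  by (simp_all add: op_hopf_monoid op_bicommutative op_bimonoid_hom trivial_hom_def)

lemma normalized_integral_kernel_cokernel:
  assumes eq: "has_equalizers C" "has_coequalizers C"
    and st: "right_costable C" "right_stable C"
    and K: "is_Ker C A B \<xi> K k" and Q: "is_Cok C A B \<xi> Q q"
    and \<mu>: "integral_along C A B \<xi> \<mu>" "normalized_along C \<xi> \<mu>"
  shows "\<exists>\<phi>. normalized_integral C K \<phi>" and "\<exists>\<psi>. normalized_cointegral C Q \<psi>"
proof -
  have int: "right_integral_along C A B \<xi> \<mu>" "left_integral_along C A B \<xi> \<mu>"
    using \<mu>(1) by (simp_all add: integral_along_def)
  note \<mu>' = right_integral_alongD(1-3)[OF int(1)]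
  show "\<exists>\<phi>. normalized_integral C K \<phi>"
    using kernel_normalized_integral[OF is_KerD(1,3)[OF K] kernel_equalizer[OF eq(1) st(1) K]
        int \<mu>(2)] by blast
  interpret O: bicommutative_hopf_hom "op_smc C" "op_bimonoid B" "op_bimonoid A" \<xi>
    by (rule op_hopf_hom)
  note KO = op_is_Ker[OF Q]
  have E: "is_equalizer (op_smc C) O.\<beta> (op.trivial_coaction (Carrier (op_bimonoid B)) (op_bimonoid A))
      (Carrier (op_bimonoid Q)) q"
    using O.kernel_equalizer[OF _ op_right_costable[OF st(2)] KO] eq(2)
    by (simp add: op_has_equalizers)
  have "right_integral_along (op_smc C) (op_bimonoid B) (op_bimonoid A) \<xi> \<mu>"
    "left_integral_along (op_smc C) (op_bimonoid B) (op_bimonoid A) \<xi> \<mu>"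
    "normalized_along (op_smc C) \<xi> \<mu>"
    using int \<mu>(2) \<mu>'
    by (simp_all add: op_integral_along[OF _ _ \<xi>] op_normalized_along[of _ "Carrier A" "Carrier B"] Hom_iff)
  from O.kernel_normalized_integral[OF op.is_KerD(1,3)[OF KO] E this]
  obtain \<psi> where "normalized_integral (op_smc C) (op_bimonoid Q) \<psi>" .
  then show "\<exists>\<psi>. normalized_cointegral C Q \<psi>"
    using op_normalized_integral is_CokD(1)[OF Q] by auto
qed

end

context opposite_monoidal
begin

lemma opposite_hopf_homI:
  assumes "is_hopf_monoid C A" "is_bicommutative C A" "is_hopf_monoid C B" "is_bicommutative C B"
    and "bimonoid_hom C A B \<xi>"
  shows "opposite_hopf_hom C A B \<xi>"
  by unfold_locales (fact assms)+

text \<open>The dual of \<open>integral_along_quotient\<close>.\<close>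

lemma integral_along_sub:
  assumes hopf: "is_hopf_monoid C Q" "is_hopf_monoid C B" "is_hopf_monoid C I"
    and q: "bimonoid_hom C B Q q" and i: "bimonoid_hom C I B i"
    and qi: "q \<cdot> i = \<eta> Q \<cdot> \<epsilon> I"
    and E: "is_equalizer C (coaction_along B q) (trivial_coaction (Carrier B) Q) (Carrier I) i"
    and \<psi>: "normalized_cointegral C Q \<psi>"
  obtains \<mu> where "left_integral_along C I B i \<mu>" "\<mu> \<cdot> i = \<iota> (Carrier I)"
proof -
  have "normalized_integral (op_smc C) (op_bimonoid Q) \<psi>"
    using op_normalized_integral \<psi> hopf by simp
  with op.integral_along_quotient[of "op_bimonoid Q" "op_bimonoid B" "op_bimonoid I" q i \<psi>]
  obtain \<mu> where "left_integral_along (op_smc C) (op_bimonoid B) (op_bimonoid I) i \<mu>"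
    "\<mu> \<cdot> i = \<iota> (Carrier I)"
    using hopf q i qi E
    by (auto simp: op_hopf_monoid op_bimonoid_hom coaction_along_def trivial_coaction_def)
  then show thesis
    using that op_integral_along(2)[OF _ _ i] hopf by simp
qed

text \<open>The zero arrows of the abelian category are the trivial homomorphisms: precomposing the
  trivial homomorphism with the zero endomorphism gives zero by additivity, and the trivial
  homomorphism itself because homomorphisms preserve the counit.  Thus its kernels and cokernels are
  those of \<open>is_Ker\<close> and \<open>is_Cok\<close>, and \<open>coimage_factorization\<close> applies.\<close>

lemma hopf_image_factorization:
  assumes ab: "abelian_category (Hopf_bc C)"
    and A: "is_hopf_monoid C A" "is_bicommutative C A"
    and B: "is_hopf_monoid C B" "is_bicommutative C B"
    and \<xi>: "bimonoid_hom C A B \<xi>"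
    and K: "is_Ker C A B \<xi> K k" and Q: "is_Cok C A B \<xi> Q q"
  obtains I \<pi> i where "is_Cok C K A k I \<pi>" "is_Ker C B Q q I i" "i \<cdot> \<pi> = \<xi>"
proof -
  let ?D = "Hopf_bc C"
  interpret D: category ?D using ab by (simp add: abelian_category_def)
  obtain add zero where pre: "preadditive ?D add zero"
    and cok: "\<And>X Y f. f \<in> Hom ?D X Y \<Longrightarrow> \<exists>Q q. is_coequalizer ?D f (zero X Y) Q q"
    and mono: "\<And>m. mono_arrow ?D m \<Longrightarrow> \<exists>X Y. \<exists>f\<in>Hom ?D X Y. is_equalizer ?D f (zero X Y) (Dom ?D m) m"
    and epi: "\<And>e. epi_arrow ?D e \<Longrightarrow> \<exists>X Y. \<exists>f\<in>Hom ?D X Y. is_coequalizer ?D f (zero X Y) (Cod ?D e) e"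
    using ab unfolding abelian_category_def by blast
  interpret D: preadditive_category ?D add zero
    by unfold_locales (rule pre)
  have zero: "zero X Y = (X, trivial_hom C X Y, Y)" if XY: "X \<in> Obj ?D" "Y \<in> Obj ?D" for X Y
  proof -
    have X: "is_bimonoid C X" and Y: "is_bimonoid C Y" using XY by (simp_all add: Hopf_bc_def)
    have t: "(X, trivial_hom C X Y, Y) \<in> Hom ?D X Y"
      using XY trivial_hom_hom[OF X Y] by (simp add: Hom_iff Hopf_bc_def)
    have "zero X X \<in> Hom ?D X X" using XY by (simp add: Hom_iff)
    then obtain z where z: "zero X X = (X, z, X)" "bimonoid_hom C X X z"
      by (cases "zero X X") (auto simp: Hom_iff Hopf_bc_def)
    note z' = bimonoid_homD[OF z(2)]
    have "zero X Y = (X, trivial_hom C X Y, Y) \<cdot>\<^bsub>?D\<^esub> zero X X"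
      using D.comp_zero[of "(X, trivial_hom C X Y, Y)" X X] t XY by (simp add: Hom_iff)
    also have "\<dots> = (X, trivial_hom C X Y, Y)"
      using z' X Y unfolding z(1) by (simp add: Hopf_bc_def trivial_hom_def)
    finally show ?thesis .
  qed
  note k = is_KerD[OF K]
  interpret opposite_hopf_hom C A B \<xi> by (rule opposite_hopf_homI[OF A B \<xi>])
  note q = is_CokD[OF Q]
  have obj: "A \<in> Obj ?D" "B \<in> Obj ?D" "K \<in> Obj ?D" "Q \<in> Obj ?D"
    using A B k q by (simp_all add: Hopf_bc_def)
  have f: "(A, \<xi>, B) \<in> Hom ?D A B" using A B \<xi> by (simp add: Hom_iff Hopf_bc_def)
  have KE: "is_equalizer ?D (A, \<xi>, B) (zero A B) K (K, k, A)"
    using K obj by (simp add: is_Ker_def zero)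
  have QE: "is_coequalizer ?D (A, \<xi>, B) (zero A B) Q (B, q, Q)"
    using Q obj by (simp add: is_Cok_def zero)
  obtain I p j where pj: "p \<in> Hom ?D A I" "j \<in> Hom ?D I B" "j \<cdot>\<^bsub>?D\<^esub> p = (A, \<xi>, B)"
    "is_coequalizer ?D (K, k, A) (zero K A) I p" "is_equalizer ?D (B, q, Q) (zero B Q) I j"
    by (rule D.coimage_factorization[OF cok mono epi KE QE f])
  obtain \<pi> where p: "p = (A, \<pi>, I)" using pj(1) by (cases p) (auto simp: Hom_iff Hopf_bc_def)
  obtain i where j: "j = (I, i, B)" using pj(2) by (cases j) (auto simp: Hom_iff Hopf_bc_def)
  show thesis
    using that[of I \<pi> i] pj(3-5) obj by (simp add: p j zero is_Ker_def is_Cok_def Hopf_bc_def)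
qed

text \<open>With \<open>\<xi> = i \<pi>\<close>, an integral \<open>\<mu>\<close> along \<open>\<pi>\<close> with \<open>\<pi> \<mu> = 1\<close> and an integral \<open>\<nu>\<close> along \<open>i\<close> with
  \<open>\<nu> i = 1\<close> give \<open>\<xi> (\<mu> \<nu>) \<xi> = i (\<pi> \<mu>) (\<nu> i) \<pi> = \<xi>\<close>.\<close>

lemma normalized_integral_exists:
  assumes eq: "has_equalizers C" "has_coequalizers C"
    and st: "right_costable C" "right_stable C"
    and ab: "abelian_category (Hopf_bc C)"
    and A: "is_hopf_monoid C A" "is_bicommutative C A"
    and B: "is_hopf_monoid C B" "is_bicommutative C B"
    and \<xi>: "bimonoid_hom C A B \<xi>"
    and K: "is_Ker C A B \<xi> K k" and Q: "is_Cok C A B \<xi> Q q"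
    and \<phi>: "normalized_integral C K \<phi>" and \<psi>: "normalized_cointegral C Q \<psi>"
  obtains \<mu> where "integral_along C A B \<xi> \<mu>" "normalized_along C \<xi> \<mu>"
proof -
  interpret X: opposite_hopf_hom C A B \<xi> by (rule opposite_hopf_homI[OF A B \<xi>])
  note k = is_KerD[OF K] and q = X.is_CokD[OF Q]
  obtain I \<pi> i where I: "is_Cok C K A k I \<pi>" "is_Ker C B Q q I i" "i \<cdot> \<pi> = \<xi>"
    by (rule hopf_image_factorization[OF ab A B \<xi> K Q])
  interpret k: opposite_hopf_hom C K A k by (rule opposite_hopf_homI[OF k(1,2) A k(3)])
  interpret q: opposite_hopf_hom C B Q q by (rule opposite_hopf_homI[OF B q(1,2,3)])
  note \<pi> = k.is_CokD[OF I(1)] and i = is_KerD[OF I(2)]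
  note \<pi>' = bimonoid_homD[OF \<pi>(3)] and i' = bimonoid_homD[OF i(3)]
  have \<pi>k: "\<pi> \<cdot> k = \<eta> I \<cdot> \<epsilon> K"
    using \<pi>(1,4) \<pi>' k(1) A comp_extend[OF \<pi>'(5), of "\<epsilon> K"] by (simp add: trivial_hom_def)
  have qi: "q \<cdot> i = \<eta> Q \<cdot> \<epsilon> I"
    using i(1,4) i' q(1) B by (simp add: trivial_hom_def)
  obtain \<mu> where \<mu>: "left_integral_along C A I \<pi> \<mu>" "\<pi> \<cdot> \<mu> = \<iota> (Carrier I)"
    by (rule integral_along_quotient[OF k(1) A(1) \<pi>(1) k(3) \<pi>(3) \<pi>k
        k.cokernel_coequalizer[OF eq(2) st(2) I(1)] \<phi>])
  obtain \<nu> where \<nu>: "left_integral_along C I B i \<nu>" "\<nu> \<cdot> i = \<iota> (Carrier I)"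
    by (rule integral_along_sub[OF q(1) B(1) \<pi>(1) q(3) i(3) qi
        q.kernel_equalizer[OF eq(1) st(1) I(2)] \<psi>])
  have left: "left_integral_along C A B \<xi> (\<mu> \<cdot> \<nu>)"
    using left_integral_along_comp[OF _ _ _ \<pi>(3) i(3) \<mu>(1) \<nu>(1)] A B \<pi>(1) I(3) by simp
  have m: "\<mu> \<in> Arr C" "Dom C \<mu> = Carrier I" "Cod C \<mu> = Carrier A"
    and n: "\<nu> \<in> Arr C" "Dom C \<nu> = Carrier B" "Cod C \<nu> = Carrier I"
    using \<mu>(1) \<nu>(1) by (simp_all add: left_integral_along_def Hom_iff)
  have "\<xi> \<cdot> (\<mu> \<cdot> \<nu>) \<cdot> \<xi> = i \<cdot> (\<pi> \<cdot> \<mu>) \<cdot> (\<nu> \<cdot> i) \<cdot> \<pi>"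
    using m n \<pi>' i' by (simp flip: I(3))
  also have "\<dots> = \<xi>" unfolding \<mu>(2) \<nu>(2) using \<pi>' i' \<pi>(1) I(3) by simp
  finally show thesis
    using that[of "\<mu> \<cdot> \<nu>"] left X.right_integral_iff_left
    by (simp add: integral_along_def normalized_along_def)
qed

end

theorem theorem1p1:
  fixes C :: "('o, 'm) smc" and A B :: "('o, 'm) bimonoid" and \<xi> :: 'm
  assumes "symmetric_monoidal_category C"
    and "has_equalizers C" and "has_coequalizers C"
    and "bistable C"
    and "abelian_category (Hopf_bc C)"
    and "is_hopf_monoid C A" and "is_bicommutative C A"
    and "is_hopf_monoid C B" and "is_bicommutative C B"
    and "bimonoid_hom C A B \<xi>"
  shows "(\<forall>K k Q q. is_Ker C A B \<xi> K k \<and> is_Cok C A B \<xi> Q q \<longrightarrow>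
            ((\<exists>\<mu>. generator_along C A B \<xi> \<mu> \<and> normalized_along C \<xi> \<mu>) \<longleftrightarrow>
             (\<exists>\<phi>. normalized_integral C K \<phi>) \<and> (\<exists>\<psi>. normalized_cointegral C Q \<psi>)))
       \<and> (\<forall>\<mu> \<mu>'. integral_along C A B \<xi> \<mu> \<and> normalized_along C \<xi> \<mu>
                 \<and> integral_along C A B \<xi> \<mu>' \<and> normalized_along C \<xi> \<mu>' \<longrightarrow> \<mu> = \<mu>')"
proof -
  interpret symmetric_monoidal_category C by fact
  interpret opposite_monoidal C by unfold_locales
  interpret opposite_hopf_hom C A B \<xi> by (rule opposite_hopf_homI) fact+
  have st: "right_costable C" "right_stable C"
    using assms(4) by (simp_all add: bistable_def stable_def costable_def)
  show ?thesis
  proof (intro conjI allI impI iffI; (elim conjE exE)?)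
    fix K k Q q \<mu>
    assume KQ: "is_Ker C A B \<xi> K k" "is_Cok C A B \<xi> Q q"
      and \<mu>: "generator_along C A B \<xi> \<mu>" "normalized_along C \<xi> \<mu>"
    then have int: "integral_along C A B \<xi> \<mu>" by (simp add: generator_along_def)
    show "\<exists>\<phi>. normalized_integral C K \<phi>" "\<exists>\<psi>. normalized_cointegral C Q \<psi>"
      using normalized_integral_kernel_cokernel[OF assms(2,3) st KQ int \<mu>(2)] by blast+
  next
    fix K k Q q \<phi> \<psi>
    assume "is_Ker C A B \<xi> K k" "is_Cok C A B \<xi> Q q"
      "normalized_integral C K \<phi>" "normalized_cointegral C Q \<psi>"
    then obtain \<mu> where "integral_along C A B \<xi> \<mu>" "normalized_along C \<xi> \<mu>"
      using normalized_integral_exists[OF assms(2,3) st assms(5-10)] by blast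
    then show "\<exists>\<mu>. generator_along C A B \<xi> \<mu> \<and> normalized_along C \<xi> \<mu>"
      using normalized_generator by blast
  next
    fix \<mu> \<mu>'
    assume "integral_along C A B \<xi> \<mu>" "normalized_along C \<xi> \<mu>"
      "integral_along C A B \<xi> \<mu>'" "normalized_along C \<xi> \<mu>'"
    then show "\<mu> = \<mu>'" by (rule normalized_integral_unique)
  qed
qed

end
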